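(* Let $\mathsf{C}$ be a finite subcategory of $\mathsf{B}$ satisfying condition ( * ) of the context, and let $R$ be a commutative ring such that $|G|$ is invertible in $R$ for every $G\in\mathrm{Ob}(\mathsf{C})$. Let $\mathcal{S}$ be a set of representatives of the isomorphism classes of sections $(P,K)$ of groups $G\in\mathrm{Ob}(\mathsf{C})$ with $e_{(P,K)}\in\mathsf{C}_{G,G}$, and for each $(P,K)\in\mathcal{S}$ let $\mathcal{T}_{(P,K)}$ denote a set of representatives of the isomorphism classes of simple left $R[\mathrm{Aut}_{\mathsf{C}}(P/K)]$-modules. Set $A:=A_{\mathsf{C},R}^\kappa$. Then the map $$((P,K),T)\mapsto \mathrm{Hd}\bigl(Ae'_{(P,K)}\otimes_{e'_{(P,K)}Ae'_{(P,K)}}\tilde{T}\bigr)$$ induces a bijection between the set of pairs $((P,K),T)$, where $(P,K)\in\mathcal{S}$ and $T\in\mathcal{T}_{(P,K)}$, and the set of isomorphism classes of simple left $A$-modules. Here $\tilde T=\mathrm{Inf}_{R_\kappa\Gamma_{e_{(P,K)}}}^{e'_{(P,K)}Ae'_{(P,K)}}(T)$ denotes $T$, viewed as an $R_\kappa\Gamma_{e_{(P,K)}}$-module via the isomorphism $R\mathrm{Aut}_{\mathsf{C}}(P/K)\cong R_\kappa\Gamma_{e_{(P,K)}}$, $\alpha\mapsto[G:K]\cdot(P,K,\alpha,P,K)$, and then inflated to $e'_{(P,K)}Ae'_{(P,K)}$ along the decomposition $e'_{(P,K)}Ae'_{(P,K)}=R_\kappa\Gamma_{e_{(P,K)}}\oplus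 RJ_{e_{(P,K)}}$.
   Context: All groups are finite. A section of $G$ is a pair $(P,K)$ with $K\unlhd P\le G$; sections $(P_1,K_1)$ of $G$ and $(P_2,K_2)$ of $G'$ are isomorphic if $P_1/K_1\cong P_2/K_2$. For $L\le G\times H$: $p_1(L),p_2(L)$ are the images under the projections to $G$, $H$; $k_1(L)=\{g\mid(g,1)\in L\}$, $k_2(L)=\{h\mid(1,h)\in L\}$; $q(L)$ is the common isomorphism class of $p_1(L)/k_1(L)\cong p_2(L)/k_2(L)$. For sections $(B,A)$ of $G$, $(D,C)$ of $H$ and an isomorphism $\eta\colon D/C\to B/A$, $(B,A,\eta,D,C)$ denotes the subgroup $\{(g,h)\in B\times D\mid\eta(hC)=gA\}$ of $G\times H$; every subgroup of $G\times H$ has a unique such form. For $L\le G\times H$, $M\le H\times K$ put $L*M=\{(g,k)\in G\times K\mid\exists h\in H:(g,h)\in L,(h,k)\in M\}$. $\mathsf{B}$ is a category whose objects form a set of finite groups in which every isomorphism type of finite group is represented, with $\mathrm{Hom}_{\mathsf{B}}(H,G)=\mathscr{S}_{G\times H}$ (the set of subgroups of $G\times H$) and composition $L\circ M=L*M$; the identity of $G$ is $\Delta(G)=\{(g,g)\}$. For a subcategory $\mathsf{C}$ write $\mathsf{C}_{G,H}=\mathrm{Hom}_{\mathsf{C}}(H,G)$. A category is finite if its set of morphisms is finite. A finite group $Q$ is realized in $\mathsf{C}$ if there are $G,H\in\mathrm{Ob}(\mathsf{C})$ and $L\in\mathsf{C}_{G,H}$ with $q(L)=[Q]$. Condition ( *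 ): if $Q$ is realized in $\mathsf{C}$, $G,H\in\mathrm{Ob}(\mathsf{C})$, and $(P_1,K_1)$, $(P_2,K_2)$ are sections of $G$, $H$ with $P_1/K_1\cong Q\cong P_2/K_2$, then there exists an isomorphism $\alpha\colon P_2/K_2\to P_1/K_1$ with $(P_1,K_1,\alpha,P_2,K_2)\in\mathsf{C}_{G,H}$. $A_{\mathsf{C},R}^\kappa=R_\kappa\mathsf{C}$ is the twisted category algebra: the free $R$-module on the morphisms of $\mathsf{C}$ with product $L\cdot M=\kappa(L,M)\,(L*M)$, $\kappa(L,M)=\frac{|k_2(L)\cap k_1(M)|}{|H|}$, for $L\in\mathsf{C}_{G,H}$, $M\in\mathsf{C}_{H,K}$, and product $0$ for non-composable morphisms. For a section $(P,K)$ of $G\in\mathrm{Ob}(\mathsf C)$: $e_{(P,K)}:=(P,K,\mathrm{id}_{P/K},P,K)$, an idempotent of $(\mathscr{S}_{G\times G},* )$. If $e=e_{(P,K)}\in\mathsf{C}_{G,G}$, put $e'_{(P,K)}:=[G:K]\cdot e_{(P,K)}$, an idempotent of $A$; $\mathrm{Aut}_{\mathsf{C}}(P/K):=\{\alpha\in\mathrm{Aut}(P/K)\mid(P,K,\alpha,P,K)\in\mathsf{C}_{G,G}\}$; $\Gamma_e$ is the group of invertible elements of the monoid $e*\mathsf{C}_{G,G}*e$ (with identity $e$), which equals $\{(P,K,\alpha,P,K)\mid\alpha\in\mathrm{Aut}_{\mathsf{C}}(P/K)\}$; $J_e:=(e*\mathsf{C}_{G,G}*e)\smallsetminus\Gamma_e$;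 $R_\kappa\Gamma_e$ is the $R$-span of $\Gamma_e$ in $A$ (a unitary subalgebra of $e'_{(P,K)}Ae'_{(P,K)}$) and $RJ_e$ is the $R$-span of $J_e$, an ideal of $e'_{(P,K)}Ae'_{(P,K)}$. For a module $M$, $\mathrm{Hd}(M)=M/\mathrm{Rad}(M)$, where $\mathrm{Rad}(M)$ is the intersection of all maximal submodules. *)

theory Defs
  imports "HOL-Algebra.Module" "HOL-Algebra.AbelCoset" "HOL-Algebra.Generated_Groups"
    "HOL-Algebra.Free_Abelian_Groups" "HOL-Algebra.Bij"
begin

section \<open>Modules over rings that need not be commutative\<close>

text \<open>
  The library locale \<^locale>\<open>module\<close> requires a commutative ring of scalars.  Its record type is
  reused here; as in the library, the ring multiplication and unit that this record carries play no
  role, and the modules constructed below leave them undefined.  The library locale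
  \<^locale>\<open>submodule\<close> makes sense over any ring of scalars.
\<close>

locale left_module = A?: ring A + M?: abelian_group M
  for A :: "('a, 'b) ring_scheme" (structure) and M :: "('a, 'm, 'c) module_scheme" (structure) +
  assumes smult_closed [simp, intro]:
      "\<lbrakk>a \<in> carrier A; x \<in> carrier M\<rbrakk> \<Longrightarrow> a \<odot>\<^bsub>M\<^esub> x \<in> carrier M"
    and smult_l_distr:
      "\<lbrakk>a \<in> carrier A; b \<in> carrier A; x \<in> carrier M\<rbrakk> \<Longrightarrow>
        (a \<oplus> b) \<odot>\<^bsub>M\<^esub> x = a \<odot>\<^bsub>M\<^esub> x \<oplus>\<^bsub>M\<^esub> b \<odot>\<^bsub>M\<^esub> x"
    and smult_r_distr:
      "\<lbrakk>a \<in> carrier A; x \<in> carrier M; y \<in> carrier M\<rbrakk> \<Longrightarrow>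
        a \<odot>\<^bsub>M\<^esub> (x \<oplus>\<^bsub>M\<^esub> y) = a \<odot>\<^bsub>M\<^esub> x \<oplus>\<^bsub>M\<^esub> a \<odot>\<^bsub>M\<^esub> y"
    and smult_assoc:
      "\<lbrakk>a \<in> carrier A; b \<in> carrier A; x \<in> carrier M\<rbrakk> \<Longrightarrow>
        (a \<otimes> b) \<odot>\<^bsub>M\<^esub> x = a \<odot>\<^bsub>M\<^esub> (b \<odot>\<^bsub>M\<^esub> x)"
    and smult_one [simp]: "x \<in> carrier M \<Longrightarrow> \<one> \<odot>\<^bsub>M\<^esub> x = x"

definition module_iso :: "'a ring \<Rightarrow> ('a, 'm) module \<Rightarrow> ('a, 'n) module \<Rightarrow> bool" where
  "module_iso A M N \<longleftrightarrow>
    (\<exists>f \<in> iso (add_monoid M) (add_monoid N).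
       \<forall>a \<in> carrier A. \<forall>x \<in> carrier M. f (a \<odot>\<^bsub>M\<^esub> x) = a \<odot>\<^bsub>N\<^esub> f x)"

definition simple_module :: "'a ring \<Rightarrow> ('a, 'm) module \<Rightarrow> bool" where
  "simple_module A M \<longleftrightarrow> left_module A M \<and> carrier M \<noteq> {\<zero>\<^bsub>M\<^esub>} \<and>
    (\<forall>N. submodule N A M \<longrightarrow> N = {\<zero>\<^bsub>M\<^esub>} \<or> N = carrier M)"

text \<open>
  A simple \<open>A\<close>-module is isomorphic to \<open>A / I\<close> for a maximal left ideal \<open>I\<close>, whose elements are
  cosets, that is, sets of elements of \<open>A\<close>.  Hence every simple module, whatever the type of its
  elements, has an isomorphic copy with elements of type \<^typ>\<open>'a set\<close> when \<open>A\<close> has elements of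
  type \<^typ>\<open>'a\<close> (lemma below), and isomorphism classes of simple modules are
  formed within that type.
\<close>

lemma simple_module_copy:
  fixes M :: "('a, 'm) module"
  assumes "simple_module A M"
  shows "\<exists>N :: ('a, 'a set) module. simple_module A N \<and> module_iso A M N"
proof -
  interpret left_module A M using assms by (simp add: simple_module_def)
  have "\<zero>\<^bsub>M\<^esub> \<in> carrier M" by simp
  then obtain m where m: "m \<in> carrier M" "m \<noteq> \<zero>\<^bsub>M\<^esub>"
    using assms by (auto simp: simple_module_def)
  have l_null: "\<zero>\<^bsub>A\<^esub> \<odot>\<^bsub>M\<^esub> x = \<zero>\<^bsub>M\<^esub>" if "x \<in> carrier M" for x
  proof -
    have "\<zero>\<^bsub>A\<^esub> \<odot>\<^bsub>M\<^esub> x = \<zero>\<^bsub>A\<^esub> \<odot>\<^bsub>M\<^esub> x \<oplus>\<^bsub>M\<^esub> \<zero>\<^bsub>A\<^esub> \<odot>\<^bsub>M\<^esub> x"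
      using smult_l_distr[of "\<zero>\<^bsub>A\<^esub>" "\<zero>\<^bsub>A\<^esub>" x] that by simp
    then show ?thesis
      using M.add.l_cancel_one'[of "\<zero>\<^bsub>A\<^esub> \<odot>\<^bsub>M\<^esub> x" "\<zero>\<^bsub>A\<^esub> \<odot>\<^bsub>M\<^esub> x"] that by simp
  qed
  have l_minus: "(\<ominus>\<^bsub>A\<^esub> a) \<odot>\<^bsub>M\<^esub> x = \<ominus>\<^bsub>M\<^esub> (a \<odot>\<^bsub>M\<^esub> x)" if "a \<in> carrier A" "x \<in> carrier M" for a x
  proof -
    have "(\<ominus>\<^bsub>A\<^esub> a) \<odot>\<^bsub>M\<^esub> x \<oplus>\<^bsub>M\<^esub> a \<odot>\<^bsub>M\<^esub> x = \<zero>\<^bsub>M\<^esub>"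
      using smult_l_distr[of "\<ominus>\<^bsub>A\<^esub> a" a x] that by (simp add: A.l_neg l_null)
    then show ?thesis using that by (simp add: M.minus_equality)
  qed
  define X where "X = (\<lambda>a. a \<odot>\<^bsub>M\<^esub> m) ` carrier A"
  have "submodule X A M"
  proof (intro submodule.intro submodule_axioms.intro group.subgroupI[OF M.a_group])
    show "X \<subseteq> carrier (add_monoid M)" "X \<noteq> {}" using m by (auto simp: X_def)
    show "inv\<^bsub>add_monoid M\<^esub> a \<in> X" if "a \<in> X" for a
      using that m by (auto simp: X_def a_inv_def[symmetric] l_minus[symmetric])
    show "a \<otimes>\<^bsub>add_monoid M\<^esub> b \<in> X" if "a \<in> X" "b \<in> X" for a b
      using that m by (auto simp: X_def smult_l_distr[symmetric])
    show "a \<odot>\<^bsub>M\<^esub> x \<in> X" if "a \<in> carrier A" "x \<in> X" for a x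
      using that m by (auto simp: X_def smult_assoc[symmetric])
  qed
  moreover have "m \<in> X" using m by (force simp: X_def intro: image_eqI[of _ _ "\<one>\<^bsub>A\<^esub>"])
  ultimately have X: "X = carrier M"
    using assms m by (auto simp: simple_module_def)
  define f where "f x = {a \<in> carrier A. a \<odot>\<^bsub>M\<^esub> m = x}" for x
  define g where "g = inv_into (carrier M) f"
  have inj: "inj_on f (carrier M)"
  proof (rule inj_onI)
    fix x y assume "x \<in> carrier M" and fxy: "f x = f y"
    then have "x \<in> X" using X by simp
    then obtain a where "a \<in> f x" by (auto simp: X_def f_def)
    then show "x = y" using fxy by (auto simp: f_def)
  qed
  have gf [simp]: "g (f x) = x" if "x \<in> carrier M" for x
    using that inj by (simp add: g_def)
  define N :: "('a, 'a set) module" where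
    "N = \<lparr>carrier = f ` carrier M, mult = undefined, one = undefined, ring.zero = f \<zero>\<^bsub>M\<^esub>,
          add = (\<lambda>U V. f (g U \<oplus>\<^bsub>M\<^esub> g V)), smult = (\<lambda>a U. f (a \<odot>\<^bsub>M\<^esub> g U))\<rparr>"
  have N [simp]: "carrier N = f ` carrier M" "ring.zero N = f \<zero>\<^bsub>M\<^esub>"
    "add N U V = f (g U \<oplus>\<^bsub>M\<^esub> g V)" "smult N a U = f (a \<odot>\<^bsub>M\<^esub> g U)" for U V a
    by (simp_all add: N_def)
  have "abelian_group N"
  proof (rule abelian_groupI)
    show "x \<oplus>\<^bsub>N\<^esub> y \<oplus>\<^bsub>N\<^esub> z = x \<oplus>\<^bsub>N\<^esub> (y \<oplus>\<^bsub>N\<^esub> z)"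
      if "x \<in> carrier N" "y \<in> carrier N" "z \<in> carrier N" for x y z
      using that by (auto simp: M.a_assoc)
    show "x \<oplus>\<^bsub>N\<^esub> y = y \<oplus>\<^bsub>N\<^esub> x" if "x \<in> carrier N" "y \<in> carrier N" for x y
      using that by (auto simp: M.a_comm)
    show "\<exists>y\<in>carrier N. y \<oplus>\<^bsub>N\<^esub> x = \<zero>\<^bsub>N\<^esub>" if "x \<in> carrier N" for x
    proof -
      obtain z where "z \<in> carrier M" "x = f z" using \<open>x \<in> carrier N\<close> by auto
      then show ?thesis by (intro bexI[of _ "f (\<ominus>\<^bsub>M\<^esub> z)"]) (simp_all add: M.l_neg)
    qed
  qed auto
  then have lN: "left_module A N"
    unfolding left_module_def left_module_axioms_def
    by (auto simp: smult_l_distr smult_r_distr smult_assoc A.ring_axioms)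
  have "f \<in> iso (add_monoid M) (add_monoid N)"
    using inj by (auto simp: iso_def hom_def bij_betw_def)
  then have iso: "module_iso A M N" unfolding module_iso_def by (rule bexI[rotated]) simp
  have "Y = {\<zero>\<^bsub>N\<^esub>} \<or> Y = carrier N" if Y: "submodule Y A N" for Y
  proof -
    interpret N: left_module A N by (rule lN)
    have sub: "subgroup Y (add_monoid N)" using Y by (rule submodule.axioms)
    have Ysub: "Y \<subseteq> f ` carrier M" using subgroup.subset[OF sub] by simp
    have minus: "f (\<ominus>\<^bsub>M\<^esub> x) = \<ominus>\<^bsub>N\<^esub> (f x)" if "x \<in> carrier M" for x
      using that by (intro N.minus_equality[symmetric]) (auto simp: M.l_neg)
    have "submodule {x \<in> carrier M. f x \<in> Y} A M"
    proof (intro submodule.intro submodule_axioms.intro group.subgroupI[OF M.a_group])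
      show "{x \<in> carrier M. f x \<in> Y} \<noteq> {}"
        using subgroup.one_closed[OF sub] by auto
      show "inv\<^bsub>add_monoid M\<^esub> a \<in> {x \<in> carrier M. f x \<in> Y}" if "a \<in> {x \<in> carrier M. f x \<in> Y}" for a
        using that subgroup.m_inv_closed[OF sub, folded a_inv_def]
        by (auto simp: minus a_inv_def[symmetric])
      show "a \<otimes>\<^bsub>add_monoid M\<^esub> b \<in> {x \<in> carrier M. f x \<in> Y}"
        if "a \<in> {x \<in> carrier M. f x \<in> Y}" "b \<in> {x \<in> carrier M. f x \<in> Y}" for a b
        using that subgroup.m_closed[OF sub, of "f a" "f b"] by auto
      show "a \<odot>\<^bsub>M\<^esub> x \<in> {x \<in> carrier M. f x \<in> Y}"
        if "a \<in> carrier A" "x \<in> {x \<in> carrier M. f x \<in> Y}" for a x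
        using that submodule.smult_closed[OF Y, of a "f x"] by auto
    qed auto
    then have "{x \<in> carrier M. f x \<in> Y} = {\<zero>\<^bsub>M\<^esub>} \<or> {x \<in> carrier M. f x \<in> Y} = carrier M"
      using assms by (auto simp: simple_module_def)
    then show ?thesis
    proof
      have Y: "Y = f ` {x \<in> carrier M. f x \<in> Y}" using Ysub by auto
      assume "{x \<in> carrier M. f x \<in> Y} = {\<zero>\<^bsub>M\<^esub>}"
      with Y have "Y = {\<zero>\<^bsub>N\<^esub>}" by simp
      then show ?thesis ..
    next
      assume "{x \<in> carrier M. f x \<in> Y} = carrier M"
      with Ysub have "Y = carrier N" by auto
      then show ?thesis ..
    qed
  qed
  moreover have "carrier N \<noteq> {\<zero>\<^bsub>N\<^esub>}"
  proof
    assume "carrier N = {\<zero>\<^bsub>N\<^esub>}"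
    then have "f m = f \<zero>\<^bsub>M\<^esub>" using m by auto
    then show False using inj m by (auto dest: inj_onD)
  qed
  ultimately show ?thesis using lN iso unfolding simple_module_def by blast
qed

definition iso_class :: "'a ring \<Rightarrow> ('a, 'm) module \<Rightarrow> ('a, 'a set) module set" where
  "iso_class A M = {N. simple_module A N \<and> module_iso A N M}"

definition simple_iso_classes :: "'a ring \<Rightarrow> ('a, 'a set) module set set" where
  "simple_iso_classes A = {iso_class A M | M :: ('a, 'a set) module. simple_module A M}"

definition simple_representatives :: "'a ring \<Rightarrow> ('a, 'm) module set \<Rightarrow> bool" where
  "simple_representatives A T \<longleftrightarrow>
    (\<forall>M\<in>T. simple_module A M) \<and>
    (\<forall>M\<in>T. \<forall>N\<in>T. module_iso A M N \<longrightarrow> M = N) \<and>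
    (\<forall>N :: ('a, 'a set) module. simple_module A N \<longrightarrow> (\<exists>M\<in>T. module_iso A N M))"

definition maximal_submodule :: "'a ring \<Rightarrow> ('a, 'm) module \<Rightarrow> 'm set \<Rightarrow> bool" where
  "maximal_submodule A M N \<longleftrightarrow> submodule N A M \<and> N \<noteq> carrier M \<and>
    (\<forall>L. submodule L A M \<longrightarrow> N \<subseteq> L \<longrightarrow> L = N \<or> L = carrier M)"

text \<open>Intersecting with the carrier gives \<open>Rad M = M\<close> if there are no maximal submodules.\<close>

definition Rad :: "'a ring \<Rightarrow> ('a, 'm) module \<Rightarrow> 'm set" where
  "Rad A M = carrier M \<inter> \<Inter>{N. maximal_submodule A M N}"

definition quotient_module :: "('a, 'm) module \<Rightarrow> 'm set \<Rightarrow> ('a, 'm set) module" where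
  "quotient_module M N =
    \<lparr>carrier = a_rcosets\<^bsub>M\<^esub> N, mult = undefined, one = undefined,
     ring.zero = N, add = set_add M,
     smult = (\<lambda>a U. \<Union>u\<in>U. N +>\<^bsub>M\<^esub> (a \<odot>\<^bsub>M\<^esub> u))\<rparr>"

definition Hd :: "'a ring \<Rightarrow> ('a, 'm) module \<Rightarrow> ('a, 'm set) module" where
  "Hd A M = quotient_module M (Rad A M)"

definition pullback :: "('b \<Rightarrow> 'a) \<Rightarrow> ('a, 'm) module \<Rightarrow> ('b, 'm) module" where
  "pullback f M =
    \<lparr>carrier = carrier M, mult = undefined, one = undefined,
     ring.zero = \<zero>\<^bsub>M\<^esub>, add = add M, smult = (\<lambda>b x. f b \<odot>\<^bsub>M\<^esub> x)\<rparr>"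

text \<open>
  The tensor product over \<open>S\<close> of a left module \<open>X\<close> carrying the right \<open>S\<close>-action \<open>rho\<close> with a left
  \<open>S\<close>-module \<open>M\<close>: the free abelian group on pairs modulo the subgroup generated by the usual
  relations, with scalars acting on the first factor.
\<close>

definition tensor_relations ::
  "'s ring \<Rightarrow> ('a, 'x) module \<Rightarrow> ('x \<Rightarrow> 's \<Rightarrow> 'x) \<Rightarrow> ('s, 'm) module \<Rightarrow> (('x \<times> 'm) \<Rightarrow>\<^sub>0 int) set" where
  "tensor_relations S X rho M =
    {frag_of (x \<oplus>\<^bsub>X\<^esub> y, t) - frag_of (x, t) - frag_of (y, t) | x y t.
       x \<in> carrier X \<and> y \<in> carrier X \<and> t \<in> carrier M} \<union>
    {frag_of (x, s \<oplus>\<^bsub>M\<^esub> t) - frag_of (x, s) - frag_of (x, t) | x s t.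
       x \<in> carrier X \<and> s \<in> carrier M \<and> t \<in> carrier M} \<union>
    {frag_of (rho x b, t) - frag_of (x, b \<odot>\<^bsub>M\<^esub> t) | x b t.
       x \<in> carrier X \<and> b \<in> carrier S \<and> t \<in> carrier M}"

definition tensor ::
  "'s ring \<Rightarrow> ('a, 'x) module \<Rightarrow> ('x \<Rightarrow> 's \<Rightarrow> 'x) \<Rightarrow> ('s, 'm) module
    \<Rightarrow> ('a, (('x \<times> 'm) \<Rightarrow>\<^sub>0 int) set) module" where
  "tensor S X rho M =
    (let F = free_Abelian_group (carrier X \<times> carrier M);
         N = generate F (tensor_relations S X rho M)
     in \<lparr>carrier = rcosets\<^bsub>F\<^esub> N, mult = undefined, one = undefined,
         ring.zero = N, add = set_mult F,
         smult = (\<lambda>a U. \<Union>u\<in>U. N #>\<^bsub>F\<^esub> frag_extend (\<lambda>(x, t). frag_of (a \<odot>\<^bsub>X\<^esub> x, t)) u)\<rparr>)"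

text \<open>The left module \<open>Ae\<close> and the ring \<open>eAe\<close> for an idempotent \<open>e\<close> of \<open>A\<close>.\<close>

definition left_ideal_module :: "'a ring \<Rightarrow> 'a \<Rightarrow> ('a, 'a) module" where
  "left_ideal_module A e =
    \<lparr>carrier = {a \<otimes>\<^bsub>A\<^esub> e | a. a \<in> carrier A}, mult = undefined, one = undefined,
     ring.zero = \<zero>\<^bsub>A\<^esub>, add = add A, smult = mult A\<rparr>"

definition corner_ring :: "'a ring \<Rightarrow> 'a \<Rightarrow> 'a ring" where
  "corner_ring A e =
    A\<lparr>carrier := {e \<otimes>\<^bsub>A\<^esub> a \<otimes>\<^bsub>A\<^esub> e | a. a \<in> carrier A}, one := e\<rparr>"


section \<open>Algebras with a finite basis\<close>

text \<open>
  The free \<open>R\<close>-module on a finite set \<open>X\<close>, realized as the functions from \<open>X\<close> to \<open>R\<close>, with the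
  bilinear product given on basis elements by \<open>x y = (c x y) (op x y)\<close>, and with unit \<open>u\<close>.  Where
  \<open>c x y = 0\<close> the value \<open>op x y\<close> is irrelevant.
\<close>

definition basis_algebra ::
  "'r ring \<Rightarrow> 'x set \<Rightarrow> ('x \<Rightarrow> 'x \<Rightarrow> 'r) \<Rightarrow> ('x \<Rightarrow> 'x \<Rightarrow> 'x) \<Rightarrow> ('x \<Rightarrow> 'r) \<Rightarrow> ('x \<Rightarrow> 'r) ring" where
  "basis_algebra R X c op u =
    \<lparr>carrier = X \<rightarrow>\<^sub>E carrier R,
     mult = (\<lambda>f g. \<lambda>z\<in>X. \<Oplus>\<^bsub>R\<^esub>p \<in> {(x, y). x \<in> X \<and> y \<in> X \<and> op x y = z}.
               c (fst p) (snd p) \<otimes>\<^bsub>R\<^esub> (f (fst p) \<otimes>\<^bsub>R\<^esub> g (snd p))),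
     one = u,
     ring.zero = (\<lambda>x\<in>X. \<zero>\<^bsub>R\<^esub>),
     add = (\<lambda>f g. \<lambda>x\<in>X. f x \<oplus>\<^bsub>R\<^esub> g x)\<rparr>"

definition monomial :: "'r ring \<Rightarrow> 'x set \<Rightarrow> 'r \<Rightarrow> 'x \<Rightarrow> 'x \<Rightarrow> 'r" where
  "monomial R X r x = (\<lambda>y\<in>X. if y = x then r else \<zero>\<^bsub>R\<^esub>)"

text \<open>The \<open>R\<close>-span of a subset \<open>Y\<close> of the basis \<open>X\<close>.\<close>

definition basis_span :: "'r ring \<Rightarrow> 'x set \<Rightarrow> 'x set \<Rightarrow> ('x \<Rightarrow> 'r) set" where
  "basis_span R X Y = {f \<in> X \<rightarrow>\<^sub>E carrier R. \<forall>x \<in> X - Y. f x = \<zero>\<^bsub>R\<^esub>}"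

definition group_algebra :: "'r ring \<Rightarrow> 'x monoid \<Rightarrow> ('x \<Rightarrow> 'r) ring" where
  "group_algebra R \<Gamma> =
    basis_algebra R (carrier \<Gamma>) (\<lambda>_ _. \<one>\<^bsub>R\<^esub>) (mult \<Gamma>) (monomial R (carrier \<Gamma>) \<one>\<^bsub>R\<^esub> \<one>\<^bsub>\<Gamma>\<^esub>)"

abbreviation nat_in :: "'r ring \<Rightarrow> nat \<Rightarrow> 'r" where
  "nat_in R n \<equiv> [n] \<cdot>\<^bsub>R\<^esub> \<one>\<^bsub>R\<^esub>"


section \<open>Sections and subgroups of direct products\<close>

definition is_section :: "'g monoid \<Rightarrow> 'g set \<Rightarrow> 'g set \<Rightarrow> bool" where
  "is_section G P K \<longleftrightarrow> subgroup P G \<and> K \<lhd> G\<lparr>carrier := P\<rparr>"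

definition sec_quot :: "'g monoid \<Rightarrow> 'g set \<Rightarrow> 'g set \<Rightarrow> 'g set monoid" where
  "sec_quot G P K = G\<lparr>carrier := P\<rparr> Mod K"

definition p1 :: "('g \<times> 'h) set \<Rightarrow> 'g set" where
  "p1 L = fst ` L"

definition k1 :: "'h monoid \<Rightarrow> ('g \<times> 'h) set \<Rightarrow> 'g set" where
  "k1 H L = {g. (g, \<one>\<^bsub>H\<^esub>) \<in> L}"

definition k2 :: "'g monoid \<Rightarrow> ('g \<times> 'h) set \<Rightarrow> 'h set" where
  "k2 G L = {h. (\<one>\<^bsub>G\<^esub>, h) \<in> L}"

text \<open>
  The subgroup \<open>(B, A, \<eta>, D, E)\<close> of \<open>G \<times> H\<close>.  The library builds quotient groups from right cosets;
  they agree with the left cosets because \<open>A\<close> and \<open>E\<close> are normal in \<open>B\<close> and \<open>D\<close>.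
\<close>

definition goursat ::
  "'g monoid \<Rightarrow> 'h monoid \<Rightarrow> 'g set \<Rightarrow> 'g set \<Rightarrow> ('h set \<Rightarrow> 'g set) \<Rightarrow> 'h set \<Rightarrow> 'h set \<Rightarrow> ('g \<times> 'h) set"
  where
  "goursat G H B A \<eta> D E = {(g, h). g \<in> B \<and> h \<in> D \<and> \<eta> (E #>\<^bsub>H\<^esub> h) = A #>\<^bsub>G\<^esub> g}"

definition e_sec :: "'g monoid \<Rightarrow> 'g set \<Rightarrow> 'g set \<Rightarrow> ('g \<times> 'g) set" where
  "e_sec G P K = goursat G G P K id P K"


section \<open>The category of finite groups and its subcategories\<close>

text \<open>
  \<open>Hom C G H\<close> is the set of morphisms from \<open>H\<close> to \<open>G\<close>, consisting of subgroups of \<open>G \<times> H\<close>.  Since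
  such a subgroup is a relation between \<open>G\<close> and \<open>H\<close>, the composition \<open>L * M\<close> is the relational
  composition \<open>L O M\<close>.  Elements of groups all have the same type \<^typ>\<open>'g\<close>.
\<close>

record 'g subgroup_category =
  Ob :: "'g monoid set"
  Hom :: "'g monoid \<Rightarrow> 'g monoid \<Rightarrow> ('g \<times> 'g) set set"

text \<open>Every finite group is isomorphic to one whose elements are natural numbers.\<close>

definition represents_finite_groups :: "'g monoid set \<Rightarrow> bool" where
  "represents_finite_groups \<O> \<longleftrightarrow>
    (\<forall>G\<in>\<O>. group G \<and> finite (carrier G)) \<and>
    (\<forall>Q :: nat monoid. group Q \<longrightarrow> finite (carrier Q) \<longrightarrow> (\<exists>G\<in>\<O>. G \<cong> Q))"

definition category_B :: "'g monoid set \<Rightarrow> 'g subgroup_category" where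
  "category_B \<O> = \<lparr>Ob = \<O>, Hom = (\<lambda>G H. {L. subgroup L (G \<times>\<times> H)})\<rparr>"

definition subcategory :: "'g subgroup_category \<Rightarrow> 'g subgroup_category \<Rightarrow> bool" where
  "subcategory C B \<longleftrightarrow>
    Ob C \<subseteq> Ob B \<and>
    (\<forall>G\<in>Ob C. \<forall>H\<in>Ob C. Hom C G H \<subseteq> Hom B G H) \<and>
    (\<forall>G\<in>Ob C. Id_on (carrier G) \<in> Hom C G G) \<and>
    (\<forall>G\<in>Ob C. \<forall>H\<in>Ob C. \<forall>K\<in>Ob C. \<forall>L\<in>Hom C G H. \<forall>M\<in>Hom C H K. L O M \<in> Hom C G K)"

text \<open>Morphisms carry their codomain and domain, so that distinct Hom-sets are disjoint.\<close>

type_synonym 'g morphism = "'g monoid \<times> ('g \<times> 'g) set \<times> 'g monoid"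

definition Mor :: "'g subgroup_category \<Rightarrow> 'g morphism set" where
  "Mor C = {(G, L, H). G \<in> Ob C \<and> H \<in> Ob C \<and> L \<in> Hom C G H}"

definition finite_category :: "'g subgroup_category \<Rightarrow> bool" where
  "finite_category C \<longleftrightarrow> finite (Mor C)"

text \<open>
  \<open>p1(L)/k1(L)\<close> represents the isomorphism class \<open>q(L)\<close>.
\<close>

definition realized :: "'g subgroup_category \<Rightarrow> 'q monoid \<Rightarrow> bool" where
  "realized C Q \<longleftrightarrow> group Q \<and> finite (carrier Q) \<and>
    (\<exists>G\<in>Ob C. \<exists>H\<in>Ob C. \<exists>L\<in>Hom C G H. sec_quot G (p1 L) (k1 H L) \<cong> Q)"

text \<open>
  The group \<open>Q\<close> matters only up to isomorphism, and a realized group is isomorphic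
  to some \<open>p1(L)/k1(L)\<close>, whose elements have type \<^typ>\<open>'g set\<close>.
\<close>

definition condition_star :: "'g subgroup_category \<Rightarrow> bool" where
  "condition_star C \<longleftrightarrow>
    (\<forall>Q :: 'g set monoid. realized C Q \<longrightarrow>
      (\<forall>G\<in>Ob C. \<forall>H\<in>Ob C. \<forall>P1 K1 P2 K2.
         is_section G P1 K1 \<longrightarrow> is_section H P2 K2 \<longrightarrow>
         sec_quot G P1 K1 \<cong> Q \<longrightarrow> Q \<cong> sec_quot H P2 K2 \<longrightarrow>
         (\<exists>\<alpha> \<in> iso (sec_quot H P2 K2) (sec_quot G P1 K1).
            goursat G H P1 K1 \<alpha> P2 K2 \<in> Hom C G H)))"

text \<open>A section \<open>(P, K)\<close> is recorded together with the group \<open>G\<close> of which it is a section.\<close>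

definition C_sections :: "'g subgroup_category \<Rightarrow> ('g monoid \<times> 'g set \<times> 'g set) set" where
  "C_sections C =
    {(G, P, K). G \<in> Ob C \<and> is_section G P K \<and> e_sec G P K \<in> Hom C G G}"

definition section_iso ::
  "'g monoid \<times> 'g set \<times> 'g set \<Rightarrow> 'g monoid \<times> 'g set \<times> 'g set \<Rightarrow> bool" where
  "section_iso = (\<lambda>(G, P, K) (G', P', K'). sec_quot G P K \<cong> sec_quot G' P' K')"

definition section_representatives ::
  "'g subgroup_category \<Rightarrow> ('g monoid \<times> 'g set \<times> 'g set) set \<Rightarrow> bool" where
  "section_representatives C S \<longleftrightarrow>
    S \<subseteq> C_sections C \<and>
    (\<forall>s\<in>S. \<forall>s'\<in>S. section_iso s s' \<longrightarrow> s = s') \<and>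
    (\<forall>s\<in>C_sections C. \<exists>s'\<in>S. section_iso s s')"

text \<open>The library's automorphism groups consist of functions extensional on the carrier.\<close>

definition Aut_C ::
  "'g subgroup_category \<Rightarrow> 'g monoid \<times> 'g set \<times> 'g set \<Rightarrow> ('g set \<Rightarrow> 'g set) monoid" where
  "Aut_C C = (\<lambda>(G, P, K).
    (AutoGroup (sec_quot G P K))
      \<lparr>carrier := {\<alpha> \<in> auto (sec_quot G P K). goursat G G P K \<alpha> P K \<in> Hom C G G}\<rparr>)"


section \<open>The twisted category algebra\<close>

definition kappa :: "'r ring \<Rightarrow> 'g morphism \<Rightarrow> 'g morphism \<Rightarrow> 'r" where
  "kappa R = (\<lambda>(G, L, H) (H', M, K).
    if H = H' then nat_in R (card (k2 G L \<inter> k1 K M)) \<otimes>\<^bsub>R\<^esub> inv\<^bsub>R\<^esub> (nat_in R (order H))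
    else \<zero>\<^bsub>R\<^esub>)"

definition comp_mor :: "'g morphism \<Rightarrow> 'g morphism \<Rightarrow> 'g morphism" where
  "comp_mor = (\<lambda>(G, L, H) (H', M, K). (G, L O M, K))"

text \<open>
  The unit is the sum of the elements \<open>|G| \<Delta>(G)\<close>, because \<open>\<kappa>(L, \<Delta>(H)) = \<kappa>(\<Delta>(H), M) = 1/|H|\<close>.
\<close>

definition twisted_algebra ::
  "'g subgroup_category \<Rightarrow> 'r ring \<Rightarrow> ('g morphism \<Rightarrow> 'r) ring" where
  "twisted_algebra C R =
    basis_algebra R (Mor C) (kappa R) comp_mor
      (restrict (\<lambda>(G, L, H). if G = H \<and> L = Id_on (carrier G) then nat_in R (order G) else \<zero>\<^bsub>R\<^esub>)
        (Mor C))"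

definition e_prime ::
  "'g subgroup_category \<Rightarrow> 'r ring \<Rightarrow> 'g monoid \<times> 'g set \<times> 'g set \<Rightarrow> 'g morphism \<Rightarrow> 'r" where
  "e_prime C R = (\<lambda>(G, P, K).
    monomial R (Mor C) (nat_in R (card (rcosets\<^bsub>G\<^esub> K))) (G, e_sec G P K, G))"

text \<open>The monoid \<open>e * C(G,G) * e\<close>, its group of units \<open>\<Gamma>\<^sub>e\<close> and the complement \<open>J\<^sub>e\<close>.\<close>

definition local_monoid ::
  "'g subgroup_category \<Rightarrow> 'g monoid \<times> 'g set \<times> 'g set \<Rightarrow> ('g \<times> 'g) set monoid" where
  "local_monoid C = (\<lambda>(G, P, K).
    \<lparr>carrier = {e_sec G P K O L O e_sec G P K | L. L \<in> Hom C G G},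
     mult = (O), one = e_sec G P K\<rparr>)"

definition Gamma :: "'g subgroup_category \<Rightarrow> 'g monoid \<times> 'g set \<times> 'g set \<Rightarrow> 'g morphism set" where
  "Gamma C s = {(fst s, L, fst s) | L. L \<in> Units (local_monoid C s)}"

definition J_set :: "'g subgroup_category \<Rightarrow> 'g monoid \<times> 'g set \<times> 'g set \<Rightarrow> 'g morphism set" where
  "J_set C s = {(fst s, L, fst s) | L. L \<in> carrier (local_monoid C s) - Units (local_monoid C s)}"

text \<open>
  The linear map \<open>R Aut\<^sub>C(P/K) \<rightarrow> A\<close>, \<open>\<alpha> \<mapsto> [G : K] (P, K, \<alpha>, P, K)\<close>, an isomorphism onto the span
  of \<open>\<Gamma>\<^sub>e\<close>.
\<close>

definition aut_embed ::
  "'g subgroup_category \<Rightarrow> 'r ring \<Rightarrow> 'g monoid \<times> 'g set \<times> 'g set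
    \<Rightarrow> (('g set \<Rightarrow> 'g set) \<Rightarrow> 'r) \<Rightarrow> 'g morphism \<Rightarrow> 'r" where
  "aut_embed C R = (\<lambda>(G, P, K) f.
    \<Oplus>\<^bsub>twisted_algebra C R\<^esub>\<alpha> \<in> carrier (Aut_C C (G, P, K)).
      monomial R (Mor C) (f \<alpha> \<otimes>\<^bsub>R\<^esub> nat_in R (card (rcosets\<^bsub>G\<^esub> K))) (G, goursat G G P K \<alpha> P K, G))"

text \<open>The projection \<open>e'Ae' = R\<Gamma>\<^sub>e \<oplus> RJ\<^sub>e \<rightarrow> R\<Gamma>\<^sub>e\<close>.\<close>

definition Gamma_proj ::
  "'g subgroup_category \<Rightarrow> 'r ring \<Rightarrow> 'g monoid \<times> 'g set \<times> 'g set
    \<Rightarrow> ('g morphism \<Rightarrow> 'r) \<Rightarrow> 'g morphism \<Rightarrow> 'r" where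
  "Gamma_proj C R s x =
    (THE y. y \<in> basis_span R (Mor C) (Gamma C s) \<and>
      (\<exists>j \<in> basis_span R (Mor C) (J_set C s). x = y \<oplus>\<^bsub>twisted_algebra C R\<^esub> j))"

text \<open>The module \<open>T\<close> viewed as an \<open>R\<Gamma>\<^sub>e\<close>-module, and then inflated to \<open>e'Ae'\<close>.\<close>

definition inflation ::
  "'g subgroup_category \<Rightarrow> 'r ring \<Rightarrow> 'g monoid \<times> 'g set \<times> 'g set
    \<Rightarrow> (('g set \<Rightarrow> 'g set) \<Rightarrow> 'r, 't) module \<Rightarrow> ('g morphism \<Rightarrow> 'r, 't) module" where
  "inflation C R s T =
    pullback (Gamma_proj C R s)
      (pullback (inv_into (carrier (group_algebra R (Aut_C C s))) (aut_embed C R s)) T)"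

definition head_module ::
  "'g subgroup_category \<Rightarrow> 'r ring \<Rightarrow> 'g monoid \<times> 'g set \<times> 'g set
    \<Rightarrow> (('g set \<Rightarrow> 'g set) \<Rightarrow> 'r, 't) module
    \<Rightarrow> ('g morphism \<Rightarrow> 'r, ((('g morphism \<Rightarrow> 'r) \<times> 't) \<Rightarrow>\<^sub>0 int) set set) module" where
  "head_module C R s T =
    (let A = twisted_algebra C R; e' = e_prime C R s
     in Hd A (tensor (corner_ring A e') (left_ideal_module A e') (mult A) (inflation C R s T)))"

end

theory Submission
  imports Defs "HOL-Algebra.Multiplicative_Group"
begin

text \<open>
  The proof attaches to every simple \<open>A\<close>-module \<open>V\<close> an apex: a section \<open>(P, K)\<close> of least order
  \<open>|P / K|\<close> among those whose idempotent \<open>e\<close> acts nontrivially on \<open>V\<close>.  The module is then recovered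
  from the simple module \<open>e'V\<close> of the local algebra \<open>e'Ae'\<close>.

  The value \<open>\<kappa>(L, M)\<close> is a unit of \<open>R\<close> for composable \<open>L\<close> and \<open>M\<close>, because \<open>|k\<^sub>2(L) \<inter> k\<^sub>1(M)|\<close> divides \<open>|H|\<close>.
  So if a morphism annihilates \<open>V\<close>, then so do all its composites.
  Call \<open>|q(L)| = |p\<^sub>1(L)| / |k\<^sub>1(L)|\<close> the rank of \<open>L\<close>; composition does not increase it.  Each \<open>L\<close> is \<open>e * L\<close> for
  the idempotent \<open>e\<close> of \<open>(p\<^sub>1(L), k\<^sub>1(L))\<close>, a section of order \<open>|q(L)|\<close>.  This idempotent belongs to the category:
  condition (*) provides some \<open>(P, K, \<alpha>, P, K)\<close>, and a power of the automorphism \<open>\<alpha>\<close> is the identity.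
  Hence an apex exists, and every morphism of smaller rank annihilates \<open>V\<close> (\<open>apex_exists\<close>).

  An element \<open>L = e\<^sub>t * L * e\<^sub>s\<close> whose rank is the order of both sections \<open>s\<close> and \<open>t\<close> is the graph of an isomorphism between
  them, by Goursat's lemma.  For \<open>s = t\<close> this identifies the units of \<open>e * C(G, G) * e\<close> with \<open>Aut\<^sub>C(P / K)\<close> and shows that
  all other elements have smaller rank, so that they form an ideal and annihilate \<open>V\<close> if \<open>s\<close> is the apex.
  For two apexes \<open>s\<close> and \<open>t\<close> of \<open>V\<close> it gives \<open>s \<cong> t\<close> (\<open>apex_unique\<close>).  Conversely, (*) connects isomorphic sections
  by morphisms whose composite is invertible, so that the apex may be moved to a given representative (\<open>apex_transfer\<close>).

  The rest is the theory of an idempotent \<open>e\<close> of a ring \<open>A\<close>.  If \<open>T\<close> is a simple \<open>eAe\<close>-module, then \<open>Ae \<otimes> T\<close> has a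
  largest proper submodule, and its head \<open>D\<close> is simple with \<open>eD \<cong> T\<close> (\<open>simple_head_tensor\<close>).  A simple module \<open>V\<close> with
  \<open>eV \<noteq> 0\<close> is determined by the simple module \<open>eV\<close> (\<open>simple_modules_iso_if_corners_iso\<close>).  Applied to \<open>e'\<close>, these facts
  reduce the theorem to two statements: the head formed from \<open>(P, K)\<close> and \<open>T\<close> has apex \<open>(P, K)\<close>
  (\<open>apex_head_module\<close>), and if \<open>V\<close> has apex \<open>(P, K)\<close>, then \<open>e'V\<close> is inflated from \<open>R Aut\<^sub>C(P / K)\<close>
  (\<open>inflated_if_J_zero\<close>).
\<close>

section \<open>Modules, submodules and isomorphisms\<close>

context left_module
begin

lemma smult_l_null [simp]: "x \<in> carrier M \<Longrightarrow> \<zero>\<^bsub>A\<^esub> \<odot>\<^bsub>M\<^esub> x = \<zero>\<^bsub>M\<^esub>"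
  using smult_l_distr[of "\<zero>\<^bsub>A\<^esub>" "\<zero>\<^bsub>A\<^esub>" x] M.add.l_cancel_one'[of "\<zero>\<^bsub>A\<^esub> \<odot>\<^bsub>M\<^esub> x" "\<zero>\<^bsub>A\<^esub> \<odot>\<^bsub>M\<^esub> x"]
  by simp

lemma smult_r_null [simp]: "a \<in> carrier A \<Longrightarrow> a \<odot>\<^bsub>M\<^esub> \<zero>\<^bsub>M\<^esub> = \<zero>\<^bsub>M\<^esub>"
  using smult_r_distr[of a "\<zero>\<^bsub>M\<^esub>" "\<zero>\<^bsub>M\<^esub>"] M.add.l_cancel_one'[of "a \<odot>\<^bsub>M\<^esub> \<zero>\<^bsub>M\<^esub>" "a \<odot>\<^bsub>M\<^esub> \<zero>\<^bsub>M\<^esub>"]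
  by simp

lemma smult_r_minus:
  assumes "a \<in> carrier A" "x \<in> carrier M"
  shows "a \<odot>\<^bsub>M\<^esub> (\<ominus>\<^bsub>M\<^esub> x) = \<ominus>\<^bsub>M\<^esub> (a \<odot>\<^bsub>M\<^esub> x)"
proof -
  have "a \<odot>\<^bsub>M\<^esub> (\<ominus>\<^bsub>M\<^esub> x) \<oplus>\<^bsub>M\<^esub> a \<odot>\<^bsub>M\<^esub> x = \<zero>\<^bsub>M\<^esub>"
    using smult_r_distr[of a "\<ominus>\<^bsub>M\<^esub> x" x] assms by (simp add: M.l_neg)
  then show ?thesis using assms by (simp add: M.minus_equality)
qed

lemma smult_l_minus:
  assumes "a \<in> carrier A" "x \<in> carrier M"
  shows "(\<ominus>\<^bsub>A\<^esub> a) \<odot>\<^bsub>M\<^esub> x = \<ominus>\<^bsub>M\<^esub> (a \<odot>\<^bsub>M\<^esub> x)"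
proof -
  have "(\<ominus>\<^bsub>A\<^esub> a) \<odot>\<^bsub>M\<^esub> x \<oplus>\<^bsub>M\<^esub> a \<odot>\<^bsub>M\<^esub> x = \<zero>\<^bsub>M\<^esub>"
    using smult_l_distr[of "\<ominus>\<^bsub>A\<^esub> a" a x] assms by (simp add: A.l_neg)
  then show ?thesis using assms by (simp add: M.minus_equality)
qed

lemma smult_eq_iff:
  assumes "a \<in> carrier A" "b \<in> carrier A" "x \<in> carrier M"
  shows "a \<odot>\<^bsub>M\<^esub> x = b \<odot>\<^bsub>M\<^esub> x \<longleftrightarrow> (a \<ominus>\<^bsub>A\<^esub> b) \<odot>\<^bsub>M\<^esub> x = \<zero>\<^bsub>M\<^esub>"
proof -
  have "(a \<ominus>\<^bsub>A\<^esub> b) \<odot>\<^bsub>M\<^esub> x = a \<odot>\<^bsub>M\<^esub> x \<oplus>\<^bsub>M\<^esub> \<ominus>\<^bsub>M\<^esub> (b \<odot>\<^bsub>M\<^esub> x)"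
    using assms by (simp add: A.minus_eq smult_l_distr smult_l_minus)
  also have "\<dots> = \<zero>\<^bsub>M\<^esub> \<longleftrightarrow> a \<odot>\<^bsub>M\<^esub> x = b \<odot>\<^bsub>M\<^esub> x"
    using assms M.minus_equality[of "a \<odot>\<^bsub>M\<^esub> x" "\<ominus>\<^bsub>M\<^esub> (b \<odot>\<^bsub>M\<^esub> x)"] by (auto simp: M.r_neg)
  finally show ?thesis by blast
qed

lemma submoduleI:
  assumes "H \<subseteq> carrier M" "\<zero>\<^bsub>M\<^esub> \<in> H"
    and "\<And>x y. x \<in> H \<Longrightarrow> y \<in> H \<Longrightarrow> x \<oplus>\<^bsub>M\<^esub> y \<in> H"
    and smult: "\<And>a x. a \<in> carrier A \<Longrightarrow> x \<in> H \<Longrightarrow> a \<odot>\<^bsub>M\<^esub> x \<in> H"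
  shows "submodule H A M"
proof (intro submodule.intro submodule_axioms.intro group.subgroupI[OF M.a_group])
  show "inv\<^bsub>add_monoid M\<^esub> a \<in> H" if "a \<in> H" for a
    using smult[of "\<ominus>\<^bsub>A\<^esub> \<one>\<^bsub>A\<^esub>" a] that assms(1) smult_l_minus[of "\<one>\<^bsub>A\<^esub>" a]
    by (auto simp: a_inv_def[symmetric])
qed (use assms in auto)

lemma cyclic_submodule:
  assumes "m \<in> carrier M"
  shows "submodule ((\<lambda>a. a \<odot>\<^bsub>M\<^esub> m) ` carrier A) A M"
proof (rule submoduleI)
  show "\<zero>\<^bsub>M\<^esub> \<in> (\<lambda>a. a \<odot>\<^bsub>M\<^esub> m) ` carrier A"
    using assms by (intro image_eqI[of _ _ "\<zero>\<^bsub>A\<^esub>"]) auto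
qed (use assms in \<open>auto simp: smult_l_distr[symmetric] smult_assoc[symmetric]\<close>)

end

lemma submoduleD:
  assumes "submodule H A M"
  shows "H \<subseteq> carrier M" "\<zero>\<^bsub>M\<^esub> \<in> H" "\<And>x y. x \<in> H \<Longrightarrow> y \<in> H \<Longrightarrow> x \<oplus>\<^bsub>M\<^esub> y \<in> H"
    "\<And>a x. a \<in> carrier A \<Longrightarrow> x \<in> H \<Longrightarrow> a \<odot>\<^bsub>M\<^esub> x \<in> H" "\<And>x. x \<in> H \<Longrightarrow> \<ominus>\<^bsub>M\<^esub> x \<in> H"
  using subgroup.subset[OF submodule.axioms(1)[OF assms]]
    subgroup.one_closed[OF submodule.axioms(1)[OF assms]]
    subgroup.m_closed[OF submodule.axioms(1)[OF assms]] submodule.smult_closed[OF assms]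
    subgroup.m_inv_closed[OF submodule.axioms(1)[OF assms]]
  by (auto simp: a_inv_def)

lemma simple_moduleD:
  assumes "simple_module A V"
  shows "left_module A V" "carrier V \<noteq> {\<zero>\<^bsub>V\<^esub>}"
    "submodule N A V \<Longrightarrow> N = {\<zero>\<^bsub>V\<^esub>} \<or> N = carrier V"
  using assms by (auto simp: simple_module_def)

lemma simple_module_cyclic:
  assumes "simple_module A V" "m \<in> carrier V" "m \<noteq> \<zero>\<^bsub>V\<^esub>"
  shows "(\<lambda>a. a \<odot>\<^bsub>V\<^esub> m) ` carrier A = carrier V"
proof -
  interpret left_module A V using assms by (simp add: simple_module_def)
  have "m \<in> (\<lambda>a. a \<odot>\<^bsub>V\<^esub> m) ` carrier A"
    using assms(2) by (intro image_eqI[of _ _ "\<one>\<^bsub>A\<^esub>"]) auto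
  then show ?thesis
    using simple_moduleD(3)[OF assms(1) cyclic_submodule[OF assms(2)]] assms(3) by blast
qed

lemma simple_module_cyclicE:
  assumes "simple_module A V" "m \<in> carrier V" "m \<noteq> \<zero>\<^bsub>V\<^esub>" "y \<in> carrier V"
  obtains a where "a \<in> carrier A" "y = a \<odot>\<^bsub>V\<^esub> m"
  using simple_module_cyclic[OF assms(1-3)] assms(4) by (metis imageE)

definition module_bij :: "('m \<Rightarrow> 'n) \<Rightarrow> 'a ring \<Rightarrow> ('a, 'm) module \<Rightarrow> ('a, 'n) module \<Rightarrow> bool" where
  "module_bij f A M N \<longleftrightarrow> bij_betw f (carrier M) (carrier N) \<and>
    (\<forall>x\<in>carrier M. \<forall>y\<in>carrier M. f (x \<oplus>\<^bsub>M\<^esub> y) = f x \<oplus>\<^bsub>N\<^esub> f y) \<and>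
    (\<forall>a\<in>carrier A. \<forall>x\<in>carrier M. f (a \<odot>\<^bsub>M\<^esub> x) = a \<odot>\<^bsub>N\<^esub> f x)"

lemma module_bijD:
  assumes "module_bij f A M N"
  shows "bij_betw f (carrier M) (carrier N)"
    "\<And>x y. x \<in> carrier M \<Longrightarrow> y \<in> carrier M \<Longrightarrow> f (x \<oplus>\<^bsub>M\<^esub> y) = f x \<oplus>\<^bsub>N\<^esub> f y"
    "\<And>a x. a \<in> carrier A \<Longrightarrow> x \<in> carrier M \<Longrightarrow> f (a \<odot>\<^bsub>M\<^esub> x) = a \<odot>\<^bsub>N\<^esub> f x"
    "\<And>x. x \<in> carrier M \<Longrightarrow> f x \<in> carrier N"
  using assms by (auto simp: module_bij_def bij_betw_def)

lemma module_iso_iff_bij: "module_iso A M N \<longleftrightarrow> (\<exists>f. module_bij f A M N)"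
  unfolding module_iso_def module_bij_def
  by (auto simp: iso_def hom_def bij_betw_def Pi_def Bex_def)

lemma module_isoI:
  assumes "bij_betw f (carrier M) (carrier N)"
    and "\<And>x y. x \<in> carrier M \<Longrightarrow> y \<in> carrier M \<Longrightarrow> f (x \<oplus>\<^bsub>M\<^esub> y) = f x \<oplus>\<^bsub>N\<^esub> f y"
    and "\<And>a x. a \<in> carrier A \<Longrightarrow> x \<in> carrier M \<Longrightarrow> f (a \<odot>\<^bsub>M\<^esub> x) = a \<odot>\<^bsub>N\<^esub> f x"
  shows "module_iso A M N"
  unfolding module_iso_iff_bij module_bij_def using assms by blast

lemma module_iso_sym:
  assumes "left_module A M" "module_iso A M N"
  shows "module_iso A N M"
proof -
  interpret left_module A M by fact
  obtain f where "module_bij f A M N" using assms(2) by (auto simp: module_iso_iff_bij)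
  note f = module_bijD[OF this]
  let ?g = "inv_into (carrier M) f"
  have N: "carrier N = f ` carrier M" using f(1) by (simp add: bij_betw_def)
  have gf: "?g (f x) = x" if "x \<in> carrier M" for x
    using bij_betw_inv_into_left[OF f(1) that] .
  show ?thesis
  proof (rule module_isoI[of ?g])
    show "bij_betw ?g (carrier N) (carrier M)" by (rule bij_betw_inv_into[OF f(1)])
  qed (auto simp: N gf f(2)[symmetric] f(3)[symmetric])
qed

lemma module_iso_trans:
  assumes "module_iso A M N" "module_iso A N P"
  shows "module_iso A M P"
proof -
  obtain f where "module_bij f A M N" using assms(1) by (auto simp: module_iso_iff_bij)
  note f = module_bijD[OF this]
  obtain g where "module_bij g A N P" using assms(2) by (auto simp: module_iso_iff_bij)
  note g = module_bijD[OF this]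
  have [simp]: "f x \<in> carrier N" if "x \<in> carrier M" for x
    using f(1) that by (auto simp: bij_betw_def)
  show ?thesis
    by (rule module_isoI[of "g \<circ> f"]) (use f g in \<open>auto intro: bij_betw_trans\<close>)
qed

lemma module_iso_zero:
  assumes "left_module A M" "left_module A N"
    and "bij_betw f (carrier M) (carrier N)"
    and "\<And>x y. x \<in> carrier M \<Longrightarrow> y \<in> carrier M \<Longrightarrow> f (x \<oplus>\<^bsub>M\<^esub> y) = f x \<oplus>\<^bsub>N\<^esub> f y"
  shows "f \<zero>\<^bsub>M\<^esub> = \<zero>\<^bsub>N\<^esub>"
proof -
  interpret M: left_module A M by fact
  interpret N: left_module A N by fact
  have c: "f \<zero>\<^bsub>M\<^esub> \<in> carrier N" using assms(3) by (auto simp: bij_betw_def)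
  have "f \<zero>\<^bsub>M\<^esub> \<oplus>\<^bsub>N\<^esub> f \<zero>\<^bsub>M\<^esub> = f \<zero>\<^bsub>M\<^esub>" using assms(4)[of "\<zero>\<^bsub>M\<^esub>" "\<zero>\<^bsub>M\<^esub>"] by simp
  then show ?thesis using N.M.add.l_cancel_one'[OF c c] by simp
qed

text \<open>Passing to the common copy with elements of a fixed type compares modules of any two types.\<close>

lemma iso_class_eq_iff:
  fixes V :: "('a, 'm) module" and W :: "('a, 'n) module"
  assumes V: "simple_module A V" and W: "simple_module A W"
  shows "iso_class A V = iso_class A W \<longleftrightarrow> module_iso A V W"
proof
  assume eq: "iso_class A V = iso_class A W"
  obtain N :: "('a, 'a set) module" where N: "simple_module A N" "module_iso A V N"
    using simple_module_copy[OF V] by blast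
  then have "N \<in> iso_class A V"
    using module_iso_sym[OF simple_moduleD(1)[OF V]] by (auto simp: iso_class_def)
  then have "module_iso A N W" using eq by (auto simp: iso_class_def)
  then show "module_iso A V W" using N(2) module_iso_trans by blast
next
  assume iso: "module_iso A V W"
  then have "module_iso A W V" by (rule module_iso_sym[OF simple_moduleD(1)[OF V]])
  with iso show "iso_class A V = iso_class A W"
    unfolding iso_class_def by (blast intro: module_iso_trans)
qed

lemma iso_class_in_simple_iso_classes:
  fixes V :: "('a, 'm) module"
  assumes "simple_module A V"
  shows "iso_class A V \<in> simple_iso_classes A"
proof -
  obtain N :: "('a, 'a set) module" where N: "simple_module A N" "module_iso A V N"
    using simple_module_copy[OF assms] by blast
  then have "iso_class A V = iso_class A N" using iso_class_eq_iff[OF assms N(1)] by simp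
  then show ?thesis using N(1) by (auto simp: simple_iso_classes_def)
qed

lemma pullback_simps [simp]:
  "carrier (pullback f M) = carrier M" "\<zero>\<^bsub>pullback f M\<^esub> = \<zero>\<^bsub>M\<^esub>"
  "add (pullback f M) = add M" "smult (pullback f M) b x = f b \<odot>\<^bsub>M\<^esub> x"
  by (simp_all add: pullback_def)

lemma abelian_group_transfer:
  assumes "abelian_group M" "carrier N = carrier M" "\<zero>\<^bsub>N\<^esub> = \<zero>\<^bsub>M\<^esub>" "add N = add M"
  shows "abelian_group N"
proof -
  interpret abelian_group M by fact
  show ?thesis
  proof (rule abelian_groupI)
    show "\<exists>y\<in>carrier N. y \<oplus>\<^bsub>N\<^esub> x = \<zero>\<^bsub>N\<^esub>" if "x \<in> carrier N" for x
      using that by (intro bexI[of _ "\<ominus>\<^bsub>M\<^esub> x"]) (simp_all add: assms(2-) l_neg)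
  qed (simp_all add: assms(2-) a_ac)
qed

lemma left_module_pullback:
  assumes "left_module A M" "ring B" "f \<in> ring_hom B A"
  shows "left_module B (pullback f M)"
proof -
  interpret left_module A M by fact
  interpret B: ring B by fact
  have [simp]: "f b \<in> carrier A" if "b \<in> carrier B" for b
    using ring_hom_closed[OF assms(3) that] .
  show ?thesis
  proof (intro left_module.intro left_module_axioms.intro)
    show "abelian_group (pullback f M)"
      by (rule abelian_group_transfer[OF M.abelian_group_axioms]) auto
  qed (auto simp: assms(2) ring_hom_add[OF assms(3)] ring_hom_mult[OF assms(3)]
        ring_hom_one[OF assms(3)] smult_l_distr smult_r_distr smult_assoc)
qed

lemma simple_module_pullback:
  assumes M: "simple_module A M" and "ring B" "f \<in> ring_hom B A" "f ` carrier B = carrier A"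
  shows "simple_module B (pullback f M)"
proof -
  interpret left_module A M using M by (simp add: simple_module_def)
  have "N = {\<zero>\<^bsub>M\<^esub>} \<or> N = carrier M" if "submodule N B (pullback f M)" for N
  proof (rule simple_moduleD(3)[OF M], rule submoduleI)
    show "a \<odot>\<^bsub>M\<^esub> x \<in> N" if ax: "a \<in> carrier A" "x \<in> N" for a x
    proof -
      obtain b where "b \<in> carrier B" "a = f b" using ax(1) assms(4) by (metis imageE)
      then show ?thesis using submoduleD(4)[OF \<open>submodule N B _\<close> _ ax(2)] by simp
    qed
  qed (use submoduleD[OF that] in auto)
  then show ?thesis
    using simple_moduleD(2)[OF M] left_module_pullback[OF left_module_axioms assms(2,3)]
    by (auto simp: simple_module_def)
qed

lemma module_iso_pullback_iff:
  assumes "f ` carrier B = carrier A"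
  shows "module_iso B (pullback f M) (pullback f N) \<longleftrightarrow> module_iso A M N"
  unfolding module_iso_iff_bij module_bij_def by (simp add: assms[symmetric])

section \<open>Corners\<close>

text \<open>The \<open>eAe\<close>-module \<open>eV\<close>: for an idempotent \<open>e\<close>, the elements \<open>e x\<close> are those that \<open>e\<close> fixes.\<close>

definition corner_module :: "'a ring \<Rightarrow> 'a \<Rightarrow> ('a, 'm) module \<Rightarrow> ('a, 'm) module" where
  "corner_module A e V =
    \<lparr>carrier = {x \<in> carrier V. e \<odot>\<^bsub>V\<^esub> x = x}, mult = undefined, one = undefined,
     ring.zero = \<zero>\<^bsub>V\<^esub>, add = add V, smult = smult V\<rparr>"

lemma corner_module_simps [simp]:
  "carrier (corner_module A e V) = {x \<in> carrier V. e \<odot>\<^bsub>V\<^esub> x = x}"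
  "\<zero>\<^bsub>corner_module A e V\<^esub> = \<zero>\<^bsub>V\<^esub>" "add (corner_module A e V) = add V"
  "smult (corner_module A e V) = smult V"
  by (simp_all add: corner_module_def)

locale ring_idempotent = ring A for A :: "'a ring" (structure) and e +
  assumes e_closed [simp]: "e \<in> carrier A" and e_idem [simp]: "e \<otimes> e = e"
begin

abbreviation B where "B \<equiv> corner_ring A e"

lemma corner_simps [simp]:
  "\<one>\<^bsub>B\<^esub> = e" "\<zero>\<^bsub>B\<^esub> = \<zero>" "add B = add A" "mult B = mult A"
  by (simp_all add: corner_ring_def)

lemma corner_carrier: "b \<in> carrier B \<longleftrightarrow> b \<in> carrier A \<and> e \<otimes> b = b \<and> b \<otimes> e = b"
proof
  assume "b \<in> carrier B"
  then obtain a where a: "a \<in> carrier A" "b = e \<otimes> a \<otimes> e" by (auto simp: corner_ring_def)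
  have "e \<otimes> (e \<otimes> a \<otimes> e) = (e \<otimes> e) \<otimes> a \<otimes> e" using a(1) by (simp only: m_assoc m_closed e_closed)
  moreover have "(e \<otimes> a \<otimes> e) \<otimes> e = e \<otimes> a \<otimes> (e \<otimes> e)"
    using a(1) by (simp only: m_assoc m_closed e_closed)
  ultimately show "b \<in> carrier A \<and> e \<otimes> b = b \<and> b \<otimes> e = b" using a by simp
next
  assume b: "b \<in> carrier A \<and> e \<otimes> b = b \<and> b \<otimes> e = b"
  then have "b = e \<otimes> b \<otimes> e" by simp
  with b show "b \<in> carrier B" by (force simp: corner_ring_def)
qed

lemma cornerI: "a \<in> carrier A \<Longrightarrow> e \<otimes> a \<otimes> e \<in> carrier B"
  by (auto simp: corner_ring_def)

lemma e_in_corner [simp]: "e \<in> carrier B"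
  by (simp add: corner_carrier)

lemma ring_corner: "ring B"
proof (rule ringI)
  show "abelian_group B"
  proof (rule abelian_groupI)
    show "\<exists>y\<in>carrier B. y \<oplus>\<^bsub>B\<^esub> x = \<zero>\<^bsub>B\<^esub>" if "x \<in> carrier B" for x
      using that by (intro bexI[of _ "\<ominus> x"]) (simp_all add: corner_carrier r_minus l_minus l_neg)
  qed (simp_all add: corner_carrier r_distr l_distr a_ac)
  show "monoid B"
  proof (rule monoidI)
    show "x \<otimes>\<^bsub>B\<^esub> y \<in> carrier B" if "x \<in> carrier B" "y \<in> carrier B" for x y
      using that m_assoc[of e x y] m_assoc[of x y e] by (simp add: corner_carrier)
  qed (simp_all add: corner_carrier m_assoc)
qed (simp_all add: corner_carrier l_distr r_distr)

lemma left_module_corner: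
  assumes "left_module A V"
  shows "left_module B (corner_module A e V)"
proof -
  interpret V: left_module A V by fact
  have "abelian_group (corner_module A e V)"
  proof (rule abelian_groupI)
    show "\<exists>y\<in>carrier (corner_module A e V). y \<oplus>\<^bsub>corner_module A e V\<^esub> x = \<zero>\<^bsub>corner_module A e V\<^esub>"
      if "x \<in> carrier (corner_module A e V)" for x
      using that by (intro bexI[of _ "\<ominus>\<^bsub>V\<^esub> x"]) (auto simp: V.smult_r_minus V.M.l_neg)
  qed (auto simp: V.smult_r_distr V.M.a_ac)
  moreover have "e \<odot>\<^bsub>V\<^esub> (b \<odot>\<^bsub>V\<^esub> x) = b \<odot>\<^bsub>V\<^esub> x" if "b \<in> carrier B" "x \<in> carrier V" for b x
    using that by (simp add: V.smult_assoc[symmetric] corner_carrier)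
  ultimately show ?thesis
    by (intro left_module.intro left_module_axioms.intro ring_corner)
      (auto simp: corner_carrier V.smult_l_distr V.smult_r_distr V.smult_assoc)
qed

lemma corner_image:
  assumes "left_module A V" "x \<in> carrier V"
  shows "e \<odot>\<^bsub>V\<^esub> x \<in> carrier (corner_module A e V)"
proof -
  interpret V: left_module A V by fact
  show ?thesis using assms(2) by (simp add: V.smult_assoc[symmetric])
qed

text \<open>
  A nonzero \<open>eAe\<close>-submodule of \<open>eV\<close> contains some \<open>v \<noteq> 0\<close>, hence \<open>eAe v = eA v = eV\<close>.
\<close>

lemma simple_module_corner:
  assumes V: "simple_module A V" and nz: "\<exists>x\<in>carrier V. e \<odot>\<^bsub>V\<^esub> x \<noteq> \<zero>\<^bsub>V\<^esub>"
  shows "simple_module B (corner_module A e V)"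
  unfolding simple_module_def
proof (intro conjI allI impI)
  interpret V: left_module A V using V by (simp add: simple_module_def)
  show "left_module B (corner_module A e V)" by (rule left_module_corner[OF V.left_module_axioms])
  obtain x where "x \<in> carrier V" "e \<odot>\<^bsub>V\<^esub> x \<noteq> \<zero>\<^bsub>V\<^esub>" using nz by blast
  then show "carrier (corner_module A e V) \<noteq> {\<zero>\<^bsub>corner_module A e V\<^esub>}"
    using corner_image[OF V.left_module_axioms] by (metis corner_module_simps(2) singletonD)
  fix N assume N: "submodule N B (corner_module A e V)"
  show "N = {\<zero>\<^bsub>corner_module A e V\<^esub>} \<or> N = carrier (corner_module A e V)"
  proof (rule disjCI)
    assume "N \<noteq> carrier (corner_module A e V)"
    have "x = \<zero>\<^bsub>V\<^esub>" if "x \<in> N" for x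
    proof (rule ccontr)
      assume "x \<noteq> \<zero>\<^bsub>V\<^esub>"
      have x: "x \<in> carrier V" "e \<odot>\<^bsub>V\<^esub> x = x" using submoduleD(1)[OF N] that by auto
      have "y \<in> N" if "y \<in> carrier (corner_module A e V)" for y
      proof -
        have y: "y \<in> carrier V" "e \<odot>\<^bsub>V\<^esub> y = y" using that by auto
        obtain a where a: "a \<in> carrier A" "y = a \<odot>\<^bsub>V\<^esub> x"
          using simple_module_cyclicE[OF V x(1) \<open>x \<noteq> _\<close> y(1)] .
        have "y = (e \<otimes> a \<otimes> e) \<odot>\<^bsub>V\<^esub> x" using a x y by (simp add: V.smult_assoc)
        then show ?thesis using submoduleD(4)[OF N cornerI[OF a(1)] \<open>x \<in> N\<close>] by simp
      qed
      then show False using submoduleD(1)[OF N] \<open>N \<noteq> carrier (corner_module A e V)\<close> by blast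
    qed
    with submoduleD(2)[OF N] show "N = {\<zero>\<^bsub>corner_module A e V\<^esub>}"
      unfolding corner_module_simps by blast
  qed
qed

lemma module_iso_corner:
  assumes "left_module A V" "module_iso A V W"
  shows "module_iso B (corner_module A e V) (corner_module A e W)"
proof -
  interpret V: left_module A V by fact
  obtain f where "module_bij f A V W" using assms(2) by (auto simp: module_iso_iff_bij)
  note f = module_bijD[OF this]
  have inj: "f x = f y \<longleftrightarrow> x = y" if "x \<in> carrier V" "y \<in> carrier V" for x y
    using f(1) that by (auto simp: bij_betw_def inj_on_eq_iff)
  have W: "carrier W = f ` carrier V" using f(1) by (simp add: bij_betw_def)
  have eq: "e \<odot>\<^bsub>W\<^esub> f x = f x \<longleftrightarrow> e \<odot>\<^bsub>V\<^esub> x = x" if "x \<in> carrier V" for x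
    using that inj[of "e \<odot>\<^bsub>V\<^esub> x" x] by (simp add: f(3)[symmetric])
  show ?thesis
  proof (rule module_isoI[of f])
    show "bij_betw f (carrier (corner_module A e V)) (carrier (corner_module A e W))"
      unfolding bij_betw_def by (auto simp: W eq inj_on_def inj)
  qed (auto simp: f corner_carrier)
qed

text \<open>
  If \<open>v \<in> eV\<close> corresponds to \<open>w \<in> eW\<close>, then \<open>v\<close> and \<open>w\<close> have the same annihilator \<open>I\<close>, because \<open>a v = 0\<close> holds if
  and only if \<open>(e b a e) v = 0\<close> for all \<open>b\<close>, and the latter condition only involves the \<open>eAe\<close>-module \<open>eV\<close>.
  For \<open>v \<noteq> 0\<close> this gives \<open>V \<cong> A / I \<cong> W\<close>.
\<close>

lemma simple_modules_iso_if_corners_iso: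
  assumes V: "simple_module A V" and W: "simple_module A W"
    and nz: "\<exists>x\<in>carrier V. e \<odot>\<^bsub>V\<^esub> x \<noteq> \<zero>\<^bsub>V\<^esub>"
    and iso: "module_iso B (corner_module A e V) (corner_module A e W)"
  shows "module_iso A V W"
proof -
  interpret V: left_module A V using V by (simp add: simple_module_def)
  interpret W: left_module A W using W by (simp add: simple_module_def)
  obtain f where "module_bij f B (corner_module A e V) (corner_module A e W)" using iso by (auto simp: module_iso_iff_bij)
  note f = module_bijD[OF this]
  have f0: "f \<zero>\<^bsub>V\<^esub> = \<zero>\<^bsub>W\<^esub>"
    using module_iso_zero[OF left_module_corner[OF V.left_module_axioms]
        left_module_corner[OF W.left_module_axioms] f(1)] f(2) by simp
  obtain v where v: "v \<in> carrier V" "e \<odot>\<^bsub>V\<^esub> v = v" "v \<noteq> \<zero>\<^bsub>V\<^esub>"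
  proof -
    obtain x where "x \<in> carrier V" "e \<odot>\<^bsub>V\<^esub> x \<noteq> \<zero>\<^bsub>V\<^esub>" using nz by blast
    then show ?thesis using corner_image[OF V.left_module_axioms, of x] by (intro that[of "e \<odot>\<^bsub>V\<^esub> x"]) simp_all
  qed
  define w where "w = f v"
  have vc: "v \<in> carrier (corner_module A e V)" using v by simp
  have wc: "w \<in> carrier (corner_module A e W)"
    unfolding w_def using f(1) vc by (rule bij_betwE[rule_format])
  have w: "w \<in> carrier W" "e \<odot>\<^bsub>W\<^esub> w = w" using wc by auto
  have f_inj: "f x = \<zero>\<^bsub>W\<^esub> \<longleftrightarrow> x = \<zero>\<^bsub>V\<^esub>" if "x \<in> carrier (corner_module A e V)" for x
    using f(1) that f0 inj_on_eq_iff[of f "carrier (corner_module A e V)" x "\<zero>\<^bsub>V\<^esub>"]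
    by (auto simp: bij_betw_def)
  have "w \<noteq> \<zero>\<^bsub>W\<^esub>" using f_inj[OF vc] v(3) by (simp add: w_def)
  \<comment> \<open>If \<open>x \<noteq> 0\<close>, then \<open>A x\<close> contains \<open>u\<close>, and \<open>e u = u \<noteq> 0\<close>.\<close>
  have detect: "x = \<zero>\<^bsub>U\<^esub>"
    if U: "simple_module A U" and u: "u \<in> carrier U" "e \<odot>\<^bsub>U\<^esub> u = u" "u \<noteq> \<zero>\<^bsub>U\<^esub>"
      and x: "x \<in> carrier U" and z: "\<And>b. b \<in> carrier A \<Longrightarrow> e \<odot>\<^bsub>U\<^esub> (b \<odot>\<^bsub>U\<^esub> x) = \<zero>\<^bsub>U\<^esub>"
    for U :: "('a, 'u) module" and u x
  proof (rule ccontr)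
    assume "x \<noteq> \<zero>\<^bsub>U\<^esub>"
    then obtain b where "b \<in> carrier A" "u = b \<odot>\<^bsub>U\<^esub> x"
      using simple_module_cyclicE[OF U x _ u(1)] by blast
    then show False using z[of b] u by simp
  qed
  have ann: "a \<odot>\<^bsub>V\<^esub> v = \<zero>\<^bsub>V\<^esub> \<longleftrightarrow> a \<odot>\<^bsub>W\<^esub> w = \<zero>\<^bsub>W\<^esub>" if a: "a \<in> carrier A" for a
  proof -
    have *: "e \<odot>\<^bsub>V\<^esub> (b \<odot>\<^bsub>V\<^esub> (a \<odot>\<^bsub>V\<^esub> v)) = \<zero>\<^bsub>V\<^esub> \<longleftrightarrow> e \<odot>\<^bsub>W\<^esub> (b \<odot>\<^bsub>W\<^esub> (a \<odot>\<^bsub>W\<^esub> w)) = \<zero>\<^bsub>W\<^esub>"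
      if b: "b \<in> carrier A" for b
    proof -
      let ?c = "e \<otimes> (b \<otimes> a) \<otimes> e"
      have "?c \<odot>\<^bsub>V\<^esub> v = e \<odot>\<^bsub>V\<^esub> (b \<odot>\<^bsub>V\<^esub> (a \<odot>\<^bsub>V\<^esub> v))" "?c \<odot>\<^bsub>W\<^esub> w = e \<odot>\<^bsub>W\<^esub> (b \<odot>\<^bsub>W\<^esub> (a \<odot>\<^bsub>W\<^esub> w))"
        using a b v w by (simp_all add: V.smult_assoc W.smult_assoc)
      moreover have c: "?c \<in> carrier B" using a b by (intro cornerI) simp
      moreover have "?c \<odot>\<^bsub>V\<^esub> v \<in> carrier (corner_module A e V)"
        using left_module.smult_closed[OF left_module_corner[OF V.left_module_axioms] c vc] by simp
      ultimately show ?thesis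
        using f_inj[of "?c \<odot>\<^bsub>V\<^esub> v"] f(3)[OF c vc] by (simp add: w_def)
    qed
    show ?thesis
    proof
      assume "a \<odot>\<^bsub>V\<^esub> v = \<zero>\<^bsub>V\<^esub>"
      then show "a \<odot>\<^bsub>W\<^esub> w = \<zero>\<^bsub>W\<^esub>"
        using detect[OF W w \<open>w \<noteq> \<zero>\<^bsub>W\<^esub>\<close>, of "a \<odot>\<^bsub>W\<^esub> w"] * a w(1) by simp
    next
      assume "a \<odot>\<^bsub>W\<^esub> w = \<zero>\<^bsub>W\<^esub>"
      then show "a \<odot>\<^bsub>V\<^esub> v = \<zero>\<^bsub>V\<^esub>"
        using detect[OF V v, of "a \<odot>\<^bsub>V\<^esub> v"] * a v(1) by simp
    qed
  qed
  have same: "a \<odot>\<^bsub>V\<^esub> v = b \<odot>\<^bsub>V\<^esub> v \<longleftrightarrow> a \<odot>\<^bsub>W\<^esub> w = b \<odot>\<^bsub>W\<^esub> w"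
    if "a \<in> carrier A" "b \<in> carrier A" for a b
  using ann[of "a \<ominus> b"] V.smult_eq_iff[of a b v] W.smult_eq_iff[of a b w] that v(1) w(1) by simp
  have VA: "carrier V = (\<lambda>a. a \<odot>\<^bsub>V\<^esub> v) ` carrier A" "carrier W = (\<lambda>a. a \<odot>\<^bsub>W\<^esub> w) ` carrier A"
    using simple_module_cyclic[OF V v(1,3)] simple_module_cyclic[OF W w(1) \<open>w \<noteq> _\<close>] by auto
  define g where "g x = inv_into (carrier A) (\<lambda>a. a \<odot>\<^bsub>V\<^esub> v) x \<odot>\<^bsub>W\<^esub> w" for x
  have g: "g (a \<odot>\<^bsub>V\<^esub> v) = a \<odot>\<^bsub>W\<^esub> w" if "a \<in> carrier A" for a
  proof -
    have "a \<odot>\<^bsub>V\<^esub> v \<in> (\<lambda>a. a \<odot>\<^bsub>V\<^esub> v) ` carrier A" using that by auto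
    from inv_into_into[OF this] f_inv_into_f[OF this] show ?thesis
      unfolding g_def using same that by blast
  qed
  show ?thesis
  proof (rule module_isoI[of g])
    show "bij_betw g (carrier V) (carrier W)"
      unfolding bij_betw_def VA by (auto simp: inj_on_def g same image_image cong: image_cong)
    show "g (x \<oplus>\<^bsub>V\<^esub> y) = g x \<oplus>\<^bsub>W\<^esub> g y" if xy: "x \<in> carrier V" "y \<in> carrier V" for x y
    proof -
      obtain a where "a \<in> carrier A" "x = a \<odot>\<^bsub>V\<^esub> v"
        using simple_module_cyclicE[OF V v(1,3) xy(1)] .
      moreover obtain b where "b \<in> carrier A" "y = b \<odot>\<^bsub>V\<^esub> v"
        using simple_module_cyclicE[OF V v(1,3) xy(2)] .
      ultimately show ?thesis
        using g[of "a \<oplus> b"] v(1) w(1) by (simp add: g V.smult_l_distr W.smult_l_distr)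
    qed
    show "g (a \<odot>\<^bsub>V\<^esub> x) = a \<odot>\<^bsub>W\<^esub> g x" if ax: "a \<in> carrier A" "x \<in> carrier V" for a x
    proof -
      obtain b where "b \<in> carrier A" "x = b \<odot>\<^bsub>V\<^esub> v"
        using simple_module_cyclicE[OF V v(1,3) ax(2)] .
      then show ?thesis
        using g[of "a \<otimes> b"] v(1) w(1) ax(1) by (simp add: g V.smult_assoc W.smult_assoc)
    qed
  qed
qed

end

section \<open>Quotient modules and heads\<close>

text \<open>
  Quotient modules and tensor products are both cosets of an abelian group whose scalars act
  through an operation \<open>\<phi>\<close> that satisfies the module laws modulo a subgroup \<open>N\<close>.
\<close>

locale coset_module = A?: ring A + G?: comm_group G + N?: subgroup N G
  for A :: "'a ring" and G :: "('u, 'v) monoid_scheme" (structure) and N +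
  fixes \<phi> :: "'a \<Rightarrow> 'u \<Rightarrow> 'u" and Q :: "('a, 'u set) module"
  assumes carrier_Q: "carrier Q = rcosets N" and zero_Q: "\<zero>\<^bsub>Q\<^esub> = N" and add_Q: "add Q = set_mult G"
    and smult_Q: "\<And>a U. a \<odot>\<^bsub>Q\<^esub> U = (\<Union>u\<in>U. N #> \<phi> a u)"
    and \<phi>_closed: "\<And>a u. a \<in> carrier A \<Longrightarrow> u \<in> carrier G \<Longrightarrow> \<phi> a u \<in> carrier G"
    and \<phi>_N: "\<And>a u. a \<in> carrier A \<Longrightarrow> u \<in> N \<Longrightarrow> \<phi> a u \<in> N"
    and \<phi>_hom: "\<And>a u v. a \<in> carrier A \<Longrightarrow> u \<in> carrier G \<Longrightarrow> v \<in> carrier G \<Longrightarrow> \<phi> a (u \<otimes> v) = \<phi> a u \<otimes> \<phi> a v"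
    and \<phi>_add: "\<And>a b u. a \<in> carrier A \<Longrightarrow> b \<in> carrier A \<Longrightarrow> u \<in> carrier G \<Longrightarrow>
        N #> \<phi> (a \<oplus>\<^bsub>A\<^esub> b) u = N #> (\<phi> a u \<otimes> \<phi> b u)"
    and \<phi>_mult: "\<And>a b u. a \<in> carrier A \<Longrightarrow> b \<in> carrier A \<Longrightarrow> u \<in> carrier G \<Longrightarrow>
        N #> \<phi> (a \<otimes>\<^bsub>A\<^esub> b) u = N #> \<phi> a (\<phi> b u)"
    and \<phi>_one: "\<And>u. u \<in> carrier G \<Longrightarrow> N #> \<phi> \<one>\<^bsub>A\<^esub> u = N #> u"
begin

lemma N_normal: "N \<lhd> G"
  by (rule G.subgroup_imp_normal[OF N.subgroup_axioms])

lemma carrier_coset: "carrier Q = (\<lambda>u. N #> u) ` carrier G"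
  by (auto simp: carrier_Q RCOSETS_def)

lemma add_coset:
  assumes "u \<in> carrier G" "v \<in> carrier G"
  shows "(N #> u) \<oplus>\<^bsub>Q\<^esub> (N #> v) = N #> (u \<otimes> v)"
  using normal.rcos_sum[OF N_normal] assms by (simp add: add_Q)

lemma coset_eq_iff:
  assumes "u \<in> carrier G" "v \<in> carrier G"
  shows "N #> u = N #> v \<longleftrightarrow> (\<exists>n\<in>N. u = n \<otimes> v)"
proof
  assume "N #> u = N #> v"
  then have "u \<in> N #> v" using rcos_self[OF assms(1) N.subgroup_axioms] by simp
  then show "\<exists>n\<in>N. u = n \<otimes> v" by (auto simp: r_coset_def)
next
  assume "\<exists>n\<in>N. u = n \<otimes> v"
  then have "u \<in> N #> v" by (auto simp: r_coset_def)
  then show "N #> u = N #> v"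
    using repr_independence[OF _ assms(2) N.subgroup_axioms] by simp
qed

lemma coset_absorb:
  assumes "n \<in> N" "v \<in> carrier G"
  shows "N #> (n \<otimes> v) = N #> v"
  using assms by (subst coset_eq_iff) auto

lemma smult_coset:
  assumes "a \<in> carrier A" "u \<in> carrier G"
  shows "a \<odot>\<^bsub>Q\<^esub> (N #> u) = N #> \<phi> a u"
proof -
  have "N #> \<phi> a v = N #> \<phi> a u" if v: "v \<in> N #> u" for v
  proof -
    obtain n where n: "n \<in> N" "v = n \<otimes> u" using v by (auto simp: r_coset_def)
    then show ?thesis
      using assms by (simp add: \<phi>_hom coset_absorb \<phi>_N \<phi>_closed)
  qed
  then show ?thesis
    using rcos_self[OF assms(2) N.subgroup_axioms] unfolding smult_Q by blast
qed

lemma left_module_Q: "left_module A Q"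
proof -
  have one: "N = N #> \<one>" using N.subset by simp
  have "abelian_group Q"
  proof (rule abelian_groupI)
    show "\<exists>y\<in>carrier Q. y \<oplus>\<^bsub>Q\<^esub> x = \<zero>\<^bsub>Q\<^esub>" if x: "x \<in> carrier Q" for x
    proof -
      obtain u where u: "u \<in> carrier G" "x = N #> u" using x by (auto simp: carrier_coset)
      then have "(N #> inv u) \<oplus>\<^bsub>Q\<^esub> x = N #> \<one>" by (simp add: add_coset)
      then show ?thesis using u one by (auto simp: zero_Q carrier_coset)
    qed
    show "\<zero>\<^bsub>Q\<^esub> \<in> carrier Q" using one by (auto simp: zero_Q carrier_coset)
    show "\<zero>\<^bsub>Q\<^esub> \<oplus>\<^bsub>Q\<^esub> x = x" if x: "x \<in> carrier Q" for x
    proof -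
      obtain u where u: "u \<in> carrier G" "x = N #> u" using x by (auto simp: carrier_coset)
      then show ?thesis using add_coset[of \<one> u] one by (simp add: zero_Q)
    qed
    show "x \<oplus>\<^bsub>Q\<^esub> y = y \<oplus>\<^bsub>Q\<^esub> x" if "x \<in> carrier Q" "y \<in> carrier Q" for x y
      using that by (auto simp: carrier_coset add_coset m_comm)
  qed (auto simp: carrier_coset add_coset m_assoc)
  then show ?thesis
    by (intro left_module.intro left_module_axioms.intro A.ring_axioms)
      (auto simp: carrier_coset add_coset smult_coset \<phi>_closed \<phi>_add \<phi>_mult \<phi>_one \<phi>_hom)
qed

end

lemma quotient_coset_module:
  fixes M :: "('a, 'm) module"
  assumes M: "left_module A M" and N: "submodule N A M"
  shows "coset_module A (add_monoid M) N (smult M) (quotient_module M N)"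
proof -
  interpret M: left_module A M by fact
  show ?thesis
    by (intro coset_module.intro coset_module_axioms.intro M.a_comm_group submodule.axioms(1)[OF N])
      (use submoduleD[OF N] in \<open>auto simp: quotient_module_def A_RCOSETS_def set_add_def a_r_coset_def
        M.smult_l_distr M.smult_r_distr M.smult_assoc M.A.ring_axioms\<close>)
qed

lemma simple_quotient_module:
  fixes M :: "('a, 'm) module"
  assumes M: "left_module A M" and N: "maximal_submodule A M N"
  shows "simple_module A (quotient_module M N)"
proof -
  have sN: "submodule N A M" and maxi: "\<And>L. submodule L A M \<Longrightarrow> N \<subseteq> L \<Longrightarrow> L = N \<or> L = carrier M"
    and proper: "N \<noteq> carrier M" using N by (auto simp: maximal_submodule_def)
  interpret M: left_module A M by fact
  let ?Q = "quotient_module M N"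
  interpret Q: coset_module A "add_monoid M" N "smult M" ?Q
    by (rule quotient_coset_module[OF M sN])
  let ?c = "\<lambda>x. N #>\<^bsub>add_monoid M\<^esub> x"
  have carrier: "carrier ?Q = ?c ` carrier M" using Q.carrier_coset by simp
  have eqN: "?c x = N \<longleftrightarrow> x \<in> N" if "x \<in> carrier M" for x
    using that M.M.add.rcos_self[OF _ Q.subgroup_axioms, of x] Q.rcos_const[OF M.M.a_group, of x] by auto
  have "Y = {\<zero>\<^bsub>?Q\<^esub>} \<or> Y = carrier ?Q" if Y: "submodule Y A ?Q" for Y
  proof -
    let ?L = "{x \<in> carrier M. ?c x \<in> Y}"
    have N_in: "N \<in> Y" using submoduleD(2)[OF Y] by (simp add: Q.zero_Q)
    have "submodule ?L A M"
    proof (rule M.submoduleI)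
      show "\<zero>\<^bsub>M\<^esub> \<in> ?L" using eqN[of "\<zero>\<^bsub>M\<^esub>"] N_in submoduleD(2)[OF sN] by simp
      show "x \<oplus>\<^bsub>M\<^esub> y \<in> ?L" if "x \<in> ?L" "y \<in> ?L" for x y
        using that submoduleD(3)[OF Y, of "?c x" "?c y"] Q.add_coset[of x y] by simp
      show "a \<odot>\<^bsub>M\<^esub> x \<in> ?L" if "a \<in> carrier A" "x \<in> ?L" for a x
        using that submoduleD(4)[OF Y, of a "?c x"] Q.smult_coset[of a x] by simp
    qed auto
    moreover have "N \<subseteq> ?L"
    proof
      fix x assume "x \<in> N"
      moreover from this have "x \<in> carrier M" using submoduleD(1)[OF sN] by blast
      ultimately show "x \<in> ?L" using eqN[of x] N_in by simp
    qed
    ultimately consider "?L = N" | "?L = carrier M" using maxi by blast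
    then show ?thesis
    proof cases
      case 1
      have "y = N" if "y \<in> Y" for y
      proof -
        obtain x where "x \<in> carrier M" "y = ?c x"
          using \<open>y \<in> Y\<close> submoduleD(1)[OF Y] carrier by blast
        moreover from this have "x \<in> N" using 1 \<open>y \<in> Y\<close> by blast
        ultimately show ?thesis using eqN by simp
      qed
      then have "Y = {N}" using N_in by blast
      then show ?thesis by (simp add: Q.zero_Q)
    next
      case 2
      then have "carrier ?Q \<subseteq> Y" using carrier by auto
      then show ?thesis using submoduleD(1)[OF Y] by blast
    qed
  qed
  moreover have "carrier ?Q \<noteq> {\<zero>\<^bsub>?Q\<^esub>}"
  proof -
    obtain x where "x \<in> carrier M" "x \<notin> N" using proper submoduleD(1)[OF sN] by blast
    then have "?c x \<in> carrier ?Q" "?c x \<noteq> N" using carrier eqN by auto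
    then show ?thesis by (auto simp: Q.zero_Q)
  qed
  ultimately show ?thesis using Q.left_module_Q by (simp add: simple_module_def)
qed

section \<open>Modules generated from a corner\<close>

text \<open>
  The situation of \<open>M = Ae \<otimes> T\<close>, without reference to tensors: \<open>\<iota> t = e \<otimes> t\<close> and
  \<open>\<psi> (x \<otimes> t) = (e x) t\<close>.  The submodule \<open>{m. \<psi> (A m) = 0}\<close> contains every proper submodule \<open>L\<close>: if
  \<open>\<psi> (a m) = t \<noteq> 0\<close> for some \<open>m \<in> L\<close>, then \<open>\<iota> t = e a m \<in> L\<close>, and \<open>t\<close> generates \<open>T\<close>.
\<close>

locale corner_extension = ring_idempotent A e + M: left_module A M
  for A :: "'a ring" (structure) and e and M :: "('a, 'm) module" +
  fixes T :: "('a, 't) module" and \<iota> :: "'t \<Rightarrow> 'm" and \<psi> :: "'m \<Rightarrow> 't"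
  assumes T: "simple_module B T"
    and \<iota>_closed: "\<And>t. t \<in> carrier T \<Longrightarrow> \<iota> t \<in> carrier M"
    and \<iota>_add: "\<And>s t. s \<in> carrier T \<Longrightarrow> t \<in> carrier T \<Longrightarrow> \<iota> (s \<oplus>\<^bsub>T\<^esub> t) = \<iota> s \<oplus>\<^bsub>M\<^esub> \<iota> t"
    and \<iota>_smult: "\<And>b t. b \<in> carrier B \<Longrightarrow> t \<in> carrier T \<Longrightarrow> \<iota> (b \<odot>\<^bsub>T\<^esub> t) = b \<odot>\<^bsub>M\<^esub> \<iota> t"
    and \<psi>_closed: "\<And>m. m \<in> carrier M \<Longrightarrow> \<psi> m \<in> carrier T"
    and \<psi>_add: "\<And>m n. m \<in> carrier M \<Longrightarrow> n \<in> carrier M \<Longrightarrow> \<psi> (m \<oplus>\<^bsub>M\<^esub> n) = \<psi> m \<oplus>\<^bsub>T\<^esub> \<psi> n"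
    and \<psi>_\<iota>: "\<And>t. t \<in> carrier T \<Longrightarrow> \<psi> (\<iota> t) = t"
    and \<iota>_\<psi>: "\<And>m. m \<in> carrier M \<Longrightarrow> \<iota> (\<psi> m) = e \<odot>\<^bsub>M\<^esub> m"
    and generated: "\<And>L. submodule L A M \<Longrightarrow> \<iota> ` carrier T \<subseteq> L \<Longrightarrow> L = carrier M"
begin

sublocale T: left_module B T
  by (rule simple_moduleD(1)[OF T])

definition radical where
  "radical = {m \<in> carrier M. \<forall>a\<in>carrier A. \<psi> (a \<odot>\<^bsub>M\<^esub> m) = \<zero>\<^bsub>T\<^esub>}"

lemma \<psi>_zero: "\<psi> \<zero>\<^bsub>M\<^esub> = \<zero>\<^bsub>T\<^esub>"
  using \<psi>_add[of "\<zero>\<^bsub>M\<^esub>" "\<zero>\<^bsub>M\<^esub>"] \<psi>_closed[of "\<zero>\<^bsub>M\<^esub>"] T.M.add.l_cancel_one' by simp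

lemma \<iota>_zero: "\<iota> \<zero>\<^bsub>T\<^esub> = \<zero>\<^bsub>M\<^esub>"
  using \<iota>_add[of "\<zero>\<^bsub>T\<^esub>" "\<zero>\<^bsub>T\<^esub>"] \<iota>_closed[of "\<zero>\<^bsub>T\<^esub>"] M.M.add.l_cancel_one' by simp

lemma submodule_radical: "submodule radical A M"
proof (rule M.submoduleI)
  show "b \<odot>\<^bsub>M\<^esub> x \<in> radical" if "b \<in> carrier A" "x \<in> radical" for b x
    using that by (auto simp: radical_def M.smult_assoc[symmetric])
qed (auto simp: radical_def \<psi>_zero \<psi>_add M.smult_r_distr)

lemma \<iota>_in_radical:
  assumes "t \<in> carrier T" "\<iota> t \<in> radical"
  shows "t = \<zero>\<^bsub>T\<^esub>"
proof -
  have "\<psi> (\<one> \<odot>\<^bsub>M\<^esub> \<iota> t) = \<zero>\<^bsub>T\<^esub>" using assms(2) one_closed unfolding radical_def by blast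
  then show ?thesis using assms(1) \<iota>_closed \<psi>_\<iota> by simp
qed

lemma submodule_le_radical:
  assumes L: "submodule L A M" and "L \<noteq> carrier M"
  shows "L \<subseteq> radical"
proof (rule ccontr)
  assume "\<not> L \<subseteq> radical"
  then obtain m a where m: "m \<in> L" "m \<in> carrier M" "a \<in> carrier A" "\<psi> (a \<odot>\<^bsub>M\<^esub> m) \<noteq> \<zero>\<^bsub>T\<^esub>"
    using submoduleD(1)[OF L] by (auto simp: radical_def)
  let ?t = "\<psi> (a \<odot>\<^bsub>M\<^esub> m)" and ?S = "{t \<in> carrier T. \<iota> t \<in> L}"
  have "submodule ?S B T"
  proof (rule T.submoduleI)
    show "b \<odot>\<^bsub>T\<^esub> x \<in> ?S" if "b \<in> carrier B" "x \<in> ?S" for b x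
      using that submoduleD(4)[OF L] by (auto simp: \<iota>_smult corner_carrier)
  qed (use submoduleD[OF L] in \<open>auto simp: \<iota>_add \<iota>_zero\<close>)
  moreover have "?t \<in> ?S"
    using m \<psi>_closed submoduleD(4)[OF L] by (simp add: \<iota>_\<psi>)
  ultimately have "?S = carrier T" using simple_moduleD(3)[OF T] m(4) by blast
  then have "L = carrier M" by (intro generated[OF L]) auto
  with assms(2) show False by simp
qed

lemma radical_proper: "radical \<noteq> carrier M"
proof
  assume "radical = carrier M"
  then have "carrier T \<subseteq> {\<zero>\<^bsub>T\<^esub>}" using \<iota>_in_radical \<iota>_closed by auto
  then show False using simple_moduleD(2)[OF T] T.M.zero_closed by blast
qed

lemma maximal_submodule_iff: "maximal_submodule A M N \<longleftrightarrow> N = radical"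
  using submodule_le_radical submodule_radical radical_proper
  unfolding maximal_submodule_def by blast

lemma Rad_eq: "Rad A M = radical"
  using submoduleD(1)[OF submodule_radical] by (auto simp: Rad_def maximal_submodule_iff)

lemma simple_module_Hd: "simple_module A (Hd A M)"
  unfolding Hd_def Rad_eq
  by (rule simple_quotient_module) (simp_all add: maximal_submodule_iff M.left_module_axioms)

lemma corner_Hd_iso: "module_iso B T (corner_module A e (Hd A M))"
proof -
  let ?Q = "quotient_module M radical"
  interpret Q: coset_module A "add_monoid M" radical "smult M" ?Q
    by (rule quotient_coset_module[OF M.left_module_axioms submodule_radical])
  let ?c = "\<lambda>x. radical #>\<^bsub>add_monoid M\<^esub> x"
  have e_\<iota>: "e \<odot>\<^bsub>M\<^esub> \<iota> t = \<iota> t" if "t \<in> carrier T" for t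
    using \<iota>_\<psi>[OF \<iota>_closed[OF that]] \<psi>_\<iota>[OF that] by simp
  show ?thesis unfolding Hd_def Rad_eq
  proof (rule module_isoI[of "\<lambda>t. ?c (\<iota> t)"])
    show "bij_betw (\<lambda>t. ?c (\<iota> t)) (carrier T) (carrier (corner_module A e ?Q))"
      unfolding bij_betw_def
    proof (intro conjI inj_onI subset_antisym subsetI)
      fix s t assume st: "s \<in> carrier T" "t \<in> carrier T" "?c (\<iota> s) = ?c (\<iota> t)"
      then obtain n where n: "n \<in> radical" "\<iota> s = n \<oplus>\<^bsub>M\<^esub> \<iota> t"
        using Q.coset_eq_iff[of "\<iota> s" "\<iota> t"] \<iota>_closed by auto
      have nM: "n \<in> carrier M" using n(1) by (simp add: radical_def)
      have "\<psi> (\<one> \<odot>\<^bsub>M\<^esub> n) = \<zero>\<^bsub>T\<^esub>" using n(1) one_closed unfolding radical_def by blast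
      then have "\<psi> n = \<zero>\<^bsub>T\<^esub>" using nM by simp
      moreover have "\<psi> (\<iota> s) = \<psi> n \<oplus>\<^bsub>T\<^esub> \<psi> (\<iota> t)" unfolding n(2) by (rule \<psi>_add[OF nM \<iota>_closed[OF st(2)]])
      ultimately show "s = t" using st by (simp add: \<psi>_\<iota>)
    next
      fix x assume "x \<in> (\<lambda>t. ?c (\<iota> t)) ` carrier T"
      then show "x \<in> carrier (corner_module A e ?Q)"
        using \<iota>_closed Q.smult_coset e_\<iota> Q.carrier_coset by auto
    next
      fix x assume x: "x \<in> carrier (corner_module A e ?Q)"
      then obtain m where m: "m \<in> carrier M" "x = ?c m" using Q.carrier_coset by auto
      then have "x = ?c (\<iota> (\<psi> m))" using x Q.smult_coset[of e m] \<iota>_\<psi> by simp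
      then show "x \<in> (\<lambda>t. ?c (\<iota> t)) ` carrier T" using \<psi>_closed[OF m(1)] by blast
    qed
  qed (simp_all add: \<iota>_add \<iota>_smult \<iota>_closed corner_carrier Q.smult_coset
      Q.add_coset[simplified])
qed

end

section \<open>The tensor product\<close>

text \<open>
  \<open>X\<close> is an \<open>(A, S)\<close>-bimodule.  Its right action is a separate function \<open>rho\<close>, because the record of a left
  module has no field for it.
\<close>

locale bimodule_tensor = X: left_module A X + T: left_module S T
  for A :: "'a ring" and X :: "('a, 'x) module" and S :: "'s ring" and T :: "('s, 't) module" +
  fixes rho :: "'x \<Rightarrow> 's \<Rightarrow> 'x"
  assumes rho_closed: "\<And>x b. x \<in> carrier X \<Longrightarrow> b \<in> carrier S \<Longrightarrow> rho x b \<in> carrier X"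
    and rho_smult: "\<And>a x b. a \<in> carrier A \<Longrightarrow> x \<in> carrier X \<Longrightarrow> b \<in> carrier S \<Longrightarrow>
      rho (a \<odot>\<^bsub>X\<^esub> x) b = a \<odot>\<^bsub>X\<^esub> rho x b"
begin

abbreviation F where "F \<equiv> free_Abelian_group (carrier X \<times> carrier T)"
abbreviation rel where "rel \<equiv> tensor_relations S X rho T"
abbreviation N where "N \<equiv> generate F rel"
abbreviation MT where "MT \<equiv> tensor S X rho T"
abbreviation ten where "ten x t \<equiv> N #>\<^bsub>F\<^esub> frag_of (x, t)"

definition act :: "'a \<Rightarrow> (('x \<times> 't) \<Rightarrow>\<^sub>0 int) \<Rightarrow> (('x \<times> 't) \<Rightarrow>\<^sub>0 int)" where
  "act a = frag_extend (\<lambda>(x, t). frag_of (a \<odot>\<^bsub>X\<^esub> x, t))"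

lemma act_of [simp]: "act a (frag_of (x, t)) = frag_of (a \<odot>\<^bsub>X\<^esub> x, t)"
  by (simp add: act_def)

lemma act_diff: "act a (u - v) = act a u - act a v"
  by (simp add: act_def frag_extend_diff)

lemma act_closed: "a \<in> carrier A \<Longrightarrow> u \<in> carrier F \<Longrightarrow> act a u \<in> carrier F"
  using keys_frag_extend[of "\<lambda>(x, t). frag_of (a \<odot>\<^bsub>X\<^esub> x, t)" u] by (fastforce simp: act_def keys_frag_of)

lemma rel_left: "x \<in> carrier X \<Longrightarrow> y \<in> carrier X \<Longrightarrow> t \<in> carrier T \<Longrightarrow>
    frag_of (x \<oplus>\<^bsub>X\<^esub> y, t) - frag_of (x, t) - frag_of (y, t) \<in> rel"
  unfolding tensor_relations_def by blast

lemma rel_right: "x \<in> carrier X \<Longrightarrow> s \<in> carrier T \<Longrightarrow> t \<in> carrier T \<Longrightarrow>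
    frag_of (x, s \<oplus>\<^bsub>T\<^esub> t) - frag_of (x, s) - frag_of (x, t) \<in> rel"
  unfolding tensor_relations_def by blast

lemma rel_balanced: "x \<in> carrier X \<Longrightarrow> b \<in> carrier S \<Longrightarrow> t \<in> carrier T \<Longrightarrow>
    frag_of (rho x b, t) - frag_of (x, b \<odot>\<^bsub>T\<^esub> t) \<in> rel"
  unfolding tensor_relations_def by blast

lemma diff_closed: "u \<in> carrier F \<Longrightarrow> v \<in> carrier F \<Longrightarrow> u - v \<in> carrier F"
  using keys_diff[of u v] by fastforce

lemma rel_carrier: "rel \<subseteq> carrier F"
  unfolding tensor_relations_def
  by (auto intro!: diff_closed rho_closed simp del: carrier_free_Abelian_group_iff
      simp: frag_of_in_free_Abelian_group)

lemma act_rel: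
  assumes "a \<in> carrier A" "r \<in> rel"
  shows "act a r \<in> rel"
proof -
  consider (l) x y t where "r = frag_of (x \<oplus>\<^bsub>X\<^esub> y, t) - frag_of (x, t) - frag_of (y, t)"
      "x \<in> carrier X" "y \<in> carrier X" "t \<in> carrier T"
    | (r) x s t where "r = frag_of (x, s \<oplus>\<^bsub>T\<^esub> t) - frag_of (x, s) - frag_of (x, t)"
      "x \<in> carrier X" "s \<in> carrier T" "t \<in> carrier T"
    | (b) x b t where "r = frag_of (rho x b, t) - frag_of (x, b \<odot>\<^bsub>T\<^esub> t)"
      "x \<in> carrier X" "b \<in> carrier S" "t \<in> carrier T"
    using assms(2) by (auto simp: tensor_relations_def)
  then show ?thesis
  proof cases
    case l
    then show ?thesis using assms(1)
      using rel_left[of "a \<odot>\<^bsub>X\<^esub> x" "a \<odot>\<^bsub>X\<^esub> y" t] by (simp add: act_diff X.smult_r_distr)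
  next
    case r
    then show ?thesis using assms(1)
      using rel_right[of "a \<odot>\<^bsub>X\<^esub> x" s t] by (simp add: act_diff)
  next
    case b
    then show ?thesis using assms(1)
      using rel_balanced[of "a \<odot>\<^bsub>X\<^esub> x" b t] by (simp add: act_diff rho_smult)
  qed
qed

sublocale F: comm_group F by (rule abelian_free_Abelian_group)

lemma N_subgroup: "subgroup N F"
  by (rule F.generate_is_subgroup[OF rel_carrier])

lemma act_hom: "act a (u + v) = act a u + act a v"
  by (simp add: act_def frag_extend_add)

lemma act_N:
  assumes a: "a \<in> carrier A" and "u \<in> N"
  shows "act a u \<in> N"
  using assms(2)
proof induction
  case one
  then show ?case using generate.one[of F rel] by (simp add: act_def)
next
  case (incl h)
  then show ?case by (rule generate.incl[OF act_rel[OF a]])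
next
  case (inv h)
  then have "h \<in> carrier F" using rel_carrier by blast
  then have "inv\<^bsub>F\<^esub> h = - h" "inv\<^bsub>F\<^esub> (act a h) = - act a h"
    using act_closed[OF a, of h] by simp_all
  then show ?case using generate.inv[OF act_rel[OF a inv], of F] by (simp add: act_def frag_extend_minus)
next
  case (eng h1 h2)
  then show ?case using generate.eng[of "act a h1" F rel "act a h2"] by (simp add: act_hom)
qed

lemma rel_eq:
  assumes "u - v \<in> rel" "u \<in> carrier F" "v \<in> carrier F"
  shows "N #>\<^bsub>F\<^esub> u = N #>\<^bsub>F\<^esub> v"
proof -
  have "u \<in> N #>\<^bsub>F\<^esub> v"
    using generate.incl[OF assms(1), of F] by (force simp: r_coset_def)
  then show ?thesis using F.repr_independence[OF _ assms(3) N_subgroup] by simp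
qed

text \<open>
  Two additive maps that agree modulo \<open>N\<close> on pairs agree modulo \<open>N\<close>.  This is how \<open>act\<close> satisfies the module laws
  modulo the tensor relations, although it does not satisfy them in the free abelian group.
\<close>

lemma act_eqI:
  assumes f: "\<And>u v. f (u - v) = f u - f v" and g: "\<And>u v. g (u - v) = g u - g v"
    and eq: "\<And>x t. x \<in> carrier X \<Longrightarrow> t \<in> carrier T \<Longrightarrow> f (frag_of (x, t)) - g (frag_of (x, t)) \<in> N"
    and closed: "\<And>u. u \<in> carrier F \<Longrightarrow> f u \<in> carrier F"  "\<And>u. u \<in> carrier F \<Longrightarrow> g u \<in> carrier F"
    and u: "u \<in> carrier F"
  shows "N #>\<^bsub>F\<^esub> f u = N #>\<^bsub>F\<^esub> g u"
proof -
  have diffN: "x - y \<in> N" if "x \<in> N" "y \<in> N" for x y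
  proof -
    have "y \<in> carrier F" using that(2) subgroup.subset[OF N_subgroup] by blast
    then show ?thesis
      using subgroup.m_closed[OF N_subgroup that(1) subgroup.m_inv_closed[OF N_subgroup that(2)]] by simp
  qed
  have "f u - g u \<in> N"
    using u[simplified]
  proof (induction rule: frag_induction)
    case zero
    then show ?case using generate.one[of F rel] f[of 0 0] g[of 0 0] by simp
  next
    case (one x)
    then show ?case using eq by (cases x) auto
  next
    case (diff a b)
    have "f (a - b) - g (a - b) = (f a - g a) - (f b - g b)" by (simp add: f g)
    then show ?case using diffN[OF diff] by simp
  qed
  then have "f u \<in> N #>\<^bsub>F\<^esub> g u" by (force simp: r_coset_def)
  then show ?thesis using F.repr_independence[OF _ closed(2)[OF u] N_subgroup] by simp
qed

sublocale MT: coset_module A F N act MT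
proof (intro coset_module.intro coset_module_axioms.intro X.A.ring_axioms F.comm_group_axioms N_subgroup)
  show "N #>\<^bsub>F\<^esub> act (a \<oplus>\<^bsub>A\<^esub> b) u = N #>\<^bsub>F\<^esub> (act a u \<otimes>\<^bsub>F\<^esub> act b u)"
    if ab: "a \<in> carrier A" "b \<in> carrier A" and u: "u \<in> carrier F" for a b u
    unfolding mult_free_Abelian_group
  proof (rule act_eqI[OF _ _ _ _ _ u])
    show "act (a \<oplus>\<^bsub>A\<^esub> b) (frag_of (x, t)) - (act a (frag_of (x, t)) + act b (frag_of (x, t))) \<in> N"
      if "x \<in> carrier X" "t \<in> carrier T" for x t
      using that ab by (auto intro!: generate.incl simp: X.smult_l_distr diff_diff_eq[symmetric] tensor_relations_def)
    show "act a u + act b u \<in> carrier F" if "u \<in> carrier F" for u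
      using F.m_closed[OF act_closed[OF ab(1) that] act_closed[OF ab(2) that]] by simp
  qed (use ab act_closed in \<open>auto simp: act_diff simp del: carrier_free_Abelian_group_iff\<close>)
  show "N #>\<^bsub>F\<^esub> act (a \<otimes>\<^bsub>A\<^esub> b) u = N #>\<^bsub>F\<^esub> act a (act b u)"
    if ab: "a \<in> carrier A" "b \<in> carrier A" and u: "u \<in> carrier F" for a b u
    by (rule act_eqI[OF _ _ _ _ _ u])
      (use ab act_closed subgroup.one_closed[OF N_subgroup] in
        \<open>auto simp: act_diff X.smult_assoc simp del: carrier_free_Abelian_group_iff\<close>)
  show "N #>\<^bsub>F\<^esub> act \<one>\<^bsub>A\<^esub> u = N #>\<^bsub>F\<^esub> u" if u: "u \<in> carrier F" for u
    by (rule act_eqI[OF _ _ _ _ _ u])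
      (use act_closed subgroup.one_closed[OF N_subgroup] in
        \<open>auto simp: act_diff simp del: carrier_free_Abelian_group_iff\<close>)
qed (use act_closed act_N in \<open>simp_all add: tensor_def Let_def act_def[symmetric] act_hom
    del: carrier_free_Abelian_group_iff\<close>)

lemma ten_closed: "x \<in> carrier X \<Longrightarrow> t \<in> carrier T \<Longrightarrow> ten x t \<in> carrier MT"
  using MT.carrier_coset by auto

lemma ten_add_right:
  assumes "x \<in> carrier X" "s \<in> carrier T" "t \<in> carrier T"
  shows "ten x (s \<oplus>\<^bsub>T\<^esub> t) = ten x s \<oplus>\<^bsub>MT\<^esub> ten x t"
proof -
  have "ten x (s \<oplus>\<^bsub>T\<^esub> t) = N #>\<^bsub>F\<^esub> (frag_of (x, s) + frag_of (x, t))"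
  proof (rule rel_eq)
    show "frag_of (x, s) + frag_of (x, t) \<in> carrier F"
      using assms F.m_closed[of "frag_of (x, s)" "frag_of (x, t)"] by simp
  qed (use assms in \<open>auto simp: tensor_relations_def diff_diff_eq[symmetric]\<close>)
  then show ?thesis using assms MT.add_coset[of "frag_of (x, s)" "frag_of (x, t)"] by simp
qed

lemma ten_balanced:
  assumes "x \<in> carrier X" "b \<in> carrier S" "t \<in> carrier T"
  shows "ten (rho x b) t = ten x (b \<odot>\<^bsub>T\<^esub> t)"
  by (rule rel_eq) (use assms rho_closed in \<open>auto simp: tensor_relations_def\<close>)

lemma smult_ten:
  assumes "a \<in> carrier A" "x \<in> carrier X" "t \<in> carrier T"
  shows "a \<odot>\<^bsub>MT\<^esub> ten x t = ten (a \<odot>\<^bsub>X\<^esub> x) t"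
  using MT.smult_coset[of a "frag_of (x, t)"] assms by simp

lemma tensor_induct [consumes 1, case_names zero pure add minus]:
  assumes "m \<in> carrier MT" and "P \<zero>\<^bsub>MT\<^esub>"
    and "\<And>x t. x \<in> carrier X \<Longrightarrow> t \<in> carrier T \<Longrightarrow> P (ten x t)"
    and "\<And>m n. m \<in> carrier MT \<Longrightarrow> n \<in> carrier MT \<Longrightarrow> P m \<Longrightarrow> P n \<Longrightarrow> P (m \<oplus>\<^bsub>MT\<^esub> n)"
    and "\<And>m. m \<in> carrier MT \<Longrightarrow> P m \<Longrightarrow> P (\<ominus>\<^bsub>MT\<^esub> m)"
  shows "P m"
proof -
  interpret M: left_module A MT by (rule MT.left_module_Q)
  obtain u where u: "u \<in> carrier F" "m = N #>\<^bsub>F\<^esub> u" using assms(1) MT.carrier_coset by auto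
  have "P (N #>\<^bsub>F\<^esub> u)"
    using u(1)[unfolded carrier_free_Abelian_group_iff]
  proof (rule free_Abelian_group_induct)
    have "N #>\<^bsub>F\<^esub> 0 = N" using F.coset_mult_one[OF subgroup.subset[OF N_subgroup]] by simp
    then show "P (N #>\<^bsub>F\<^esub> 0)" using assms(2) by (simp add: MT.zero_Q)
    show "P (N #>\<^bsub>F\<^esub> frag_of a)" if "a \<in> carrier X \<times> carrier T" for a
      using that assms(3) by (cases a) auto
    fix a b :: "('x \<times> 't) \<Rightarrow>\<^sub>0 int"
    assume "Poly_Mapping.keys a \<subseteq> carrier X \<times> carrier T" "Poly_Mapping.keys b \<subseteq> carrier X \<times> carrier T"
    then have ab: "a \<in> carrier F" "b \<in> carrier F" "- b \<in> carrier F" by simp_all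
    assume P: "P (N #>\<^bsub>F\<^esub> a)" "P (N #>\<^bsub>F\<^esub> b)"
    have c: "N #>\<^bsub>F\<^esub> a \<in> carrier MT" "N #>\<^bsub>F\<^esub> b \<in> carrier MT" "N #>\<^bsub>F\<^esub> (- b) \<in> carrier MT"
      using ab MT.carrier_coset by blast+
    have "(N #>\<^bsub>F\<^esub> (- b)) \<oplus>\<^bsub>MT\<^esub> (N #>\<^bsub>F\<^esub> b) = \<zero>\<^bsub>MT\<^esub>"
      using MT.add_coset[OF ab(3,2)] \<open>N #>\<^bsub>F\<^esub> 0 = N\<close> by (simp add: MT.zero_Q)
    then have "N #>\<^bsub>F\<^esub> (- b) = \<ominus>\<^bsub>MT\<^esub> (N #>\<^bsub>F\<^esub> b)" using c M.M.minus_equality by metis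
    then have "P (N #>\<^bsub>F\<^esub> (- b))" using assms(5) c P by simp
    then show "P (N #>\<^bsub>F\<^esub> (a - b))"
      using assms(4)[OF c(1,3) P(1)] MT.add_coset[OF ab(1,3)] by simp
  qed
  then show ?thesis using u by simp
qed

text \<open>Used for the map \<open>x \<otimes> t \<mapsto> (e x) t\<close> from \<open>Ae \<otimes> T\<close> to \<open>T\<close>, which is only additive.\<close>

lemma tensor_universal:
  fixes H :: "('b, 'h) module"
  assumes "abelian_group H"
    and f: "\<And>x t. x \<in> carrier X \<Longrightarrow> t \<in> carrier T \<Longrightarrow> f x t \<in> carrier H"
    and f1: "\<And>x y t. x \<in> carrier X \<Longrightarrow> y \<in> carrier X \<Longrightarrow> t \<in> carrier T \<Longrightarrow>
      f (x \<oplus>\<^bsub>X\<^esub> y) t = f x t \<oplus>\<^bsub>H\<^esub> f y t"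
    and f2: "\<And>x s t. x \<in> carrier X \<Longrightarrow> s \<in> carrier T \<Longrightarrow> t \<in> carrier T \<Longrightarrow>
      f x (s \<oplus>\<^bsub>T\<^esub> t) = f x s \<oplus>\<^bsub>H\<^esub> f x t"
    and f3: "\<And>x b t. x \<in> carrier X \<Longrightarrow> b \<in> carrier S \<Longrightarrow> t \<in> carrier T \<Longrightarrow>
      f (rho x b) t = f x (b \<odot>\<^bsub>T\<^esub> t)"
  obtains g where "\<And>m. m \<in> carrier MT \<Longrightarrow> g m \<in> carrier H"
    "\<And>m n. m \<in> carrier MT \<Longrightarrow> n \<in> carrier MT \<Longrightarrow> g (m \<oplus>\<^bsub>MT\<^esub> n) = g m \<oplus>\<^bsub>H\<^esub> g n"
    "\<And>x t. x \<in> carrier X \<Longrightarrow> t \<in> carrier T \<Longrightarrow> g (ten x t) = f x t"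
proof -
  interpret H: abelian_group H by fact
  obtain h where h: "h \<in> hom F (add_monoid H)"
    "\<And>p. p \<in> carrier X \<times> carrier T \<Longrightarrow> h (frag_of p) = case_prod f p"
    using comm_group.free_Abelian_group_universal[OF H.a_comm_group, of "case_prod f" "carrier X \<times> carrier T"] f
    by (auto simp: image_subset_iff)
  interpret h: group_hom F "add_monoid H" h
    using h(1) by unfold_locales
  have hdiff: "h (u - v) = h u \<oplus>\<^bsub>H\<^esub> \<ominus>\<^bsub>H\<^esub> h v" if "u \<in> carrier F" "v \<in> carrier F" for u v
    using that h.hom_mult[of u "inv\<^bsub>F\<^esub> v"] h.hom_inv[OF that(2)] by (simp add: a_inv_def)
  have hdiff2: "h (u - v - w) = \<zero>\<^bsub>H\<^esub>"
    if "u \<in> carrier F" "v \<in> carrier F" "w \<in> carrier F" "h u = h v \<oplus>\<^bsub>H\<^esub> h w" for u v w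
  proof -
    have c: "h v \<in> carrier H" "h w \<in> carrier H" using that h.hom_closed by auto
    have "h (u - v - w) = (h v \<oplus>\<^bsub>H\<^esub> h w) \<oplus>\<^bsub>H\<^esub> \<ominus>\<^bsub>H\<^esub> h v \<oplus>\<^bsub>H\<^esub> \<ominus>\<^bsub>H\<^esub> h w"
      using that hdiff[OF diff_closed[of u v] that(3)] hdiff[of u v] by simp
    also have "\<dots> = h w \<oplus>\<^bsub>H\<^esub> \<ominus>\<^bsub>H\<^esub> h w"
      using c H.a_comm[of "h v" "h w"] by (simp add: H.a_assoc H.r_neg)
    finally show ?thesis using c by (simp add: H.r_neg)
  qed
  have rel0: "h r = \<zero>\<^bsub>H\<^esub>" if "r \<in> rel" for r
    using that unfolding tensor_relations_def
  proof (elim UnE CollectE exE conjE, goal_cases)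
    case (1 x y t)
    then show ?case using hdiff2 h(2) f1 by simp
  next
    case (2 x s t)
    then show ?case using hdiff2 h(2) f2 by simp
  next
    case (3 x b t)
    then show ?case using hdiff h(2) f3 rho_closed f by (simp add: H.r_neg)
  qed
  have N0: "h u = \<zero>\<^bsub>H\<^esub>" if "u \<in> N" for u
    using that
  proof induction
    case one
    then show ?case using h.hom_one by simp
  next
    case (incl r)
    then show ?case by (rule rel0)
  next
    case (inv r)
    then show ?case using rel0 rel_carrier h.hom_inv[of r] H.add.inv_one by auto
  next
    case (eng u v)
    then show ?case
      using h.hom_mult F.generate_in_carrier[OF rel_carrier eng.hyps(1)]
        F.generate_in_carrier[OF rel_carrier eng.hyps(2)] by simp
  qed
  have cos: "h u = h v" if uv: "u \<in> carrier F" "v \<in> carrier F" "N #>\<^bsub>F\<^esub> u = N #>\<^bsub>F\<^esub> v" for u v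
  proof -
    obtain n where n: "n \<in> N" "u = n \<otimes>\<^bsub>F\<^esub> v" using uv MT.coset_eq_iff by blast
    then have "h u = h n \<oplus>\<^bsub>H\<^esub> h v"
      using h.hom_mult[of n v] subgroup.mem_carrier[OF N_subgroup n(1)] uv(2) by simp
    moreover have "h v \<in> carrier H" using h.hom_closed[OF uv(2)] by simp
    ultimately show ?thesis using N0[OF n(1)] by simp
  qed
  obtain g where g: "g \<in> hom (F Mod N) (add_monoid H)" "\<And>u. u \<in> carrier F \<Longrightarrow> g (N #>\<^bsub>F\<^esub> u) = h u"
    using FactGroup_universal[OF h(1) MT.N_normal cos] by blast
  show thesis
  proof (rule that[of g])
    show "g m \<in> carrier H" if "m \<in> carrier MT" for m
      using that g(2) h.hom_closed MT.carrier_coset by auto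
    show "g (m \<oplus>\<^bsub>MT\<^esub> n) = g m \<oplus>\<^bsub>H\<^esub> g n" if "m \<in> carrier MT" "n \<in> carrier MT" for m n
      using that g(1) by (auto simp: hom_def MT.add_Q MT.carrier_Q FactGroup_def)
    show "g (ten x t) = f x t" if "x \<in> carrier X" "t \<in> carrier T" for x t
      using that g(2)[of "frag_of (x, t)"] h(2) by simp
  qed
qed

end

context ring_idempotent
begin

lemma left_ideal_simps [simp]:
  "\<zero>\<^bsub>left_ideal_module A e\<^esub> = \<zero>" "add (left_ideal_module A e) = add A"
  "smult (left_ideal_module A e) = mult A"
  by (simp_all add: left_ideal_module_def)

lemma left_ideal_carrier: "x \<in> carrier (left_ideal_module A e) \<longleftrightarrow> x \<in> carrier A \<and> x \<otimes> e = x"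
  by (force simp: left_ideal_module_def m_assoc)

lemma left_module_left_ideal: "left_module A (left_ideal_module A e)"
proof (intro left_module.intro left_module_axioms.intro ring_axioms abelian_groupI)
  show "\<exists>y\<in>carrier (left_ideal_module A e). y \<oplus>\<^bsub>left_ideal_module A e\<^esub> x = \<zero>\<^bsub>left_ideal_module A e\<^esub>"
    if "x \<in> carrier (left_ideal_module A e)" for x
    using that by (intro bexI[of _ "\<ominus> x"]) (simp_all add: left_ideal_carrier l_minus l_neg)
qed (simp_all add: left_ideal_carrier l_distr r_distr a_ac m_assoc)

text \<open>
  The relation \<open>e (x \<otimes> t) = e \<otimes> (e x) t\<close>, for \<open>x\<close> in \<open>Ae\<close>, shows that \<open>e (Ae \<otimes> T)\<close> consists of the elements
  \<open>e \<otimes> t\<close>.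
\<close>

lemma corner_extension_tensor:
  assumes T: "simple_module B T"
  shows "\<exists>\<iota> \<psi>. corner_extension A e (tensor B (left_ideal_module A e) (mult A) T) T \<iota> \<psi>"
proof -
  interpret T: left_module B T by (rule simple_moduleD(1)[OF T])
  let ?X = "left_ideal_module A e"
  interpret X: bimodule_tensor A ?X B T "mult A"
    by (intro bimodule_tensor.intro bimodule_tensor_axioms.intro left_module_left_ideal T.left_module_axioms)
      (simp_all add: left_ideal_carrier corner_carrier m_assoc)
  interpret MT: left_module A X.MT by (rule X.MT.left_module_Q)
  have eX: "e \<in> carrier ?X" by (simp add: left_ideal_carrier)
  have xB: "e \<otimes> x \<in> carrier B" if "x \<in> carrier ?X" for x
    using that by (simp add: left_ideal_carrier corner_carrier m_assoc m_assoc[symmetric, of e e])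
  obtain \<psi> where \<psi>: "\<And>m. m \<in> carrier X.MT \<Longrightarrow> \<psi> m \<in> carrier T"
    "\<And>m n. m \<in> carrier X.MT \<Longrightarrow> n \<in> carrier X.MT \<Longrightarrow> \<psi> (m \<oplus>\<^bsub>X.MT\<^esub> n) = \<psi> m \<oplus>\<^bsub>T\<^esub> \<psi> n"
    "\<And>x t. x \<in> carrier ?X \<Longrightarrow> t \<in> carrier T \<Longrightarrow> \<psi> (X.ten x t) = (e \<otimes> x) \<odot>\<^bsub>T\<^esub> t"
  proof (rule X.tensor_universal[OF T.M.abelian_group_axioms, of "\<lambda>x t. (e \<otimes> x) \<odot>\<^bsub>T\<^esub> t"])
    show "(e \<otimes> (x \<oplus>\<^bsub>?X\<^esub> y)) \<odot>\<^bsub>T\<^esub> t = (e \<otimes> x) \<odot>\<^bsub>T\<^esub> t \<oplus>\<^bsub>T\<^esub> (e \<otimes> y) \<odot>\<^bsub>T\<^esub> t"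
      if "x \<in> carrier ?X" "y \<in> carrier ?X" "t \<in> carrier T" for x y t
      using that xB T.smult_l_distr[of "e \<otimes> x" "e \<otimes> y" t] by (simp add: left_ideal_carrier r_distr)
    show "(e \<otimes> (x \<otimes> b)) \<odot>\<^bsub>T\<^esub> t = (e \<otimes> x) \<odot>\<^bsub>T\<^esub> (b \<odot>\<^bsub>T\<^esub> t)"
      if "x \<in> carrier ?X" "b \<in> carrier B" "t \<in> carrier T" for x b t
      using that xB T.smult_assoc[of "e \<otimes> x" b t] by (simp add: left_ideal_carrier corner_carrier m_assoc)
  qed (use xB in \<open>auto simp: T.smult_r_distr\<close>)
  let ?\<iota> = "X.ten e"
  have \<iota>_add: "?\<iota> (s \<oplus>\<^bsub>T\<^esub> t) = ?\<iota> s \<oplus>\<^bsub>X.MT\<^esub> ?\<iota> t" if "s \<in> carrier T" "t \<in> carrier T" for s t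
    by (rule X.ten_add_right[OF eX that])
  have \<iota>_closed: "?\<iota> t \<in> carrier X.MT" if "t \<in> carrier T" for t by (rule X.ten_closed[OF eX that])
  have e_ten: "e \<odot>\<^bsub>X.MT\<^esub> X.ten x t = ?\<iota> ((e \<otimes> x) \<odot>\<^bsub>T\<^esub> t)" if "x \<in> carrier ?X" "t \<in> carrier T" for x t
  proof -
    have "e \<otimes> (e \<otimes> x) = e \<otimes> x" using that by (simp add: left_ideal_carrier m_assoc[symmetric])
    then show ?thesis using X.ten_balanced[OF eX xB[OF that(1)] that(2)] X.smult_ten[OF e_closed that] by simp
  qed
  have "corner_extension A e X.MT T ?\<iota> \<psi>"
  proof (intro corner_extension.intro corner_extension_axioms.intro ring_idempotent_axioms
      MT.left_module_axioms T)
    show "?\<iota> (b \<odot>\<^bsub>T\<^esub> t) = b \<odot>\<^bsub>X.MT\<^esub> ?\<iota> t" if "b \<in> carrier B" "t \<in> carrier T" for b t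
      using X.ten_balanced[OF eX that] X.smult_ten[of b e t] that eX by (simp add: corner_carrier)
    show "\<psi> (?\<iota> t) = t" if "t \<in> carrier T" for t
      using \<psi>(3)[OF eX that] T.smult_one[OF that] by simp
    show "?\<iota> (\<psi> m) = e \<odot>\<^bsub>X.MT\<^esub> m" if "m \<in> carrier X.MT" for m
      using that
    proof (induction rule: X.tensor_induct)
      case zero
      have "?\<iota> \<zero>\<^bsub>T\<^esub> = \<zero>\<^bsub>X.MT\<^esub>"
        using \<iota>_add[of "\<zero>\<^bsub>T\<^esub>" "\<zero>\<^bsub>T\<^esub>"] \<iota>_closed[of "\<zero>\<^bsub>T\<^esub>"] MT.M.add.l_cancel_one' by simp
      moreover have "\<psi> \<zero>\<^bsub>X.MT\<^esub> = \<zero>\<^bsub>T\<^esub>"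
        using \<psi>(2)[of "\<zero>\<^bsub>X.MT\<^esub>" "\<zero>\<^bsub>X.MT\<^esub>"] \<psi>(1)[of "\<zero>\<^bsub>X.MT\<^esub>"] T.M.add.l_cancel_one' by simp
      ultimately show ?case by simp
    next
      case (pure x t)
      then show ?case using e_ten \<psi>(3) by simp
    next
      case (add m n)
      then show ?case using \<psi>(1,2) \<iota>_add by (simp add: MT.smult_r_distr)
    next
      case (minus m)
      have z: "\<psi> \<zero>\<^bsub>X.MT\<^esub> = \<zero>\<^bsub>T\<^esub>" "?\<iota> \<zero>\<^bsub>T\<^esub> = \<zero>\<^bsub>X.MT\<^esub>"
        using \<psi>(2)[of "\<zero>\<^bsub>X.MT\<^esub>" "\<zero>\<^bsub>X.MT\<^esub>"] \<psi>(1)[of "\<zero>\<^bsub>X.MT\<^esub>"] T.M.add.l_cancel_one'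
          \<iota>_add[of "\<zero>\<^bsub>T\<^esub>" "\<zero>\<^bsub>T\<^esub>"] \<iota>_closed[of "\<zero>\<^bsub>T\<^esub>"] MT.M.add.l_cancel_one' by simp_all
      have "?\<iota> (\<psi> (\<ominus>\<^bsub>X.MT\<^esub> m)) \<oplus>\<^bsub>X.MT\<^esub> ?\<iota> (\<psi> m) = ?\<iota> (\<psi> (\<ominus>\<^bsub>X.MT\<^esub> m \<oplus>\<^bsub>X.MT\<^esub> m))"
        using minus \<psi>(1,2) \<iota>_add by simp
      also have "\<dots> = \<zero>\<^bsub>X.MT\<^esub>" using minus z by (simp add: MT.M.l_neg)
      finally have "?\<iota> (\<psi> (\<ominus>\<^bsub>X.MT\<^esub> m)) = \<ominus>\<^bsub>X.MT\<^esub> ?\<iota> (\<psi> m)"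
        using minus \<psi>(1) \<iota>_closed MT.M.minus_equality by simp
      then show ?case using minus by (simp add: MT.smult_r_minus)
    qed
    show "L = carrier X.MT" if L: "submodule L A X.MT" "?\<iota> ` carrier T \<subseteq> L" for L
    proof
      show "carrier X.MT \<subseteq> L"
      proof
        fix m assume "m \<in> carrier X.MT"
        then show "m \<in> L"
        proof (induction rule: X.tensor_induct)
          case (pure x t)
          then have "x \<odot>\<^bsub>X.MT\<^esub> ?\<iota> t \<in> L" using L submoduleD(4)[OF L(1)] by (auto simp: left_ideal_carrier)
          then show ?case using pure X.smult_ten[of x e t] eX by (simp add: left_ideal_carrier)
        qed (use submoduleD[OF L(1)] in auto)
      qed
    qed (rule submoduleD(1)[OF L(1)])
  qed (use \<psi> \<iota>_add \<iota>_closed in auto)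
  then show ?thesis by blast
qed

lemma simple_head_tensor:
  assumes "simple_module B T"
  shows "simple_module A (Hd A (tensor B (left_ideal_module A e) (mult A) T))"
    and "module_iso B T (corner_module A e (Hd A (tensor B (left_ideal_module A e) (mult A) T)))"
proof -
  obtain \<iota> \<psi> where "corner_extension A e (tensor B (left_ideal_module A e) (mult A) T) T \<iota> \<psi>"
    using corner_extension_tensor[OF assms] by blast
  then interpret corner_extension A e "tensor B (left_ideal_module A e) (mult A) T" T \<iota> \<psi> .
  show "simple_module A (Hd A (tensor B (left_ideal_module A e) (mult A) T))"
    by (rule simple_module_Hd)
  show "module_iso B T (corner_module A e (Hd A (tensor B (left_ideal_module A e) (mult A) T)))"
    by (rule corner_Hd_iso)
qed

end

section \<open>Algebras with a finite basis\<close>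

text \<open>
  Distributivity of the product and induction over sums of monomials reduce every algebraic law to
  monomials.  The closure of \<open>c\<close> is required even if only one argument lies in \<open>X\<close>: the cocycle identity also
  mentions the values of \<open>c\<close> at products \<open>op x y\<close> that may fall outside the basis.
\<close>

locale basis_product = R?: cring R
  for R :: "'r ring" (structure) +
  fixes X :: "'x set" and c :: "'x \<Rightarrow> 'x \<Rightarrow> 'r" and op :: "'x \<Rightarrow> 'x \<Rightarrow> 'x" and u :: "'x \<Rightarrow> 'r"
  assumes finite_X: "finite X"
    and c_closed: "\<And>x y. x \<in> X \<or> y \<in> X \<Longrightarrow> c x y \<in> carrier R"
    and op_closed: "\<And>x y. x \<in> X \<Longrightarrow> y \<in> X \<Longrightarrow> c x y \<noteq> \<zero> \<Longrightarrow> op x y \<in> X"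
    and op_assoc: "\<And>x y z. x \<in> X \<Longrightarrow> y \<in> X \<Longrightarrow> z \<in> X \<Longrightarrow> op (op x y) z = op x (op y z)"
    and cocycle: "\<And>x y z. x \<in> X \<Longrightarrow> y \<in> X \<Longrightarrow> z \<in> X \<Longrightarrow>
      c x y \<otimes> c (op x y) z = c x (op y z) \<otimes> c y z"
begin

abbreviation BA where "BA \<equiv> basis_algebra R X c op u"
abbreviation mono where "mono \<equiv> monomial R X"

lemma BA_simps [simp]:
  "carrier BA = X \<rightarrow>\<^sub>E carrier R" "\<one>\<^bsub>BA\<^esub> = u" "\<zero>\<^bsub>BA\<^esub> = (\<lambda>x\<in>X. \<zero>)"
  "f \<oplus>\<^bsub>BA\<^esub> g = (\<lambda>x\<in>X. f x \<oplus> g x)"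
  by (simp_all add: basis_algebra_def)

abbreviation pairs where "pairs z \<equiv> {(x, y). x \<in> X \<and> y \<in> X \<and> op x y = z}"

lemma mult_BA: "f \<otimes>\<^bsub>BA\<^esub> g =
    (\<lambda>z\<in>X. \<Oplus>p\<in>pairs z. c (fst p) (snd p) \<otimes> (f (fst p) \<otimes> g (snd p)))"
  by (simp add: basis_algebra_def)

lemma finite_pairs [simp]: "finite (pairs z)"
  by (rule finite_subset[of _ "X \<times> X"]) (auto simp: finite_X)

lemma carrierD: "f \<in> X \<rightarrow>\<^sub>E carrier R \<Longrightarrow> x \<in> X \<Longrightarrow> f x \<in> carrier R"
  by auto

lemma term_closed:
  assumes "f \<in> carrier BA" "g \<in> carrier BA"
  shows "(\<lambda>p. c (fst p) (snd p) \<otimes> (f (fst p) \<otimes> g (snd p))) \<in> pairs z \<rightarrow> carrier R"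
  using assms by (simp add: Pi_def c_closed carrierD split_beta)

lemma mult_closed: "f \<in> carrier BA \<Longrightarrow> g \<in> carrier BA \<Longrightarrow> f \<otimes>\<^bsub>BA\<^esub> g \<in> carrier BA"
  using finsum_closed[OF term_closed] by (auto simp: mult_BA)

lemma mono_closed [simp]: "r \<in> carrier R \<Longrightarrow> mono r x \<in> X \<rightarrow>\<^sub>E carrier R"
  by (auto simp: monomial_def)

lemma mono_zero [simp]: "mono \<zero> x = \<zero>\<^bsub>BA\<^esub>"
  by (auto simp: monomial_def restrict_def)

lemma distrib_left:
  assumes "f \<in> carrier BA" "g \<in> carrier BA" "h \<in> carrier BA"
  shows "f \<otimes>\<^bsub>BA\<^esub> (g \<oplus>\<^bsub>BA\<^esub> h) = f \<otimes>\<^bsub>BA\<^esub> g \<oplus>\<^bsub>BA\<^esub> f \<otimes>\<^bsub>BA\<^esub> h"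
proof (rule ext)
  fix z
  have "(\<Oplus>p\<in>pairs z. c (fst p) (snd p) \<otimes> (f (fst p) \<otimes> (g \<oplus>\<^bsub>BA\<^esub> h) (snd p))) =
     (\<Oplus>p\<in>pairs z. c (fst p) (snd p) \<otimes> (f (fst p) \<otimes> g (snd p)) \<oplus> c (fst p) (snd p) \<otimes> (f (fst p) \<otimes> h (snd p)))"
    using assms by (intro finsum_cong') (auto simp: c_closed r_distr carrierD)
  then show "(f \<otimes>\<^bsub>BA\<^esub> (g \<oplus>\<^bsub>BA\<^esub> h)) z = (f \<otimes>\<^bsub>BA\<^esub> g \<oplus>\<^bsub>BA\<^esub> f \<otimes>\<^bsub>BA\<^esub> h) z"
    using finsum_addf[OF term_closed[OF assms(1,2)] term_closed[OF assms(1,3)]]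
    by (simp add: mult_BA)
qed

lemma distrib_right:
  assumes "f \<in> carrier BA" "g \<in> carrier BA" "h \<in> carrier BA"
  shows "(f \<oplus>\<^bsub>BA\<^esub> g) \<otimes>\<^bsub>BA\<^esub> h = f \<otimes>\<^bsub>BA\<^esub> h \<oplus>\<^bsub>BA\<^esub> g \<otimes>\<^bsub>BA\<^esub> h"
proof (rule ext)
  fix z
  have "(\<Oplus>p\<in>pairs z. c (fst p) (snd p) \<otimes> ((f \<oplus>\<^bsub>BA\<^esub> g) (fst p) \<otimes> h (snd p))) =
     (\<Oplus>p\<in>pairs z. c (fst p) (snd p) \<otimes> (f (fst p) \<otimes> h (snd p)) \<oplus> c (fst p) (snd p) \<otimes> (g (fst p) \<otimes> h (snd p)))"
    using assms by (intro finsum_cong') (auto simp: c_closed r_distr l_distr carrierD)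
  then show "((f \<oplus>\<^bsub>BA\<^esub> g) \<otimes>\<^bsub>BA\<^esub> h) z = (f \<otimes>\<^bsub>BA\<^esub> h \<oplus>\<^bsub>BA\<^esub> g \<otimes>\<^bsub>BA\<^esub> h) z"
    using finsum_addf[OF term_closed[OF assms(1,3)] term_closed[OF assms(2,3)]]
    by (simp add: mult_BA)
qed

lemma mult_zero:
  assumes "f \<in> carrier BA"
  shows "\<zero>\<^bsub>BA\<^esub> \<otimes>\<^bsub>BA\<^esub> f = \<zero>\<^bsub>BA\<^esub>" "f \<otimes>\<^bsub>BA\<^esub> \<zero>\<^bsub>BA\<^esub> = \<zero>\<^bsub>BA\<^esub>"
  using assms by (auto simp: mult_BA restrict_def carrierD c_closed intro!: ext add.finprod_one_eqI)

lemma single_term: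
  assumes "finite P" "p \<in> P \<Longrightarrow> v = f p" "v \<in> carrier R" "\<And>q. q \<in> P \<Longrightarrow> q \<noteq> p \<Longrightarrow> f q = \<zero>"
  shows "finsum R f P = (if p \<in> P then v else \<zero>)"
proof (cases "p \<in> P")
  case True
  have "finsum R f P = finsum R (\<lambda>q. if p = q then v else \<zero>) P"
    using assms True by (intro finsum_cong') auto
  also have "\<dots> = v"
    using True assms by (intro finsum_singleton) auto
  finally show ?thesis using True by simp
next
  case False
  then show ?thesis using assms by (auto intro!: add.finprod_one_eqI)
qed

lemma mult_single:
  assumes "f \<in> carrier BA" "g \<in> carrier BA" "a \<in> X" "b \<in> X"
    and "\<And>x y. x \<in> X \<Longrightarrow> y \<in> X \<Longrightarrow> (x, y) \<noteq> (a, b) \<Longrightarrow> c x y \<otimes> (f x \<otimes> g y) = \<zero>"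
  shows "f \<otimes>\<^bsub>BA\<^esub> g = mono (c a b \<otimes> (f a \<otimes> g b)) (op a b)"
proof (rule ext)
  fix z
  have "(\<Oplus>p\<in>pairs z. c (fst p) (snd p) \<otimes> (f (fst p) \<otimes> g (snd p))) =
    (if (a, b) \<in> pairs z then c a b \<otimes> (f a \<otimes> g b) else \<zero>)"
  proof (rule single_term)
    show "c (fst q) (snd q) \<otimes> (f (fst q) \<otimes> g (snd q)) = \<zero>" if "q \<in> pairs z" "q \<noteq> (a, b)" for q
      using that assms(5)[of "fst q" "snd q"] by (cases q) simp
  qed (use assms in \<open>auto simp: c_closed carrierD\<close>)
  then show "(f \<otimes>\<^bsub>BA\<^esub> g) z = mono (c a b \<otimes> (f a \<otimes> g b)) (op a b) z"
    using assms by (auto simp: mult_BA monomial_def)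
qed

lemma mono_mult:
  assumes "r \<in> carrier R" "s \<in> carrier R" "x \<in> X" "y \<in> X"
  shows "mono r x \<otimes>\<^bsub>BA\<^esub> mono s y = mono (c x y \<otimes> (r \<otimes> s)) (op x y)"
  using mult_single[of "mono r x" "mono s y" x y] assms by (auto simp: monomial_def c_closed)

lemma basis_span_subset: "basis_span R X Y \<subseteq> carrier BA"
  by (auto simp: basis_span_def)

lemma basis_span_X: "basis_span R X X = carrier BA"
  by (auto simp: basis_span_def)

lemma mono_in_basis_span: "r \<in> carrier R \<Longrightarrow> x \<in> Y \<Longrightarrow> mono r x \<in> basis_span R X Y"
  by (auto simp: basis_span_def monomial_def)

lemma basis_span_induct [consumes 1, case_names zero mono add]:
  assumes f: "f \<in> basis_span R X Y" and zero: "P \<zero>\<^bsub>BA\<^esub>"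
    and mono: "\<And>r x. r \<in> carrier R \<Longrightarrow> x \<in> X \<Longrightarrow> x \<in> Y \<Longrightarrow> P (mono r x)"
    and add: "\<And>f g. f \<in> basis_span R X Y \<Longrightarrow> g \<in> basis_span R X Y \<Longrightarrow> P f \<Longrightarrow> P g \<Longrightarrow> P (f \<oplus>\<^bsub>BA\<^esub> g)"
  shows "P f"
proof -
  have "\<forall>f\<in>basis_span R X Z. P f" if "finite Z" "Z \<subseteq> X \<inter> Y" for Z
    using that
  proof (induction rule: finite_induct)
    case empty
    have "f = \<zero>\<^bsub>BA\<^esub>" if "f \<in> basis_span R X {}" for f
      using that by (auto simp: basis_span_def fun_eq_iff restrict_def PiE_def extensional_def)
    then show ?case using zero by metis
  next
    case (insert x Z)
    show ?case
    proof
      fix f assume f: "f \<in> basis_span R X (insert x Z)"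
      let ?g = "\<lambda>y\<in>X. if y = x then \<zero> else f y"
      have x: "x \<in> X" "x \<in> Y" using insert by auto
      have fx: "f x \<in> carrier R" using f x by (auto simp: basis_span_def)
      have g: "?g \<in> basis_span R X Z" using f by (auto simp: basis_span_def)
      moreover have "basis_span R X Z \<subseteq> basis_span R X Y"
        using insert.prems unfolding basis_span_def by blast
      ultimately have gY: "?g \<in> basis_span R X Y" by blast
      have "f = mono (f x) x \<oplus>\<^bsub>BA\<^esub> ?g"
      proof (rule ext)
        show "f y = (mono (f x) x \<oplus>\<^bsub>BA\<^esub> ?g) y" for y
          using f x by (cases "y \<in> X") (auto simp: basis_span_def monomial_def carrierD)
      qed
      then show "P f"
        using add[OF mono_in_basis_span[OF fx x(2)] gY mono[OF fx x]] insert g by auto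
    qed
  qed
  moreover have "f \<in> basis_span R X (X \<inter> Y)" using f by (auto simp: basis_span_def)
  ultimately show ?thesis using finite_X by blast
qed

lemma basis_span_mult:
  assumes f: "f \<in> basis_span R X Y1" and g: "g \<in> basis_span R X Y2"
    and Y: "\<And>x y. x \<in> X \<Longrightarrow> y \<in> X \<Longrightarrow> x \<in> Y1 \<Longrightarrow> y \<in> Y2 \<Longrightarrow> c x y \<noteq> \<zero> \<Longrightarrow> op x y \<in> Y3"
  shows "f \<otimes>\<^bsub>BA\<^esub> g \<in> basis_span R X Y3"
proof -
  have fg: "f \<in> carrier BA" "g \<in> carrier BA" using f g basis_span_subset by auto
  have "(f \<otimes>\<^bsub>BA\<^esub> g) z = \<zero>" if z: "z \<in> X" "z \<notin> Y3" for z
  proof -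
    have "c x y \<otimes> (f x \<otimes> g y) = \<zero>" if xy: "x \<in> X" "y \<in> X" "op x y = z" for x y
    proof -
      consider "x \<notin> Y1" | "y \<notin> Y2" | "c x y = \<zero>" using Y xy z by blast
      then show ?thesis
        using f g fg xy by cases (auto simp: basis_span_def c_closed carrierD)
    qed
    then show ?thesis using z by (auto simp: mult_BA intro!: add.finprod_one_eqI)
  qed
  then show ?thesis using mult_closed[OF fg] by (auto simp: basis_span_def)
qed

lemma abelian_group_BA: "abelian_group BA"
proof (rule abelian_groupI)
  show "\<exists>g\<in>carrier BA. g \<oplus>\<^bsub>BA\<^esub> f = \<zero>\<^bsub>BA\<^esub>" if "f \<in> carrier BA" for f
    using that by (intro bexI[of _ "\<lambda>x\<in>X. \<ominus> f x"]) (auto simp: restrict_def carrierD l_neg)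
  show "f \<oplus>\<^bsub>BA\<^esub> g \<oplus>\<^bsub>BA\<^esub> h = f \<oplus>\<^bsub>BA\<^esub> (g \<oplus>\<^bsub>BA\<^esub> h)"
    if "f \<in> carrier BA" "g \<in> carrier BA" "h \<in> carrier BA" for f g h
    using that by (auto simp: restrict_def carrierD a_assoc)
  show "f \<oplus>\<^bsub>BA\<^esub> g = g \<oplus>\<^bsub>BA\<^esub> f" if "f \<in> carrier BA" "g \<in> carrier BA" for f g
    using that by (auto simp: restrict_def carrierD a_comm)
  show "\<zero>\<^bsub>BA\<^esub> \<oplus>\<^bsub>BA\<^esub> f = f" if "f \<in> carrier BA" for f
    using that by (auto simp: fun_eq_iff restrict_def carrierD PiE_def extensional_def)
qed auto

lemma mono_assoc:
  assumes "r \<in> carrier R" "s \<in> carrier R" "t \<in> carrier R" "x \<in> X" "y \<in> X" "z \<in> X"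
  shows "mono r x \<otimes>\<^bsub>BA\<^esub> mono s y \<otimes>\<^bsub>BA\<^esub> mono t z = mono r x \<otimes>\<^bsub>BA\<^esub> (mono s y \<otimes>\<^bsub>BA\<^esub> mono t z)"
proof -
  have c: "c x y \<in> carrier R" "c (op x y) z \<in> carrier R" "c x (op y z) \<in> carrier R" "c y z \<in> carrier R"
    using assms c_closed by auto
  have left: "mono r x \<otimes>\<^bsub>BA\<^esub> mono s y \<otimes>\<^bsub>BA\<^esub> mono t z =
    mono (c x y \<otimes> c (op x y) z \<otimes> (r \<otimes> s \<otimes> t)) (op (op x y) z)"
  proof (cases "op x y \<in> X")
    case True
    then show ?thesis using assms c by (simp add: mono_mult m_ac)
  next
    case False
    then have "c x y = \<zero>" using op_closed assms by blast
    then show ?thesis using assms c mult_zero(1)[of "mono t z"] by (simp add: mono_mult)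
  qed
  have right: "mono r x \<otimes>\<^bsub>BA\<^esub> (mono s y \<otimes>\<^bsub>BA\<^esub> mono t z) =
    mono (c x (op y z) \<otimes> c y z \<otimes> (r \<otimes> s \<otimes> t)) (op x (op y z))"
  proof (cases "op y z \<in> X")
    case True
    then show ?thesis using assms c by (simp add: mono_mult m_ac)
  next
    case False
    then have "c y z = \<zero>" using op_closed assms by blast
    then show ?thesis using assms c mult_zero(2)[of "mono r x"] by (simp add: mono_mult)
  qed
  show ?thesis unfolding left right using assms by (simp add: op_assoc cocycle)
qed

lemma BA_induct [consumes 1, case_names zero mono add]:
  assumes "f \<in> carrier BA" "P \<zero>\<^bsub>BA\<^esub>"
    and "\<And>r x. r \<in> carrier R \<Longrightarrow> x \<in> X \<Longrightarrow> P (mono r x)"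
    and "\<And>f g. f \<in> carrier BA \<Longrightarrow> g \<in> carrier BA \<Longrightarrow> P f \<Longrightarrow> P g \<Longrightarrow> P (f \<oplus>\<^bsub>BA\<^esub> g)"
  shows "P f"
  using assms(1)[folded basis_span_X] assms(2-) by (induction rule: basis_span_induct) (simp_all add: basis_span_X)

lemma zero_in_BA: "\<zero>\<^bsub>BA\<^esub> \<in> carrier BA"
  by simp

lemma mono_in_BA: "r \<in> carrier R \<Longrightarrow> mono r x \<in> carrier BA"
  by simp

end

locale twisted_basis = basis_product +
  assumes u_closed: "u \<in> X \<rightarrow>\<^sub>E carrier R"
    and u_left: "\<And>r x. r \<in> carrier R \<Longrightarrow> x \<in> X \<Longrightarrow> u \<otimes>\<^bsub>BA\<^esub> mono r x = mono r x"
    and u_right: "\<And>r x. r \<in> carrier R \<Longrightarrow> x \<in> X \<Longrightarrow> mono r x \<otimes>\<^bsub>BA\<^esub> u = mono r x"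
begin

lemma ring_BA: "ring BA"
proof (rule ringI)
  note [simp del] = BA_simps
  note [simp] = mult_closed mult_zero distrib_left distrib_right zero_in_BA mono_in_BA
  interpret G: abelian_group BA by (rule abelian_group_BA)
  show "abelian_group BA" by (rule abelian_group_BA)
  show "monoid BA"
  proof (rule monoidI)
    show one: "\<one>\<^bsub>BA\<^esub> \<in> carrier BA" using u_closed by (simp add: BA_simps)
    show "\<one>\<^bsub>BA\<^esub> \<otimes>\<^bsub>BA\<^esub> f = f" if "f \<in> carrier BA" for f
      using that by (induction rule: BA_induct) (use one u_left in \<open>simp_all add: BA_simps(2)\<close>)
    show "f \<otimes>\<^bsub>BA\<^esub> \<one>\<^bsub>BA\<^esub> = f" if "f \<in> carrier BA" for f
      using that by (induction rule: BA_induct) (use one u_right in \<open>simp_all add: BA_simps(2)\<close>)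
    have 1: "mono r x \<otimes>\<^bsub>BA\<^esub> mono s y \<otimes>\<^bsub>BA\<^esub> h = mono r x \<otimes>\<^bsub>BA\<^esub> (mono s y \<otimes>\<^bsub>BA\<^esub> h)"
      if "h \<in> carrier BA" "r \<in> carrier R" "x \<in> X" "s \<in> carrier R" "y \<in> X" for r x s y h
      using that by (induction rule: BA_induct) (simp_all add: mono_assoc)
    have 2: "mono r x \<otimes>\<^bsub>BA\<^esub> g \<otimes>\<^bsub>BA\<^esub> h = mono r x \<otimes>\<^bsub>BA\<^esub> (g \<otimes>\<^bsub>BA\<^esub> h)"
      if "g \<in> carrier BA" "h \<in> carrier BA" "r \<in> carrier R" "x \<in> X" for r x g h
      using that by (induction rule: BA_induct) (simp_all add: 1)
    show "f \<otimes>\<^bsub>BA\<^esub> g \<otimes>\<^bsub>BA\<^esub> h = f \<otimes>\<^bsub>BA\<^esub> (g \<otimes>\<^bsub>BA\<^esub> h)"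
      if "f \<in> carrier BA" "g \<in> carrier BA" "h \<in> carrier BA" for f g h
      using that by (induction rule: BA_induct) (simp_all add: 2)
  qed simp
qed (auto simp: distrib_left distrib_right simp del: BA_simps)

text \<open>
  The span of \<open>Y\<close> occurs instead of the whole algebra because the projection from \<open>e'Ae'\<close> to the group algebra of
  \<open>\<Gamma>\<^sub>e\<close> is multiplicative only on \<open>e'Ae'\<close>.
\<close>

lemma additive_mult_on_span:
  assumes B: "ring B" and Y: "\<And>x y. x \<in> X \<Longrightarrow> y \<in> X \<Longrightarrow> x \<in> Y \<Longrightarrow> y \<in> Y \<Longrightarrow> c x y \<noteq> \<zero> \<Longrightarrow> op x y \<in> Y"
    and closed: "\<And>f. f \<in> basis_span R X Y \<Longrightarrow> \<phi> f \<in> carrier B"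
    and add: "\<And>f g. f \<in> basis_span R X Y \<Longrightarrow> g \<in> basis_span R X Y \<Longrightarrow> \<phi> (f \<oplus>\<^bsub>BA\<^esub> g) = \<phi> f \<oplus>\<^bsub>B\<^esub> \<phi> g"
    and mult: "\<And>r s x y. r \<in> carrier R \<Longrightarrow> s \<in> carrier R \<Longrightarrow> x \<in> X \<Longrightarrow> y \<in> X \<Longrightarrow> x \<in> Y \<Longrightarrow> y \<in> Y \<Longrightarrow>
      \<phi> (mono r x \<otimes>\<^bsub>BA\<^esub> mono s y) = \<phi> (mono r x) \<otimes>\<^bsub>B\<^esub> \<phi> (mono s y)"
    and f: "f \<in> basis_span R X Y" and g: "g \<in> basis_span R X Y"
  shows "\<phi> (f \<otimes>\<^bsub>BA\<^esub> g) = \<phi> f \<otimes>\<^bsub>B\<^esub> \<phi> g"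
proof -
  note [simp del] = BA_simps
  interpret B: ring B by fact
  interpret BA: ring BA by (rule ring_BA)
  have sub: "f \<in> carrier BA" if "f \<in> basis_span R X Y" for f using that basis_span_subset by blast
  have zero_span: "\<zero>\<^bsub>BA\<^esub> \<in> basis_span R X Y" by (auto simp: basis_span_def BA_simps)
  have mult_span: "f \<otimes>\<^bsub>BA\<^esub> g \<in> basis_span R X Y" if "f \<in> basis_span R X Y" "g \<in> basis_span R X Y" for f g
    by (rule basis_span_mult[OF that Y])
  have z: "\<phi> \<zero>\<^bsub>BA\<^esub> = \<zero>\<^bsub>B\<^esub>"
    using add[OF zero_span zero_span] closed[OF zero_span] B.add.l_cancel_one' by simp
  have 1: "\<phi> (mono r x \<otimes>\<^bsub>BA\<^esub> g) = \<phi> (mono r x) \<otimes>\<^bsub>B\<^esub> \<phi> g"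
    if g: "g \<in> basis_span R X Y" and r: "r \<in> carrier R" "x \<in> X" "x \<in> Y" for r x g
    using g
  proof (induction rule: basis_span_induct)
    case (add f g)
    have m: "mono r x \<in> basis_span R X Y" by (rule mono_in_basis_span[OF r(1,3)])
    then show ?case
      using add mult_span[OF m] closed assms(4) by (simp add: sub BA.r_distr B.r_distr)
  qed (use z r sub mono_in_basis_span[OF r(1,3)] closed mult in simp_all)
  show ?thesis
    using f
  proof (induction rule: basis_span_induct)
    case (add f f')
    then show ?case
      using mult_span[OF _ g] closed assms(4) g by (simp add: sub BA.l_distr B.l_distr)
  qed (use z sub g closed 1 in simp_all)
qed

end

section \<open>Subgroups of direct products\<close>

text \<open>
  In a finite group the inverse of an element is one of its powers.  The set of automorphisms realized in a category
  is a priori only closed under composition.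
\<close>

lemma (in group) closed_subset_is_subgroup:
  assumes "finite (carrier G)" "S \<subseteq> carrier G" "S \<noteq> {}"
    and closed: "\<And>x y. x \<in> S \<Longrightarrow> y \<in> S \<Longrightarrow> x \<otimes> y \<in> S"
  shows "subgroup S G"
proof (rule subgroupI)
  show "inv x \<in> S" if x: "x \<in> S" for x
  proof -
    have pow: "x [^] Suc n \<in> S" for n
      by (induction n) (use closed x assms(2) in auto)
    have xc: "x \<in> carrier G" using x assms(2) by blast
    \<comment> \<open>The exponent \<open>2 |G| - 1\<close> is positive even in the trivial group.\<close>
    obtain m where m: "order G = Suc m"
      using assms(1) order_gt_0_iff_finite gr0_implies_Suc by metis
    have "x [^] order G = \<one>" by (rule pow_order_eq_1[OF xc])
    moreover have "x [^] Suc (m + m) \<otimes> x = x [^] (order G + order G)"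
      using m by simp
    ultimately have "x [^] Suc (m + m) \<otimes> x = \<one>" using xc by (simp add: nat_pow_mult[symmetric])
    then have "inv x = x [^] Suc (m + m)" using xc by (intro inv_equality) auto
    then show ?thesis using pow by simp
  qed
qed (use assms in auto)

text \<open>
  Every statement about the first factor yields one about the second factor by passing to the converse relation.
\<close>

abbreviation p2 :: "('g \<times> 'h) set \<Rightarrow> 'h set" where
  "p2 L \<equiv> p1 (L\<inverse>)"

lemma p1_iff: "g \<in> p1 L \<longleftrightarrow> (\<exists>h. (g, h) \<in> L)"
  by (force simp: p1_def)

lemma p2_iff: "h \<in> p2 L \<longleftrightarrow> (\<exists>g. (g, h) \<in> L)"
  by (force simp: p1_def)

lemma k1_iff: "g \<in> k1 H L \<longleftrightarrow> (g, \<one>\<^bsub>H\<^esub>) \<in> L"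
  by (simp add: k1_def)

lemma k2_iff: "h \<in> k2 G L \<longleftrightarrow> (\<one>\<^bsub>G\<^esub>, h) \<in> L"
  by (simp add: k2_def)

lemma k1_converse: "k1 G (L\<inverse>) = k2 G L"
  by (auto simp: k1_def k2_def)

lemma is_sectionD:
  assumes "is_section G P K"
  shows "subgroup P G" "K \<lhd> G\<lparr>carrier := P\<rparr>" "K \<subseteq> P"
proof -
  show "subgroup P G" and n: "K \<lhd> G\<lparr>carrier := P\<rparr>" using assms by (auto simp: is_section_def)
  show "K \<subseteq> P" using subgroup.subset[OF normal_imp_subgroup[OF n]] by simp
qed

lemma sec_quot_carrier: "carrier (sec_quot G P K) = (\<lambda>g. K #>\<^bsub>G\<^esub> g) ` P"
  by (auto simp: sec_quot_def FactGroup_def RCOSETS_def)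

lemma sec_quot_one: "\<one>\<^bsub>sec_quot G P K\<^esub> = K"
  by (simp add: sec_quot_def)

lemma sec_quot_mult:
  assumes "is_section G P K" "x \<in> P" "y \<in> P"
  shows "(K #>\<^bsub>G\<^esub> x) \<otimes>\<^bsub>sec_quot G P K\<^esub> (K #>\<^bsub>G\<^esub> y) = K #>\<^bsub>G\<^esub> (x \<otimes>\<^bsub>G\<^esub> y)"
  using normal.rcos_sum[OF is_sectionD(2)[OF assms(1)], of x y] assms(2,3)
  by (simp add: sec_quot_def)

lemma group_sec_quot: "is_section G P K \<Longrightarrow> group (sec_quot G P K)"
  unfolding sec_quot_def using normal.factorgroup_is_group[OF is_sectionD(2)] by blast

text \<open>
  Sections and quotients are defined for groups whose record has no further fields.
\<close>

locale plain_group = group G for G :: "'g monoid" (structure)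
begin

lemma section_subgroup: "is_section G P K \<Longrightarrow> subgroup K G"
  using incl_subgroup[OF is_sectionD(1)] normal_imp_subgroup[OF is_sectionD(2)] by blast

lemma section_coset_eq_iff:
  assumes "is_section G P K" "x \<in> P" "y \<in> P"
  shows "K #> x = K #> y \<longleftrightarrow> x \<otimes> inv y \<in> K"
proof -
  have K: "subgroup K G" by (rule section_subgroup[OF assms(1)])
  have xy: "x \<in> carrier G" "y \<in> carrier G"
    using assms subgroup.subset[OF is_sectionD(1)[OF assms(1)]] by auto
  have "K #> x = K #> y \<longleftrightarrow> x \<in> K #> y"
    using repr_independence[OF _ xy(2) K, of x] rcos_self[OF xy(1) K] by auto
  then show ?thesis using subgroup.rcos_module[OF K is_group xy(2,1)] by simp
qed

lemma section_card:
  assumes "is_section G P K" "finite (carrier G)"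
  shows "card (carrier (sec_quot G P K)) * card K = card P"
proof -
  have P: "subgroup P G" by (rule is_sectionD(1)[OF assms(1)])
  interpret P: group "G\<lparr>carrier := P\<rparr>" by (rule subgroup_imp_group[OF P])
  have "finite P" using finite_subset[OF subgroup.subset[OF P] assms(2)] .
  then show ?thesis
    using P.lagrange_finite[OF _ normal_imp_subgroup[OF is_sectionD(2)[OF assms(1)]]]
    by (simp add: sec_quot_def FactGroup_def order_def)
qed

end

locale prod_subgroup = G: plain_group G + H: plain_group H + L: subgroup L "G \<times>\<times> H"
  for G :: "'g monoid" and H :: "'h monoid" and L +
  assumes finite_G: "finite (carrier G)" and finite_H: "finite (carrier H)"
begin

lemma mem_carrier: "(g, h) \<in> L \<Longrightarrow> g \<in> carrier G \<and> h \<in> carrier H"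
  using L.subset by auto

lemma one_mem: "(\<one>\<^bsub>G\<^esub>, \<one>\<^bsub>H\<^esub>) \<in> L"
  using L.one_closed by simp

lemma mult_mem: "(g, h) \<in> L \<Longrightarrow> (g', h') \<in> L \<Longrightarrow> (g \<otimes>\<^bsub>G\<^esub> g', h \<otimes>\<^bsub>H\<^esub> h') \<in> L"
  using L.m_closed by fastforce

lemma inv_mem: "(g, h) \<in> L \<Longrightarrow> (inv\<^bsub>G\<^esub> g, inv\<^bsub>H\<^esub> h) \<in> L"
  using L.m_inv_closed[of "(g, h)"] mem_carrier[of g h]
  by (simp add: inv_DirProd G.is_group H.is_group)

lemma finite_L: "finite L"
  by (rule finite_subset[of _ "carrier G \<times> carrier H"]) (use mem_carrier finite_G finite_H in auto)

lemma converse: "prod_subgroup H G (L\<inverse>)"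
proof (intro prod_subgroup.intro prod_subgroup_axioms.intro plain_group.intro H.is_group G.is_group finite_G finite_H)
  interpret HG: group "H \<times>\<times> G" by (rule DirProd_group[OF H.is_group G.is_group])
  show "subgroup (L\<inverse>) (H \<times>\<times> G)"
  proof (rule HG.subgroupI)
    show "L\<inverse> \<noteq> {}" using one_mem by auto
    show "inv\<^bsub>H \<times>\<times> G\<^esub> a \<in> L\<inverse>" if "a \<in> L\<inverse>" for a
      using that inv_mem mem_carrier by (auto simp: inv_DirProd G.is_group H.is_group)
  qed (use mem_carrier mult_mem in auto)
qed

lemma p1_subgroup: "subgroup (p1 L) G"
proof (rule G.subgroupI)
  show "p1 L \<noteq> {}" using one_mem by (auto simp: p1_def)
qed (use mem_carrier mult_mem inv_mem in \<open>auto simp: p1_iff, blast+\<close>)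

lemma k1_subset: "k1 H L \<subseteq> p1 L"
  by (auto simp: p1_iff k1_iff)

lemma section_p1_k1: "is_section G (p1 L) (k1 H L)"
proof -
  interpret P: group "G\<lparr>carrier := p1 L\<rparr>" by (rule G.subgroup_imp_group[OF p1_subgroup])
  have "k1 H L \<lhd> G\<lparr>carrier := p1 L\<rparr>"
    unfolding P.normal_inv_iff
  proof (intro conjI ballI)
    have inv: "inv\<^bsub>G\<lparr>carrier := p1 L\<rparr>\<^esub> x = inv\<^bsub>G\<^esub> x" if "x \<in> p1 L" for x
      using that G.m_inv_consistent[OF p1_subgroup] by simp
    show "subgroup (k1 H L) (G\<lparr>carrier := p1 L\<rparr>)"
    proof (rule P.subgroupI)
      show "k1 H L \<noteq> {}" using one_mem by (auto simp: k1_iff)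
      show "inv\<^bsub>G\<lparr>carrier := p1 L\<rparr>\<^esub> a \<in> k1 H L" if "a \<in> k1 H L" for a
        using that inv[of a] k1_subset inv_mem[of a "\<one>\<^bsub>H\<^esub>"] by (auto simp: k1_iff)
      show "a \<otimes>\<^bsub>G\<lparr>carrier := p1 L\<rparr>\<^esub> b \<in> k1 H L" if "a \<in> k1 H L" "b \<in> k1 H L" for a b
        using that mult_mem[of a "\<one>\<^bsub>H\<^esub>" b "\<one>\<^bsub>H\<^esub>"] by (simp add: k1_iff)
    qed (use k1_subset in simp)
    show "x \<otimes>\<^bsub>G\<lparr>carrier := p1 L\<rparr>\<^esub> h \<otimes>\<^bsub>G\<lparr>carrier := p1 L\<rparr>\<^esub> inv\<^bsub>G\<lparr>carrier := p1 L\<rparr>\<^esub> x \<in> k1 H L"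
      if x: "x \<in> carrier (G\<lparr>carrier := p1 L\<rparr>)" "h \<in> k1 H L" for x h
    proof -
      obtain y where y: "(x, y) \<in> L" using x(1) by (auto simp: p1_iff)
      have "(x \<otimes>\<^bsub>G\<^esub> h \<otimes>\<^bsub>G\<^esub> inv\<^bsub>G\<^esub> x, y \<otimes>\<^bsub>H\<^esub> \<one>\<^bsub>H\<^esub> \<otimes>\<^bsub>H\<^esub> inv\<^bsub>H\<^esub> y) \<in> L"
        using that(2) y by (intro mult_mem inv_mem) (auto simp: k1_iff)
      then show ?thesis using that(1) inv[of x] mem_carrier[OF y] by (simp add: k1_iff)
    qed
  qed
  then show ?thesis using p1_subgroup by (simp add: is_section_def)
qed

lemma section_p2_k2: "is_section H (p2 L) (k2 G L)"
  using prod_subgroup.section_p1_k1[OF converse] by (simp add: k1_converse)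

text \<open>The fibres of the first projection are the cosets of \<open>k\<^sub>2(L)\<close>.\<close>

lemma card_eq_p1_k2: "card L = card (p1 L) * card (k2 G L)"
proof -
  have L: "L = Sigma (p1 L) (\<lambda>g. {h. (g, h) \<in> L})" by (auto simp: p1_iff)
  have fin: "finite (p1 L)" using finite_L by (simp add: p1_def)
  have "card {h. (g, h) \<in> L} = card (k2 G L)" if g: "g \<in> p1 L" for g
  proof -
    obtain h0 where h0: "(g, h0) \<in> L" using g by (auto simp: p1_iff)
    then have c: "g \<in> carrier G" "h0 \<in> carrier H" using mem_carrier by auto
    have "bij_betw (\<lambda>h. h \<otimes>\<^bsub>H\<^esub> h0) (k2 G L) {h. (g, h) \<in> L}"
      unfolding bij_betw_def
    proof (intro conjI inj_onI subset_antisym subsetI)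
      fix x y assume "x \<in> k2 G L" "y \<in> k2 G L" "x \<otimes>\<^bsub>H\<^esub> h0 = y \<otimes>\<^bsub>H\<^esub> h0"
      then show "x = y" using c mem_carrier by (auto simp: k2_iff)
    next
      fix x assume "x \<in> (\<lambda>h. h \<otimes>\<^bsub>H\<^esub> h0) ` k2 G L"
      then show "x \<in> {h. (g, h) \<in> L}" using mult_mem[OF _ h0] c by (fastforce simp: k2_iff)
    next
      fix x assume "x \<in> {h. (g, h) \<in> L}"
      then have x: "(g, x) \<in> L" by simp
      then have "x \<otimes>\<^bsub>H\<^esub> inv\<^bsub>H\<^esub> h0 \<in> k2 G L"
        using mult_mem[OF x inv_mem[OF h0]] c by (simp add: k2_iff)
      moreover have "x = x \<otimes>\<^bsub>H\<^esub> inv\<^bsub>H\<^esub> h0 \<otimes>\<^bsub>H\<^esub> h0"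
        using mem_carrier[OF x] c by (simp add: H.m_assoc)
      ultimately show "x \<in> (\<lambda>h. h \<otimes>\<^bsub>H\<^esub> h0) ` k2 G L" by (rule rev_image_eqI)
    qed
    then show ?thesis using bij_betw_same_card by metis
  qed
  then show ?thesis
    by (subst L, subst card_SigmaI) (use fin finite_L in \<open>auto intro: finite_subset[of _ "snd ` L"] simp: rev_image_eqI\<close>)
qed

lemma card_eq_p2_k1: "card L = card (p2 L) * card (k1 H L)"
proof -
  have "k2 H (L\<inverse>) = k1 H L" by (auto simp: k1_def k2_def)
  then show ?thesis using prod_subgroup.card_eq_p1_k2[OF converse] by simp
qed

end

text \<open>The order of \<open>q(L)\<close> (\<open>rank_eq\<close>); as a quotient of cardinalities it is easily compared between relations.\<close>

definition rank :: "'h monoid \<Rightarrow> ('g \<times> 'h) set \<Rightarrow> nat" where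
  "rank H L = card (p1 L) div card (k1 H L)"

context prod_subgroup
begin

lemma finite_p1: "finite (p1 L)"
  using finite_L by (simp add: p1_def)

lemma k1_card_pos: "card (k1 H L) > 0"
proof -
  have "finite (k1 H L)" using finite_subset[OF k1_subset finite_p1] .
  moreover have "\<one>\<^bsub>G\<^esub> \<in> k1 H L" using one_mem by (simp add: k1_iff)
  ultimately show ?thesis using card_gt_0_iff by blast
qed

lemma rank_eq: "rank H L = card (carrier (sec_quot G (p1 L) (k1 H L)))"
  using G.section_card[OF section_p1_k1 finite_G, symmetric] k1_card_pos by (simp add: rank_def)

lemma rank_mult: "card (p1 L) = rank H L * card (k1 H L)"
  using G.section_card[OF section_p1_k1 finite_G] by (simp add: rank_eq)

lemma rank_pos: "rank H L > 0"
proof -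
  have "card (p1 L) > 0" using finite_p1 one_mem by (auto simp: card_gt_0_iff p1_def)
  then show ?thesis using rank_mult by (metis mult_is_0 neq0_conv)
qed

text \<open>
  Both sides multiplied by \<open>|k\<^sub>1(L)| |k\<^sub>2(L)|\<close> are \<open>|L|\<close>.
\<close>

lemma rank_converse: "rank G (L\<inverse>) = rank H L"
proof -
  interpret L': prod_subgroup H G "L\<inverse>" by (rule converse)
  have "rank H L * card (k1 H L) * card (k1 G (L\<inverse>)) = rank G (L\<inverse>) * card (k1 G (L\<inverse>)) * card (k1 H L)"
    unfolding rank_mult[symmetric] L'.rank_mult[symmetric, unfolded k1_converse] k1_converse
    using card_eq_p1_k2 card_eq_p2_k1 by (rule trans[OF sym])
  then have "rank H L * (card (k1 H L) * card (k1 G (L\<inverse>))) =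
    rank G (L\<inverse>) * (card (k1 H L) * card (k1 G (L\<inverse>)))" by (simp add: mult_ac)
  then show ?thesis using k1_card_pos L'.k1_card_pos by (metis mult_right_cancel nat_0_less_mult_iff less_numeral_extra(3))
qed

text \<open>
  Since \<open>|p\<^sub>1(L)| = |q(L)| |k\<^sub>1(L)|\<close> and \<open>|P| = |q(L)| |K|\<close>, neither of the two inclusions can be proper.
\<close>

lemma rank_maximal:
  assumes sec: "is_section G P K" and "p1 L \<subseteq> P" "K \<subseteq> k1 H L" and r: "rank H L = card (carrier (sec_quot G P K))"
  shows "p1 L = P" "k1 H L = K"
proof -
  have "finite P" using finite_subset[OF subgroup.subset[OF is_sectionD(1)[OF sec]] finite_G] .
  then have le: "card (p1 L) \<le> card P" using assms(2) card_mono by blast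
  then have "rank H L * card (k1 H L) \<le> rank H L * card K"
    using rank_mult G.section_card[OF sec finite_G] r by simp
  then have "card (k1 H L) \<le> card K" using rank_pos by simp
  moreover have "finite (k1 H L)" using k1_card_pos card_ge_0_finite by blast
  ultimately show k1: "k1 H L = K" using assms(3) card_seteq by metis
  show "p1 L = P"
    using card_subset_eq[OF \<open>finite P\<close> assms(2)] rank_mult G.section_card[OF sec finite_G] r k1 by simp
qed

end

text \<open>
  Composition with \<open>M\<close> can only make \<open>p\<^sub>1\<close> smaller and \<open>k\<^sub>1\<close> larger.
\<close>

lemma rank_comp_left:
  assumes L: "prod_subgroup G H L" and M: "prod_subgroup H K M" and LM: "prod_subgroup G K (L O M)"
  shows "rank K (L O M) \<le> rank H L"
proof -
  have "(\<one>\<^bsub>H\<^esub>, \<one>\<^bsub>K\<^esub>) \<in> M" by (rule prod_subgroup.one_mem[OF M])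
  then have "k1 H L \<subseteq> k1 K (L O M)" by (auto simp: k1_iff)
  moreover have "finite (k1 K (L O M))" using prod_subgroup.k1_card_pos[OF LM] card_ge_0_finite by blast
  ultimately have 1: "card (k1 H L) \<le> card (k1 K (L O M))" by (simp add: card_mono)
  have "p1 (L O M) \<subseteq> p1 L" by (auto simp: p1_iff)
  then have 2: "card (p1 (L O M)) \<le> card (p1 L)" using prod_subgroup.finite_p1[OF L] by (simp add: card_mono)
  have "card (p1 (L O M)) div card (k1 K (L O M)) \<le> card (p1 (L O M)) div card (k1 H L)"
    by (rule div_le_mono2[OF prod_subgroup.k1_card_pos[OF L] 1])
  also have "\<dots> \<le> card (p1 L) div card (k1 H L)" by (rule div_le_mono[OF 2])
  finally show ?thesis by (simp add: rank_def)
qed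

lemma rank_comp_right:
  assumes L: "prod_subgroup G H L" and M: "prod_subgroup H K M" and LM: "prod_subgroup G K (L O M)"
  shows "rank K (L O M) \<le> rank K M"
proof -
  have "rank G ((L O M)\<inverse>) \<le> rank H (M\<inverse>)"
    using rank_comp_left[OF prod_subgroup.converse[OF M] prod_subgroup.converse[OF L]]
      prod_subgroup.converse[OF LM] by (simp add: converse_relcomp)
  then show ?thesis using prod_subgroup.rank_converse[OF LM] prod_subgroup.rank_converse[OF M] by simp
qed

text \<open>
  The cocycle identity counts the group of all \<open>(h, k) \<in> M\<close> with \<open>(1, h) \<in> L\<close> and \<open>(k, 1) \<in> N\<close> along its two
  projections.
\<close>

lemma card_cocycle:
  assumes L: "prod_subgroup G H L" and M: "prod_subgroup H K M" and N: "prod_subgroup K I N"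
  shows "card (k2 G L \<inter> k1 K M) * card (k2 G (L O M) \<inter> k1 I N) =
    card (k2 G L \<inter> k1 I (M O N)) * card (k2 H M \<inter> k1 I N)"
proof -
  interpret L: prod_subgroup G H L by fact
  interpret M: prod_subgroup H K M by fact
  interpret N: prod_subgroup K I N by fact
  define W where "W = {(h, k) \<in> M. (\<one>\<^bsub>G\<^esub>, h) \<in> L \<and> (k, \<one>\<^bsub>I\<^esub>) \<in> N}"
  interpret HK: group "H \<times>\<times> K" by (rule DirProd_group[OF L.H.is_group M.H.is_group])
  have "subgroup W (H \<times>\<times> K)"
  proof (rule HK.subgroupI)
    show "W \<noteq> {}" using L.one_mem M.one_mem N.one_mem by (auto simp: W_def)
    show "inv\<^bsub>H \<times>\<times> K\<^esub> a \<in> W" if a: "a \<in> W" for a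
      using a M.inv_mem L.inv_mem[of "\<one>\<^bsub>G\<^esub>"] N.inv_mem[of _ "\<one>\<^bsub>I\<^esub>"] M.mem_carrier
      by (auto simp: W_def inv_DirProd L.H.is_group M.H.is_group)
    show "a \<otimes>\<^bsub>H \<times>\<times> K\<^esub> b \<in> W" if "a \<in> W" "b \<in> W" for a b
      using that M.mult_mem L.mult_mem[of "\<one>\<^bsub>G\<^esub>" _ "\<one>\<^bsub>G\<^esub>"] N.mult_mem[of _ "\<one>\<^bsub>I\<^esub>" _ "\<one>\<^bsub>I\<^esub>"]
      by (auto simp: W_def)
  qed (use M.mem_carrier in \<open>auto simp: W_def\<close>)
  then interpret W: prod_subgroup H K W
    by (intro prod_subgroup.intro prod_subgroup_axioms.intro plain_group.intro L.H.is_group M.H.is_group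
        M.finite_G M.finite_H)
  have "p1 W = k2 G L \<inter> k1 I (M O N)" "k2 H W = k2 H M \<inter> k1 I N"
    "p2 W = k2 G (L O M) \<inter> k1 I N" "k1 K W = k2 G L \<inter> k1 K M"
    using L.one_mem N.one_mem by (auto simp: W_def k1_iff k2_iff p1_iff p2_iff)
  then show ?thesis using W.card_eq_p1_k2 W.card_eq_p2_k1 by (simp add: mult.commute)
qed

section \<open>The idempotents of sections\<close>

lemma e_sec_iff: "(g, h) \<in> e_sec G P K \<longleftrightarrow> g \<in> P \<and> h \<in> P \<and> K #>\<^bsub>G\<^esub> h = K #>\<^bsub>G\<^esub> g"
  by (simp add: e_sec_def goursat_def)

lemma e_sec_converse: "(e_sec G P K)\<inverse> = e_sec G P K"
  by (auto simp: e_sec_iff)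

lemma (in plain_group) e_sec_p1: "p1 (e_sec G P K) = P"
  by (auto simp: p1_iff e_sec_iff)

lemma (in plain_group) e_sec_k1:
  assumes "is_section G P K"
  shows "k1 G (e_sec G P K) = K"
proof -
  have P: "\<one> \<in> P" "P \<subseteq> carrier G"
    using subgroup.one_closed[OF is_sectionD(1)[OF assms]] subgroup.subset[OF is_sectionD(1)[OF assms]] by auto
  have "K #> \<one> = K #> g \<longleftrightarrow> g \<in> K" if "g \<in> P" for g
    using section_coset_eq_iff[OF assms that P(1)] section_coset_eq_iff[OF assms P(1) that] that P
    by (auto simp: eq_commute)
  then have "g \<in> k1 G (e_sec G P K) \<longleftrightarrow> g \<in> K" for g
    using P is_sectionD(3)[OF assms] by (simp only: k1_iff e_sec_iff) blast
  then show ?thesis by blast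
qed

context prod_subgroup
begin

lemma e_sec_comp:
  assumes sec: "is_section G P K" and P: "p1 L \<subseteq> P" and K: "K \<subseteq> k1 H L"
  shows "e_sec G P K O L = L"
proof (intro subset_antisym subrelI)
  fix g h assume "(g, h) \<in> e_sec G P K O L"
  then obtain g' where g': "(g, g') \<in> e_sec G P K" "(g', h) \<in> L" by blast
  then have P: "g \<in> P" "g' \<in> P" "K #>\<^bsub>G\<^esub> g = K #>\<^bsub>G\<^esub> g'" by (auto simp: e_sec_iff)
  then have "(g \<otimes>\<^bsub>G\<^esub> inv\<^bsub>G\<^esub> g', \<one>\<^bsub>H\<^esub>) \<in> L"
    using G.section_coset_eq_iff[OF sec] K by (auto simp: k1_iff)
  then have "(g \<otimes>\<^bsub>G\<^esub> inv\<^bsub>G\<^esub> g' \<otimes>\<^bsub>G\<^esub> g', \<one>\<^bsub>H\<^esub> \<otimes>\<^bsub>H\<^esub> h) \<in> L" using g'(2) by (rule mult_mem)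
  moreover have "g \<in> carrier G" using P(1) subgroup.subset[OF is_sectionD(1)[OF sec]] by blast
  ultimately show "(g, h) \<in> L" using mem_carrier[OF g'(2)] by (simp add: G.m_assoc)
next
  fix g h assume gh: "(g, h) \<in> L"
  then have "g \<in> P" using P by (auto simp: p1_def)
  then have "(g, g) \<in> e_sec G P K" by (simp add: e_sec_iff)
  then show "(g, h) \<in> e_sec G P K O L" using gh by blast
qed

lemma e_sec_comp_self: "e_sec G (p1 L) (k1 H L) O L = L"
  by (rule e_sec_comp[OF section_p1_k1]) auto

lemma e_sec_fixedD:
  assumes sec: "is_section G P K" and eq: "e_sec G P K O L = L"
  shows "p1 L \<subseteq> P" "K \<subseteq> k1 H L"
proof -
  show "p1 L \<subseteq> P" using eq by (force simp: p1_iff e_sec_iff)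
  show "K \<subseteq> k1 H L"
  proof
    fix k assume "k \<in> K"
    then have "(k, \<one>\<^bsub>G\<^esub>) \<in> e_sec G P K" using G.e_sec_k1[OF sec] by (auto simp: k1_iff)
    then have "(k, \<one>\<^bsub>H\<^esub>) \<in> e_sec G P K O L" using one_mem by blast
    then show "k \<in> k1 H L" using eq by (simp add: k1_iff)
  qed
qed

lemma comp_e_sec_iff: "L O e_sec H P K = L \<longleftrightarrow> e_sec H P K O L\<inverse> = L\<inverse>"
  using converse_relcomp[of L "e_sec H P K"] e_sec_converse[of H P K] by (metis converse_converse)

end

section \<open>Isomorphisms between sections\<close>

lemma goursat_iff:
  "(g, h) \<in> goursat G H P K \<alpha> P' K' \<longleftrightarrow> g \<in> P \<and> h \<in> P' \<and> \<alpha> (K' #>\<^bsub>H\<^esub> h) = K #>\<^bsub>G\<^esub> g"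
  by (simp add: goursat_def)

lemma goursat_cong:
  assumes "\<And>U. U \<in> carrier (sec_quot H P' K') \<Longrightarrow> \<alpha> U = \<beta> U"
  shows "goursat G H P K \<alpha> P' K' = goursat G H P K \<beta> P' K'"
  using assms by (auto simp: goursat_def sec_quot_carrier)

lemma goursat_inj:
  assumes \<alpha>: "\<alpha> \<in> carrier (sec_quot H P' K') \<rightarrow> carrier (sec_quot G P K)"
    and eq: "goursat G H P K \<alpha> P' K' = goursat G H P K \<beta> P' K'" and U: "U \<in> carrier (sec_quot H P' K')"
  shows "\<alpha> U = \<beta> U"
proof -
  obtain h where h: "h \<in> P'" "U = K' #>\<^bsub>H\<^esub> h" using U by (auto simp: sec_quot_carrier)
  have "\<alpha> U \<in> carrier (sec_quot G P K)" using \<alpha> U by auto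
  then obtain g where "g \<in> P" "\<alpha> U = K #>\<^bsub>G\<^esub> g" by (auto simp: sec_quot_carrier)
  then have "(g, h) \<in> goursat G H P K \<alpha> P' K'" using h by (simp add: goursat_iff)
  then have "(g, h) \<in> goursat G H P K \<beta> P' K'" using eq by simp
  then show ?thesis using h \<open>\<alpha> U = _\<close> by (simp add: goursat_iff)
qed

lemma goursat_comp:
  assumes \<beta>: "\<beta> \<in> carrier (sec_quot I P'' K'') \<rightarrow> carrier (sec_quot H P' K')"
  shows "goursat G H P K \<alpha> P' K' O goursat H I P' K' \<beta> P'' K'' =
    goursat G I P K (\<lambda>U. \<alpha> (\<beta> U)) P'' K''"
proof (intro subset_antisym subrelI)
  fix g i assume "(g, i) \<in> goursat G I P K (\<lambda>U. \<alpha> (\<beta> U)) P'' K''"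
  then have gi: "g \<in> P" "i \<in> P''" "\<alpha> (\<beta> (K'' #>\<^bsub>I\<^esub> i)) = K #>\<^bsub>G\<^esub> g" by (auto simp: goursat_iff)
  then have "\<beta> (K'' #>\<^bsub>I\<^esub> i) \<in> carrier (sec_quot H P' K')" using \<beta> by (auto simp: sec_quot_carrier)
  then obtain h where "h \<in> P'" "\<beta> (K'' #>\<^bsub>I\<^esub> i) = K' #>\<^bsub>H\<^esub> h" by (auto simp: sec_quot_carrier)
  then show "(g, i) \<in> goursat G H P K \<alpha> P' K' O goursat H I P' K' \<beta> P'' K''"
    using gi by (intro relcompI[of g h]) (auto simp: goursat_iff)
qed (auto simp: goursat_iff)

lemma goursat_sections:
  assumes G: "group G" and H: "group H" and sec: "is_section G P K" and sec': "is_section H P' K'"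
    and \<alpha>: "\<alpha> \<in> iso (sec_quot H P' K') (sec_quot G P K)"
  shows "p1 (goursat G H P K \<alpha> P' K') = P" "k1 H (goursat G H P K \<alpha> P' K') = K"
    "p2 (goursat G H P K \<alpha> P' K') = P'" "k2 G (goursat G H P K \<alpha> P' K') = K'"
proof -
  interpret G: plain_group G by (rule plain_group.intro[OF G])
  interpret H: plain_group H by (rule plain_group.intro[OF H])
  have bij: "\<alpha> ` carrier (sec_quot H P' K') = carrier (sec_quot G P K)"
    "inj_on \<alpha> (carrier (sec_quot H P' K'))" using \<alpha> by (auto simp: iso_def bij_betw_def)
  have one: "\<alpha> K' = K"
    using hom_one[of \<alpha> "sec_quot H P' K'" "sec_quot G P K"] \<alpha> group_sec_quot[OF sec] group_sec_quot[OF sec']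
    by (simp add: iso_def sec_quot_one)
  have P: "\<one>\<^bsub>G\<^esub> \<in> P" "P \<subseteq> carrier G" "\<one>\<^bsub>H\<^esub> \<in> P'" "P' \<subseteq> carrier H"
    using subgroup.one_closed[OF is_sectionD(1)[OF sec]] subgroup.subset[OF is_sectionD(1)[OF sec]]
      subgroup.one_closed[OF is_sectionD(1)[OF sec']] subgroup.subset[OF is_sectionD(1)[OF sec']] by auto
  have K1: "K #>\<^bsub>G\<^esub> g = K \<longleftrightarrow> g \<in> K" if "g \<in> P" for g
    using G.section_coset_eq_iff[OF sec that P(1)] that P
      G.coset_mult_one[OF subgroup.subset[OF G.section_subgroup[OF sec]]] by auto
  have K1': "K' #>\<^bsub>H\<^esub> g = K' \<longleftrightarrow> g \<in> K'" if "g \<in> P'" for g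
    using H.section_coset_eq_iff[OF sec' that P(3)] that P
      H.coset_mult_one[OF subgroup.subset[OF H.section_subgroup[OF sec']]] by auto
  have Kc: "K #>\<^bsub>G\<^esub> \<one>\<^bsub>G\<^esub> = K" "K' #>\<^bsub>H\<^esub> \<one>\<^bsub>H\<^esub> = K'"
    using K1[OF P(1)] K1'[OF P(3)] subgroup.one_closed[OF G.section_subgroup[OF sec]]
      subgroup.one_closed[OF H.section_subgroup[OF sec']] by auto
  show "k1 H (goursat G H P K \<alpha> P' K') = K"
  proof (rule Set.set_eqI)
    show "g \<in> k1 H (goursat G H P K \<alpha> P' K') \<longleftrightarrow> g \<in> K" for g
      unfolding k1_iff goursat_iff Kc(2) one using P(3) K1[of g] is_sectionD(3)[OF sec] by blast
  qed
  have "\<alpha> (K' #>\<^bsub>H\<^esub> h) = K \<longleftrightarrow> K' #>\<^bsub>H\<^esub> h = K'" if "h \<in> P'" for h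
  proof -
    have "K' #>\<^bsub>H\<^esub> h \<in> carrier (sec_quot H P' K')" "K' \<in> carrier (sec_quot H P' K')"
      using that P(3) Kc(2) by (auto simp: sec_quot_carrier image_iff)
    then show ?thesis using bij(2) one by (metis inj_on_eq_iff)
  qed
  then have k2: "\<alpha> (K' #>\<^bsub>H\<^esub> h) = K \<longleftrightarrow> h \<in> K'" if "h \<in> P'" for h
    using K1'[OF that] that by blast
  show "k2 G (goursat G H P K \<alpha> P' K') = K'"
  proof (rule Set.set_eqI)
    show "h \<in> k2 G (goursat G H P K \<alpha> P' K') \<longleftrightarrow> h \<in> K'" for h
      unfolding k2_iff goursat_iff Kc(1) using P(1) k2[of h] is_sectionD(3)[OF sec'] by blast
  qed
  show "p1 (goursat G H P K \<alpha> P' K') = P"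
  proof (intro subset_antisym subsetI)
    fix g assume "g \<in> P"
    then have "K #>\<^bsub>G\<^esub> g \<in> \<alpha> ` carrier (sec_quot H P' K')" unfolding bij(1) by (auto simp: sec_quot_carrier)
    then obtain h where "h \<in> P'" "\<alpha> (K' #>\<^bsub>H\<^esub> h) = K #>\<^bsub>G\<^esub> g" by (auto simp: sec_quot_carrier)
    then show "g \<in> p1 (goursat G H P K \<alpha> P' K')" using \<open>g \<in> P\<close> by (auto simp: p1_iff goursat_iff)
  qed (auto simp: p1_iff goursat_iff)
  show "p2 (goursat G H P K \<alpha> P' K') = P'"
  proof (intro subset_antisym subsetI)
    fix h assume "h \<in> P'"
    then have "\<alpha> (K' #>\<^bsub>H\<^esub> h) \<in> carrier (sec_quot G P K)" unfolding bij(1)[symmetric] by (auto simp: sec_quot_carrier)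
    then obtain g where "g \<in> P" "\<alpha> (K' #>\<^bsub>H\<^esub> h) = K #>\<^bsub>G\<^esub> g" by (auto simp: sec_quot_carrier)
    then show "h \<in> p2 (goursat G H P K \<alpha> P' K')" using \<open>h \<in> P'\<close> by (auto simp: p2_iff goursat_iff)
  qed (auto simp: p2_iff goursat_iff)
qed

text \<open>Goursat's lemma: the isomorphism sends \<open>k\<^sub>2(L) h\<close> to \<open>k\<^sub>1(L) g\<close> for \<open>(g, h) \<in> L\<close>.\<close>

lemma (in prod_subgroup) goursat_lemma:
  obtains \<alpha> where "\<alpha> \<in> iso (sec_quot H (p2 L) (k2 G L)) (sec_quot G (p1 L) (k1 H L))"
    "\<alpha> \<in> extensional (carrier (sec_quot H (p2 L) (k2 G L)))"
    "goursat G H (p1 L) (k1 H L) \<alpha> (p2 L) (k2 G L) = L"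
proof -
  let ?K = "k1 H L" and ?K' = "k2 G L"
  have coset1: "?K #>\<^bsub>G\<^esub> g = ?K #>\<^bsub>G\<^esub> g' \<longleftrightarrow> (g \<otimes>\<^bsub>G\<^esub> inv\<^bsub>G\<^esub> g', \<one>\<^bsub>H\<^esub>) \<in> L"
    if "(g, h) \<in> L" "(g', h') \<in> L" for g h g' h'
    using G.section_coset_eq_iff[OF section_p1_k1, of g g'] that by (auto simp: p1_iff k1_iff)
  have coset2: "?K' #>\<^bsub>H\<^esub> h = ?K' #>\<^bsub>H\<^esub> h' \<longleftrightarrow> (\<one>\<^bsub>G\<^esub>, h \<otimes>\<^bsub>H\<^esub> inv\<^bsub>H\<^esub> h') \<in> L"
    if "(g, h) \<in> L" "(g', h') \<in> L" for g h g' h'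
    using H.section_coset_eq_iff[OF section_p2_k2, of h h'] that by (auto simp: p2_iff k2_iff)
  have cosets: "?K #>\<^bsub>G\<^esub> g = ?K #>\<^bsub>G\<^esub> g' \<longleftrightarrow> ?K' #>\<^bsub>H\<^esub> h = ?K' #>\<^bsub>H\<^esub> h'"
    if gh: "(g, h) \<in> L" "(g', h') \<in> L" for g h g' h'
  proof -
    let ?x = "g \<otimes>\<^bsub>G\<^esub> inv\<^bsub>G\<^esub> g'" and ?y = "h \<otimes>\<^bsub>H\<^esub> inv\<^bsub>H\<^esub> h'"
    have xy: "(?x, ?y) \<in> L" using gh by (intro mult_mem inv_mem)
    then have c: "?x \<in> carrier G" "?y \<in> carrier H" using mem_carrier by auto
    have "(?x, \<one>\<^bsub>H\<^esub>) \<in> L \<longleftrightarrow> (\<one>\<^bsub>G\<^esub>, ?y) \<in> L"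
      using mult_mem[OF xy inv_mem, of ?x "\<one>\<^bsub>H\<^esub>"] mult_mem[OF xy inv_mem, of "\<one>\<^bsub>G\<^esub>" ?y] c by auto
    then show ?thesis using coset1[OF gh] coset2[OF gh] by simp
  qed
  let ?C = "carrier (sec_quot H (p2 L) ?K')"
  define \<alpha> where "\<alpha> = (\<lambda>U\<in>?C. ?K #>\<^bsub>G\<^esub> (SOME g. \<exists>h. (g, h) \<in> L \<and> U = ?K' #>\<^bsub>H\<^esub> h))"
  have C: "?C = {?K' #>\<^bsub>H\<^esub> h | g h. (g, h) \<in> L}" unfolding sec_quot_carrier p1_def by force
  have \<alpha>: "\<alpha> (?K' #>\<^bsub>H\<^esub> h) = ?K #>\<^bsub>G\<^esub> g" if gh: "(g, h) \<in> L" for g h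
  proof -
    let ?g = "SOME g'. \<exists>h'. (g', h') \<in> L \<and> ?K' #>\<^bsub>H\<^esub> h = ?K' #>\<^bsub>H\<^esub> h'"
    have "\<exists>h'. (?g, h') \<in> L \<and> ?K' #>\<^bsub>H\<^esub> h = ?K' #>\<^bsub>H\<^esub> h'"
      using someI_ex[of "\<lambda>g'. \<exists>h'. (g', h') \<in> L \<and> ?K' #>\<^bsub>H\<^esub> h = ?K' #>\<^bsub>H\<^esub> h'"] gh by blast
    then obtain h' where "(?g, h') \<in> L" "?K' #>\<^bsub>H\<^esub> h = ?K' #>\<^bsub>H\<^esub> h'" by blast
    then have "?K #>\<^bsub>G\<^esub> ?g = ?K #>\<^bsub>G\<^esub> g" using cosets[of ?g h' g h] gh by simp
    moreover have "?K' #>\<^bsub>H\<^esub> h \<in> ?C" using gh C by blast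
    ultimately show ?thesis by (simp add: \<alpha>_def)
  qed
  have D: "carrier (sec_quot G (p1 L) ?K) = {?K #>\<^bsub>G\<^esub> g | g h. (g, h) \<in> L}"
    unfolding sec_quot_carrier p1_def by force
  show thesis
  proof (rule that[of \<alpha>])
    show "\<alpha> \<in> extensional ?C" by (simp add: \<alpha>_def)
    show "goursat G H (p1 L) ?K \<alpha> (p2 L) ?K' = L"
    proof (intro subset_antisym subrelI)
      fix g h assume "(g, h) \<in> goursat G H (p1 L) ?K \<alpha> (p2 L) ?K'"
      then obtain g' h' where gh: "(g', h) \<in> L" "(g, h') \<in> L" "\<alpha> (?K' #>\<^bsub>H\<^esub> h) = ?K #>\<^bsub>G\<^esub> g"
        by (auto simp: goursat_iff p1_iff p2_iff)
      then have "(g \<otimes>\<^bsub>G\<^esub> inv\<^bsub>G\<^esub> g', \<one>\<^bsub>H\<^esub>) \<in> L" using coset1[OF gh(2,1)] \<alpha>[OF gh(1)] by simp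
      then have "(g \<otimes>\<^bsub>G\<^esub> inv\<^bsub>G\<^esub> g' \<otimes>\<^bsub>G\<^esub> g', \<one>\<^bsub>H\<^esub> \<otimes>\<^bsub>H\<^esub> h) \<in> L" using gh(1) by (rule mult_mem)
      then show "(g, h) \<in> L" using mem_carrier[OF gh(1)] mem_carrier[OF gh(2)] by (simp add: G.m_assoc)
    qed (use \<alpha> in \<open>auto simp: goursat_iff p1_iff p2_iff\<close>)
    show "\<alpha> \<in> iso (sec_quot H (p2 L) ?K') (sec_quot G (p1 L) ?K)"
      unfolding iso_def
    proof (intro CollectI conjI homI)
      show "\<alpha> U \<in> carrier (sec_quot G (p1 L) ?K)" if "U \<in> ?C" for U
        using that C D \<alpha> by auto
      show "\<alpha> (U \<otimes>\<^bsub>sec_quot H (p2 L) ?K'\<^esub> V) = \<alpha> U \<otimes>\<^bsub>sec_quot G (p1 L) ?K\<^esub> \<alpha> V"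
        if UV: "U \<in> ?C" "V \<in> ?C" for U V
      proof -
        obtain g h where gh: "(g, h) \<in> L" "U = ?K' #>\<^bsub>H\<^esub> h" using UV(1) C by blast
        obtain g' h' where gh': "(g', h') \<in> L" "V = ?K' #>\<^bsub>H\<^esub> h'" using UV(2) C by blast
        have "g \<in> p1 L" "g' \<in> p1 L" "h \<in> p2 L" "h' \<in> p2 L" using gh gh' by (auto simp: p1_iff)
        then show ?thesis
          using sec_quot_mult[OF section_p2_k2, of h h'] sec_quot_mult[OF section_p1_k1, of g g']
            \<alpha>[OF mult_mem[OF gh(1) gh'(1)]] \<alpha>[OF gh(1)] \<alpha>[OF gh'(1)] gh gh' by simp
      qed
      show "bij_betw \<alpha> ?C (carrier (sec_quot G (p1 L) ?K))"
        unfolding bij_betw_def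
      proof (intro conjI inj_onI)
        fix U V assume UV: "U \<in> ?C" "V \<in> ?C" "\<alpha> U = \<alpha> V"
        obtain g h where gh: "(g, h) \<in> L" "U = ?K' #>\<^bsub>H\<^esub> h" using UV(1) C by blast
        obtain g' h' where gh': "(g', h') \<in> L" "V = ?K' #>\<^bsub>H\<^esub> h'" using UV(2) C by blast
        show "U = V" using UV(3) cosets[OF gh(1) gh'(1)] \<alpha>[OF gh(1)] \<alpha>[OF gh'(1)] gh gh' by simp
      next
        show "\<alpha> ` ?C = carrier (sec_quot G (p1 L) ?K)" unfolding C D using \<alpha> by (fastforce simp: image_iff)
      qed
    qed
  qed
qed

section \<open>The twisted category algebra\<close>

text \<open>
  The abbreviation for the image of a natural number in \<open>R\<close> refers to rings whose record has no further fields.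
\<close>

locale plain_cring = cring R for R :: "'r ring" (structure)

lemma (in plain_cring) nat_in_mult: "nat_in R (m * n) = nat_in R m \<otimes> nat_in R n"
proof -
  have "nat_in R (n * m) = [m] \<cdot> ([n] \<cdot> \<one>)" by (rule add.nat_pow_pow[symmetric, OF one_closed])
  also have "\<dots> = nat_in R m \<otimes> nat_in R n"
    by (simp add: add_pow_ldistr)
  finally show ?thesis by (simp add: mult.commute)
qed

lemma (in plain_cring) nat_in_dvd_Units:
  assumes "nat_in R n \<in> Units R" "m dvd n"
  shows "nat_in R m \<in> Units R"
proof -
  obtain k where n: "n = m * k" using assms(2) by blast
  let ?u = "inv (nat_in R n)"
  have u: "?u \<in> carrier R" "nat_in R m \<otimes> nat_in R k \<otimes> ?u = \<one>"
    using assms(1) by (simp_all add: n nat_in_mult)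
  have "nat_in R m \<otimes> (nat_in R k \<otimes> ?u) = \<one>" using u by (simp add: m_assoc)
  moreover have "(nat_in R k \<otimes> ?u) \<otimes> nat_in R m = \<one>" using u calculation by (simp add: m_comm)
  ultimately show ?thesis using u(1) by (auto simp: Units_def intro!: bexI[of _ "nat_in R k \<otimes> ?u"])
qed

locale star_category =
  fixes \<O> :: "'g monoid set" and C :: "'g subgroup_category" and R :: "'r ring"
  assumes represents: "represents_finite_groups \<O>"
    and subcat: "subcategory C (category_B \<O>)"
    and finite_C: "finite_category C"
    and star: "condition_star C"
    and cring_R: "cring R"
    and order_Units: "\<And>G. G \<in> Ob C \<Longrightarrow> nat_in R (order G) \<in> Units R"
begin

sublocale R: plain_cring R by (rule plain_cring.intro[OF cring_R])

abbreviation A where "A \<equiv> twisted_algebra C R"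
abbreviation mono where "mono \<equiv> monomial R (Mor C)"

lemma Ob_group: "G \<in> Ob C \<Longrightarrow> group G" "G \<in> Ob C \<Longrightarrow> finite (carrier G)"
  using represents subcat
  by (auto simp: represents_finite_groups_def subcategory_def category_B_def)

lemma Hom_prod_subgroup:
  assumes "G \<in> Ob C" "H \<in> Ob C" "L \<in> Hom C G H"
  shows "prod_subgroup G H L"
proof -
  have "Hom C G H \<subseteq> Hom (category_B \<O>) G H" using subcat assms(1,2) by (simp add: subcategory_def)
  then have "subgroup L (G \<times>\<times> H)" using assms(3) by (auto simp: category_B_def)
  then show ?thesis
    using Ob_group assms by (intro prod_subgroup.intro plain_group.intro prod_subgroup_axioms.intro) auto
qed

lemma Hom_comp:
  "G \<in> Ob C \<Longrightarrow> H \<in> Ob C \<Longrightarrow> K \<in> Ob C \<Longrightarrow> L \<in> Hom C G H \<Longrightarrow> M \<in> Hom C H K \<Longrightarrow> L O M \<in> Hom C G K"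
  using subcat by (simp add: subcategory_def)

lemma Id_Hom: "G \<in> Ob C \<Longrightarrow> Id_on (carrier G) \<in> Hom C G G"
  using subcat by (simp add: subcategory_def)

lemma MorD:
  assumes "(G, L, H) \<in> Mor C"
  shows "G \<in> Ob C" "H \<in> Ob C" "L \<in> Hom C G H" "prod_subgroup G H L"
  using assms Hom_prod_subgroup by (auto simp: Mor_def)

lemma comp_Mor: "(G, L, H) \<in> Mor C \<Longrightarrow> (H, M, K) \<in> Mor C \<Longrightarrow> (G, L O M, K) \<in> Mor C"
  using Hom_comp by (auto simp: Mor_def)

lemma kappa_eq:
  "kappa R (G, L, H) (H, M, K) =
    nat_in R (card (k2 G L \<inter> k1 K M)) \<otimes>\<^bsub>R\<^esub> inv\<^bsub>R\<^esub> (nat_in R (order H))"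
  by (simp add: kappa_def)

text \<open>
  The group \<open>k\<^sub>2(L) \<inter> k\<^sub>1(M)\<close> is a subgroup of \<open>H\<close>, so its order divides the unit \<open>|H|\<close>.
\<close>

lemma kappa_Units:
  assumes L: "(G, L, H) \<in> Mor C" and M: "(H, M, K) \<in> Mor C"
  shows "kappa R (G, L, H) (H, M, K) \<in> Units R"
proof -
  interpret L: prod_subgroup G H L using MorD[OF L] by simp
  interpret M: prod_subgroup H K M using MorD[OF M] by simp
  have "subgroup (k2 G L) H" by (rule L.H.section_subgroup[OF L.section_p2_k2])
  moreover have "subgroup (k1 K M) H" by (rule L.H.section_subgroup[OF M.section_p1_k1])
  ultimately have "subgroup (k2 G L \<inter> k1 K M) H" by (rule L.H.subgroups_Inter_pair)
  then have "card (k2 G L \<inter> k1 K M) dvd order H"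
    using L.H.lagrange_finite[OF L.finite_H] by (metis dvd_triv_right)
  then have "nat_in R (card (k2 G L \<inter> k1 K M)) \<in> Units R"
    using R.nat_in_dvd_Units order_Units MorD(2)[OF L] by blast
  then show ?thesis
    unfolding kappa_eq using order_Units[OF MorD(2)[OF L]] R.Units_m_closed R.Units_inv_Units by blast
qed

lemma kappa_closed:
  assumes "x \<in> Mor C \<or> y \<in> Mor C"
  shows "kappa R x y \<in> carrier R"
proof -
  obtain G L H H' M K where xy: "x = (G, L, H)" "y = (H', M, K)" by (cases x, cases y) auto
  show ?thesis
  proof (cases "H = H'")
    case True
    then have "H \<in> Ob C" using assms xy by (auto simp: Mor_def)
    then have "inv\<^bsub>R\<^esub> (nat_in R (order H)) \<in> carrier R" using order_Units by simp
    then show ?thesis using True by (simp add: xy kappa_eq)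
  qed (simp add: xy kappa_def)
qed

definition unit_A where
  "unit_A = restrict (\<lambda>(G, L, H). if G = H \<and> L = Id_on (carrier G) then nat_in R (order G) else \<zero>\<^bsub>R\<^esub>) (Mor C)"

lemma unit_A_simps:
  assumes "(G, L, H) \<in> Mor C"
  shows "unit_A (G, L, H) = (if G = H \<and> L = Id_on (carrier G) then nat_in R (order G) else \<zero>\<^bsub>R\<^esub>)"
  using assms by (simp add: unit_A_def)

lemma unit_A_closed: "unit_A \<in> Mor C \<rightarrow>\<^sub>E carrier R"
proof (rule PiE_I)
  show "unit_A y \<in> carrier R" if "y \<in> Mor C" for y
    using that by (cases y) (simp add: unit_A_simps)
qed (simp add: unit_A_def)

lemma A_eq: "A = basis_algebra R (Mor C) (kappa R) comp_mor unit_A"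
  by (simp add: twisted_algebra_def unit_A_def)

sublocale BP: basis_product R "Mor C" "kappa R" comp_mor unit_A
proof (intro basis_product.intro basis_product_axioms.intro R.cring_axioms)
  show "finite (Mor C)" using finite_C by (simp add: finite_category_def)
  show "kappa R x y \<in> carrier R" if "x \<in> Mor C \<or> y \<in> Mor C" for x y
    by (rule kappa_closed[OF that])
  show "comp_mor x y \<in> Mor C" if "x \<in> Mor C" "y \<in> Mor C" "kappa R x y \<noteq> \<zero>\<^bsub>R\<^esub>" for x y
    using that comp_Mor by (cases x, cases y) (auto simp: comp_mor_def kappa_def split: if_splits)
  show "comp_mor (comp_mor x y) z = comp_mor x (comp_mor y z)" for x y z :: "'g morphism"
    by (cases x, cases y, cases z) (auto simp: comp_mor_def O_assoc)
  show "kappa R x y \<otimes>\<^bsub>R\<^esub> kappa R (comp_mor x y) z = kappa R x (comp_mor y z) \<otimes>\<^bsub>R\<^esub> kappa R y z"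
    if xyz: "x \<in> Mor C" "y \<in> Mor C" "z \<in> Mor C" for x y z
  proof -
    obtain G L H where x: "x = (G, L, H)" by (cases x)
    obtain H' M K where y: "y = (H', M, K)" by (cases y)
    obtain K' N I where z: "z = (K', N, I)" by (cases z)
    have c: "kappa R x y \<in> carrier R" "kappa R (comp_mor x y) z \<in> carrier R"
      "kappa R x (comp_mor y z) \<in> carrier R" "kappa R y z \<in> carrier R"
      using xyz kappa_closed by auto
    show ?thesis
    proof (cases "H = H' \<and> K = K'")
      case True
      have "card (k2 G L \<inter> k1 K M) * card (k2 G (L O M) \<inter> k1 I N) =
          card (k2 G L \<inter> k1 I (M O N)) * card (k2 H M \<inter> k1 I N)"
        using card_cocycle MorD(4) xyz x y z True by blast
      then have eq: "nat_in R (card (k2 G L \<inter> k1 K M)) \<otimes>\<^bsub>R\<^esub> nat_in R (card (k2 G (L O M) \<inter> k1 I N)) =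
          nat_in R (card (k2 G L \<inter> k1 I (M O N))) \<otimes>\<^bsub>R\<^esub> nat_in R (card (k2 H M \<inter> k1 I N))"
        by (simp only: R.nat_in_mult[symmetric])
      have "inv\<^bsub>R\<^esub> (nat_in R (order H)) \<in> carrier R" "inv\<^bsub>R\<^esub> (nat_in R (order K)) \<in> carrier R"
        using xyz x z True MorD order_Units by auto
      moreover have "(a \<otimes>\<^bsub>R\<^esub> i) \<otimes>\<^bsub>R\<^esub> (b \<otimes>\<^bsub>R\<^esub> j) = (a \<otimes>\<^bsub>R\<^esub> b) \<otimes>\<^bsub>R\<^esub> (i \<otimes>\<^bsub>R\<^esub> j)"
        if "a \<in> carrier R" "b \<in> carrier R" "i \<in> carrier R" "j \<in> carrier R" for a b i j
        using that by (simp add: R.m_ac)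
      ultimately have "kappa R x y \<otimes>\<^bsub>R\<^esub> kappa R (comp_mor x y) z =
          nat_in R (card (k2 G L \<inter> k1 K M)) \<otimes>\<^bsub>R\<^esub> nat_in R (card (k2 G (L O M) \<inter> k1 I N)) \<otimes>\<^bsub>R\<^esub>
          (inv\<^bsub>R\<^esub> (nat_in R (order H)) \<otimes>\<^bsub>R\<^esub> inv\<^bsub>R\<^esub> (nat_in R (order K)))"
        "kappa R x (comp_mor y z) \<otimes>\<^bsub>R\<^esub> kappa R y z =
          nat_in R (card (k2 G L \<inter> k1 I (M O N))) \<otimes>\<^bsub>R\<^esub> nat_in R (card (k2 H M \<inter> k1 I N)) \<otimes>\<^bsub>R\<^esub>
          (inv\<^bsub>R\<^esub> (nat_in R (order H)) \<otimes>\<^bsub>R\<^esub> inv\<^bsub>R\<^esub> (nat_in R (order K)))"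
        using True by (simp_all add: x y z comp_mor_def kappa_eq)
      then show ?thesis using eq by simp
    next
      case False
      then have "kappa R x y = \<zero>\<^bsub>R\<^esub> \<or> kappa R (comp_mor x y) z = \<zero>\<^bsub>R\<^esub>"
        "kappa R x (comp_mor y z) = \<zero>\<^bsub>R\<^esub> \<or> kappa R y z = \<zero>\<^bsub>R\<^esub>"
        by (auto simp: x y z comp_mor_def kappa_def)
      then show ?thesis using c by auto
    qed
  qed
qed

lemma BA_eq_A: "BP.BA = A"
  by (simp add: A_eq)

text \<open>\<open>|G| \<Delta>(G)\<close> fixes every \<open>L\<close> from the left if \<open>L \<le> G \<times> H\<close>, because \<open>\<kappa>(\<Delta>(G), L) = 1 / |G|\<close>.\<close>

sublocale TB: twisted_basis R "Mor C" "kappa R" comp_mor unit_A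
proof (intro twisted_basis.intro BP.basis_product_axioms twisted_basis_axioms.intro)
  show "unit_A \<in> Mor C \<rightarrow>\<^sub>E carrier R" by (rule unit_A_closed)
  have inv1: "nat_in R 1 \<otimes>\<^bsub>R\<^esub> inv\<^bsub>R\<^esub> (nat_in R (order G)) \<otimes>\<^bsub>R\<^esub> (nat_in R (order G) \<otimes>\<^bsub>R\<^esub> r) = r"
    if "G \<in> Ob C" "r \<in> carrier R" for G r
    using order_Units[OF that(1)] that(2) by (simp add: R.m_assoc[symmetric])
  fix r x assume r: "r \<in> carrier R" and x: "x \<in> Mor C"
  obtain G L H where xe: "x = (G, L, H)" by (cases x)
  interpret L: prod_subgroup G H L using MorD x xe by blast
  have Ob: "G \<in> Ob C" "H \<in> Ob C" using MorD x xe by auto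
  have Id: "(G, Id_on (carrier G), G) \<in> Mor C" "(H, Id_on (carrier H), H) \<in> Mor C"
    using Id_Hom Ob by (auto simp: Mor_def)
  have comp: "Id_on (carrier G) O L = L" "L O Id_on (carrier H) = L"
    using L.mem_carrier by (auto simp: Id_on_def)
  have int: "k2 G (Id_on (carrier G)) \<inter> k1 H L = {\<one>\<^bsub>G\<^esub>}" "k2 G L \<inter> k1 H (Id_on (carrier H)) = {\<one>\<^bsub>H\<^esub>}"
    using L.one_mem by (auto simp: k1_iff k2_iff)
  have uc: "unit_A y \<in> carrier R" if "y \<in> Mor C" for y
    using that unit_A_closed by auto
  have u: "unit_A \<in> carrier BP.BA" unfolding BP.BA_simps by (rule unit_A_closed)
  have m: "mono r x \<in> carrier BP.BA" by (rule BP.mono_in_BA[OF r])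
  have kc: "kappa R y z \<in> carrier R" if "y \<in> Mor C" for y z using that kappa_closed by blast
  have "unit_A \<otimes>\<^bsub>BP.BA\<^esub> mono r x = mono (kappa R (G, Id_on (carrier G), G) x \<otimes>\<^bsub>R\<^esub>
      (unit_A (G, Id_on (carrier G), G) \<otimes>\<^bsub>R\<^esub> mono r x x)) (comp_mor (G, Id_on (carrier G), G) x)"
  proof (rule BP.mult_single[OF u m Id(1) x])
    fix y z assume yz: "y \<in> Mor C" "z \<in> Mor C" "(y, z) \<noteq> ((G, Id_on (carrier G), G), x)"
    obtain G1 M G2 where y: "y = (G1, M, G2)" by (cases y)
    consider "z \<noteq> x" | "z = x" "G2 \<noteq> G" | "unit_A y = \<zero>\<^bsub>R\<^esub>"
      using yz y unit_A_simps[of G1 M G2] by (cases "G1 = G2 \<and> M = Id_on (carrier G1)") auto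
    then show "kappa R y z \<otimes>\<^bsub>R\<^esub> (unit_A y \<otimes>\<^bsub>R\<^esub> mono r x z) = \<zero>\<^bsub>R\<^esub>"
    proof cases
      case 2
      then have "kappa R y z = \<zero>\<^bsub>R\<^esub>" using y xe by (simp add: kappa_def)
      then show ?thesis using yz uc r by (simp add: monomial_def)
    qed (use yz uc kc r in \<open>simp_all add: monomial_def\<close>)
  qed
  moreover have "kappa R (G, Id_on (carrier G), G) x \<otimes>\<^bsub>R\<^esub>
      (unit_A (G, Id_on (carrier G), G) \<otimes>\<^bsub>R\<^esub> mono r x x) = r"
    using inv1[OF Ob(1) r] Id(1) x by (simp add: xe kappa_eq int unit_A_simps monomial_def)
  ultimately show "unit_A \<otimes>\<^bsub>BP.BA\<^esub> mono r x = mono r x"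
    by (simp only:) (simp add: xe comp_mor_def comp)
  have "mono r x \<otimes>\<^bsub>BP.BA\<^esub> unit_A = mono (kappa R x (H, Id_on (carrier H), H) \<otimes>\<^bsub>R\<^esub>
      (mono r x x \<otimes>\<^bsub>R\<^esub> unit_A (H, Id_on (carrier H), H))) (comp_mor x (H, Id_on (carrier H), H))"
  proof (rule BP.mult_single[OF m u x Id(2)])
    fix z y assume yz: "z \<in> Mor C" "y \<in> Mor C" "(z, y) \<noteq> (x, (H, Id_on (carrier H), H))"
    obtain G1 M G2 where y: "y = (G1, M, G2)" by (cases y)
    consider "z \<noteq> x" | "z = x" "G1 \<noteq> H" | "unit_A y = \<zero>\<^bsub>R\<^esub>"
      using yz y unit_A_simps[of G1 M G2] by (cases "G1 = G2 \<and> M = Id_on (carrier G1)") auto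
    then show "kappa R z y \<otimes>\<^bsub>R\<^esub> (mono r x z \<otimes>\<^bsub>R\<^esub> unit_A y) = \<zero>\<^bsub>R\<^esub>"
    proof cases
      case 2
      then have "kappa R z y = \<zero>\<^bsub>R\<^esub>" using y xe by (simp add: kappa_def)
      then show ?thesis using yz uc r by (simp add: monomial_def)
    qed (use yz uc kc r in \<open>simp_all add: monomial_def\<close>)
  qed
  moreover have "kappa R x (H, Id_on (carrier H), H) \<otimes>\<^bsub>R\<^esub>
      (mono r x x \<otimes>\<^bsub>R\<^esub> unit_A (H, Id_on (carrier H), H)) = r"
    using inv1[OF Ob(2) r] Id(2) x r R.m_comm[of r "nat_in R (order H)"]
    by (simp add: xe kappa_eq int unit_A_simps monomial_def)
  ultimately show "mono r x \<otimes>\<^bsub>BP.BA\<^esub> unit_A = mono r x"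
    by (simp only:) (simp add: xe comp_mor_def comp)
qed

lemma ring_A: "ring A"
  using TB.ring_BA by (simp add: A_eq)

sublocale A: ring A by (rule ring_A)

lemma mono_mult_A:
  assumes "r \<in> carrier R" "s \<in> carrier R" "(G, L, H) \<in> Mor C" "(H, M, K) \<in> Mor C"
  shows "mono r (G, L, H) \<otimes>\<^bsub>A\<^esub> mono s (H, M, K) =
    mono (kappa R (G, L, H) (H, M, K) \<otimes>\<^bsub>R\<^esub> (r \<otimes>\<^bsub>R\<^esub> s)) (G, L O M, K)"
  using BP.mono_mult[OF assms] unfolding BA_eq_A by (simp add: comp_mor_def)

lemma mono_carrier: "r \<in> carrier R \<Longrightarrow> mono r x \<in> carrier A"
  using BP.mono_in_BA by (simp add: BA_eq_A)

lemma span_carrier: "f \<in> basis_span R (Mor C) Y \<Longrightarrow> f \<in> carrier A"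
  using BP.basis_span_subset by (auto simp: BA_eq_A)

lemma carrier_A: "carrier A = basis_span R (Mor C) (Mor C)"
  using BP.basis_span_X by (simp add: BA_eq_A)

lemma span_mult:
  assumes "f \<in> basis_span R (Mor C) Y1" "g \<in> basis_span R (Mor C) Y2"
    and "\<And>G L H M K. (G, L, H) \<in> Mor C \<Longrightarrow> (H, M, K) \<in> Mor C \<Longrightarrow> (G, L, H) \<in> Y1 \<Longrightarrow> (H, M, K) \<in> Y2 \<Longrightarrow>
      (G, L O M, K) \<in> Y3"
  shows "f \<otimes>\<^bsub>A\<^esub> g \<in> basis_span R (Mor C) Y3"
  unfolding BA_eq_A[symmetric]
proof (rule BP.basis_span_mult[OF assms(1,2)])
  fix x y assume xy: "x \<in> Mor C" "y \<in> Mor C" "x \<in> Y1" "y \<in> Y2" "kappa R x y \<noteq> \<zero>\<^bsub>R\<^esub>"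
  obtain G L H where x: "x = (G, L, H)" by (cases x)
  obtain H' M K where y: "y = (H', M, K)" by (cases y)
  have "H = H'" using xy(5) x y by (auto simp: kappa_def split: if_splits)
  then show "comp_mor x y \<in> Y3" using assms(3) xy x y by (simp add: comp_mor_def)
qed

end

section \<open>Automorphisms of sections realized in the category\<close>

lemma autoD:
  assumes "\<alpha> \<in> auto Q"
  shows "\<alpha> \<in> iso Q Q" "\<alpha> \<in> carrier Q \<rightarrow> carrier Q" "\<alpha> \<in> extensional (carrier Q)"
  using assms by (auto simp: auto_def Bij_def iso_def bij_betw_def)

lemma iso_restrict_auto:
  assumes "\<alpha> \<in> iso Q Q" "group Q"
  shows "restrict \<alpha> (carrier Q) \<in> auto Q"
proof -
  interpret group Q by fact
  show ?thesis using assms(1) by (auto simp: auto_def Bij_def iso_def hom_def bij_betw_def inj_on_def)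
qed

lemma AutoGroup_simps:
  "carrier (AutoGroup Q) = auto Q" "\<one>\<^bsub>AutoGroup Q\<^esub> = (\<lambda>x\<in>carrier Q. x)"
  by (simp_all add: AutoGroup_def BijGroup_def)

lemma AutoGroup_mult:
  assumes "\<alpha> \<in> auto Q" "\<beta> \<in> auto Q"
  shows "\<alpha> \<otimes>\<^bsub>AutoGroup Q\<^esub> \<beta> = compose (carrier Q) \<alpha> \<beta>"
  using assms by (simp add: AutoGroup_def BijGroup_def auto_def)

lemma finite_auto:
  assumes "finite (carrier Q)"
  shows "finite (auto Q)"
proof (rule finite_subset)
  show "auto Q \<subseteq> carrier Q \<rightarrow>\<^sub>E carrier Q" by (auto simp: auto_def hom_def Bij_def PiE_def)
qed (simp add: finite_PiE assms)

context star_category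
begin

abbreviation auts where "auts s \<equiv> carrier (Aut_C C s)"

lemma auts_iff: "\<alpha> \<in> auts (G, P, K) \<longleftrightarrow>
    \<alpha> \<in> auto (sec_quot G P K) \<and> goursat G G P K \<alpha> P K \<in> Hom C G G"
  by (simp add: Aut_C_def)

lemma finite_sec_quot:
  assumes "G \<in> Ob C" "is_section G P K"
  shows "finite (carrier (sec_quot G P K))"
  using finite_subset[OF subgroup.subset[OF is_sectionD(1)[OF assms(2)]] Ob_group(2)[OF assms(1)]]
  by (simp add: sec_quot_carrier)

lemma goursat_compose:
  assumes "\<alpha> \<in> auto (sec_quot G P K)" "\<beta> \<in> auto (sec_quot G P K)"
  shows "goursat G G P K \<alpha> P K O goursat G G P K \<beta> P K =
    goursat G G P K (\<alpha> \<otimes>\<^bsub>AutoGroup (sec_quot G P K)\<^esub> \<beta>) P K"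
  unfolding goursat_comp[OF autoD(2)[OF assms(2)]] AutoGroup_mult[OF assms]
  by (rule goursat_cong) (simp add: compose_def)

lemma goursat_one: "goursat G G P K \<one>\<^bsub>AutoGroup (sec_quot G P K)\<^esub> P K = e_sec G P K"
  unfolding e_sec_def by (rule goursat_cong) (simp add: AutoGroup_simps)

lemma auts_subgroup:
  assumes G: "G \<in> Ob C" and sec: "is_section G P K" and ne: "auts (G, P, K) \<noteq> {}"
  shows "subgroup (auts (G, P, K)) (AutoGroup (sec_quot G P K))"
proof -
  let ?Q = "sec_quot G P K"
  interpret Q: group ?Q by (rule group_sec_quot[OF sec])
  interpret AQ: group "AutoGroup ?Q" by (rule Q.AutoGroup)
  show ?thesis
  proof (rule AQ.closed_subset_is_subgroup[OF _ _ ne])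
    show "finite (carrier (AutoGroup ?Q))"
      using finite_auto[OF finite_sec_quot[OF G sec]] by (simp add: AutoGroup_simps)
    show "\<alpha> \<otimes>\<^bsub>AutoGroup ?Q\<^esub> \<beta> \<in> auts (G, P, K)" if "\<alpha> \<in> auts (G, P, K)" "\<beta> \<in> auts (G, P, K)" for \<alpha> \<beta>
      using that AQ.m_closed[of \<alpha> \<beta>] Hom_comp[OF G G G, of "goursat G G P K \<alpha> P K" "goursat G G P K \<beta> P K"]
        goursat_compose[of \<alpha> G P K \<beta>]
      by (simp add: auts_iff AutoGroup_simps)
  qed (auto simp: auts_iff AutoGroup_simps)
qed

lemma e_sec_Hom_if_auts:
  assumes G: "G \<in> Ob C" and sec: "is_section G P K" and ne: "auts (G, P, K) \<noteq> {}"
  shows "(G, P, K) \<in> C_sections C"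
proof -
  have "\<one>\<^bsub>AutoGroup (sec_quot G P K)\<^esub> \<in> auts (G, P, K)"
    by (rule subgroup.one_closed[OF auts_subgroup[OF assms]])
  then have "e_sec G P K \<in> Hom C G G" unfolding auts_iff goursat_one by simp
  then show ?thesis using G sec by (simp add: C_sections_def)
qed

text \<open>
  Condition (*), applied to the group \<open>q(L)\<close>, which \<open>L\<close> realizes.
\<close>

lemma star_iso:
  assumes L: "(G, L, H) \<in> Mor C" and "G1 \<in> Ob C" "G2 \<in> Ob C" "is_section G1 P1 K1" "is_section G2 P2 K2"
    and "sec_quot G1 P1 K1 \<cong> sec_quot G (p1 L) (k1 H L)" "sec_quot G (p1 L) (k1 H L) \<cong> sec_quot G2 P2 K2"
  obtains \<alpha> where "\<alpha> \<in> iso (sec_quot G2 P2 K2) (sec_quot G1 P1 K1)"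
    "goursat G1 G2 P1 K1 \<alpha> P2 K2 \<in> Hom C G1 G2"
proof -
  interpret L: prod_subgroup G H L using MorD[OF L] by simp
  have "realized C (sec_quot G (p1 L) (k1 H L))"
    unfolding realized_def using group_sec_quot[OF L.section_p1_k1] MorD[OF L]
      finite_sec_quot[OF MorD(1)[OF L] L.section_p1_k1] iso_refl by blast
  then show thesis using that star assms(2-) unfolding condition_star_def by blast
qed

text \<open>
  Condition (*) only provides some automorphism \<open>\<alpha>\<close> of \<open>p\<^sub>1(L) / k\<^sub>1(L)\<close> with graph in the category.  The graphs are closed
  under composition, so the graph of the identity, a power of \<open>\<alpha>\<close>, is there as well.
\<close>

lemma C_sections_p1_k1:
  assumes L: "(G, L, H) \<in> Mor C"
  shows "(G, p1 L, k1 H L) \<in> C_sections C"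
proof -
  interpret L: prod_subgroup G H L using MorD[OF L] by simp
  let ?Q = "sec_quot G (p1 L) (k1 H L)"
  note G = MorD(1)[OF L] and sec = L.section_p1_k1
  obtain \<alpha> where \<alpha>: "\<alpha> \<in> iso ?Q ?Q" "goursat G G (p1 L) (k1 H L) \<alpha> (p1 L) (k1 H L) \<in> Hom C G G"
    using star_iso[OF L G G sec sec iso_refl iso_refl] by blast
  have "goursat G G (p1 L) (k1 H L) (restrict \<alpha> (carrier ?Q)) (p1 L) (k1 H L) =
      goursat G G (p1 L) (k1 H L) \<alpha> (p1 L) (k1 H L)"
    by (rule goursat_cong) simp
  then have "restrict \<alpha> (carrier ?Q) \<in> auts (G, p1 L, k1 H L)"
    using iso_restrict_auto[OF \<alpha>(1) group_sec_quot[OF sec]] \<alpha>(2) by (simp add: auts_iff)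
  then show ?thesis using e_sec_Hom_if_auts[OF G sec] by blast
qed

end

definition srank :: "'g monoid \<times> 'g set \<times> 'g set \<Rightarrow> nat" where
  "srank = (\<lambda>(G, P, K). card (carrier (sec_quot G P K)))"

section \<open>The local algebra of a section\<close>

locale star_section = star_category \<O> C R
  for \<O> :: "'g monoid set" and C :: "'g subgroup_category" and R :: "'r ring" +
  fixes G :: "'g monoid" and P K :: "'g set"
  assumes C_section: "(G, P, K) \<in> C_sections C"
begin

abbreviation s where "s \<equiv> (G, P, K)"
abbreviation Q where "Q \<equiv> sec_quot G P K"
abbreviation e where "e \<equiv> e_sec G P K"
abbreviation e' where "e' \<equiv> e_prime C R s"
abbreviation idx where "idx \<equiv> nat_in R (card (rcosets\<^bsub>G\<^esub> K))"
abbreviation gm where "gm \<alpha> \<equiv> (G, goursat G G P K \<alpha> P K, G)"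

lemma Ob_G: "G \<in> Ob C" and sec: "is_section G P K" and e_Hom: "e \<in> Hom C G G"
  using C_section by (auto simp: C_sections_def)

lemma me_Mor: "(G, e, G) \<in> Mor C"
  using Ob_G e_Hom by (simp add: Mor_def)

sublocale E: prod_subgroup G G e
  by (rule Hom_prod_subgroup[OF Ob_G Ob_G e_Hom])

lemma k_e: "k1 G e = K" "k2 G e = K"
  using E.G.e_sec_k1[OF sec] k1_converse[of G e] by (simp_all add: e_sec_converse)

lemma p_e: "p1 e = P"
  by (rule E.G.e_sec_p1)

lemma rank_e: "rank G e = srank s"
  using E.rank_eq by (simp add: k_e p_e srank_def)

lemma idx_mult: "idx \<otimes>\<^bsub>R\<^esub> nat_in R (card K) = nat_in R (order G)"
  using E.G.lagrange_finite[OF Ob_group(2)[OF Ob_G] E.G.section_subgroup[OF sec]]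
  by (simp add: R.nat_in_mult[symmetric])

lemma idx_Units: "idx \<in> Units R"
  using E.G.lagrange_finite[OF Ob_group(2)[OF Ob_G] E.G.section_subgroup[OF sec]]
    R.nat_in_dvd_Units[OF order_Units[OF Ob_G]] by (metis dvd_triv_left)

lemma idx_inv: "nat_in R (card K) \<otimes>\<^bsub>R\<^esub> inv\<^bsub>R\<^esub> (nat_in R (order G)) = inv\<^bsub>R\<^esub> idx"
proof (rule R.comm_inv_char[symmetric])
  have o: "nat_in R (order G) \<in> Units R" by (rule order_Units[OF Ob_G])
  then show "nat_in R (card K) \<otimes>\<^bsub>R\<^esub> inv\<^bsub>R\<^esub> (nat_in R (order G)) \<in> carrier R" by simp
  show "idx \<otimes>\<^bsub>R\<^esub> (nat_in R (card K) \<otimes>\<^bsub>R\<^esub> inv\<^bsub>R\<^esub> (nat_in R (order G))) = \<one>\<^bsub>R\<^esub>"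
    using o idx_mult by (simp add: R.m_assoc[symmetric])
qed simp

lemma e'_eq: "e' = mono idx (G, e, G)"
  by (simp add: e_prime_def)

text \<open>
  If \<open>e * L = L\<close>, then \<open>K \<subseteq> k\<^sub>1(L)\<close>, hence \<open>\<kappa>(e, L) = |K| / |G| = 1 / [G : K]\<close>.  For this reason \<open>e' = [G : K] e\<close> is a
  left unit for such \<open>L\<close> and the identity of \<open>e'Ae'\<close>.
\<close>

lemma e_comp:
  assumes "(G, L, H) \<in> Mor C" "e O L = L"
  shows "kappa R (G, e, G) (G, L, H) = inv\<^bsub>R\<^esub> idx" "p1 L \<subseteq> P" "K \<subseteq> k1 H L"
proof -
  interpret L: prod_subgroup G H L using MorD[OF assms(1)] by simp
  show "p1 L \<subseteq> P" and K: "K \<subseteq> k1 H L" using L.e_sec_fixedD[OF sec assms(2)] by auto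
  then have "k2 G e \<inter> k1 H L = K" by (auto simp: k_e)
  then show "kappa R (G, e, G) (G, L, H) = inv\<^bsub>R\<^esub> idx" by (simp add: kappa_eq idx_inv)
qed

lemma comp_e:
  assumes "(H, L, G) \<in> Mor C" "L O e = L"
  shows "kappa R (H, L, G) (G, e, G) = inv\<^bsub>R\<^esub> idx" "p2 L \<subseteq> P" "K \<subseteq> k2 H L"
proof -
  interpret L: prod_subgroup H G L using MorD[OF assms(1)] by simp
  interpret L': prod_subgroup G H "L\<inverse>" by (rule L.converse)
  show "p2 L \<subseteq> P" and K: "K \<subseteq> k2 H L"
    using L'.e_sec_fixedD[OF sec] assms(2) L.comp_e_sec_iff by (auto simp: k1_converse)
  then have "k2 H L \<inter> k1 G e = K" by (auto simp: k_e)
  then show "kappa R (H, L, G) (G, e, G) = inv\<^bsub>R\<^esub> idx" by (simp add: kappa_eq idx_inv)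
qed

lemma idx_cancel:
  assumes "r \<in> carrier R"
  shows "inv\<^bsub>R\<^esub> idx \<otimes>\<^bsub>R\<^esub> (idx \<otimes>\<^bsub>R\<^esub> r) = r" "inv\<^bsub>R\<^esub> idx \<otimes>\<^bsub>R\<^esub> (r \<otimes>\<^bsub>R\<^esub> idx) = r"
    "r \<otimes>\<^bsub>R\<^esub> inv\<^bsub>R\<^esub> idx \<otimes>\<^bsub>R\<^esub> idx = r" "r \<otimes>\<^bsub>R\<^esub> idx \<otimes>\<^bsub>R\<^esub> inv\<^bsub>R\<^esub> idx = r"
proof -
  have i: "idx \<in> carrier R" "inv\<^bsub>R\<^esub> idx \<in> carrier R" using idx_Units by auto
  have 1: "inv\<^bsub>R\<^esub> idx \<otimes>\<^bsub>R\<^esub> idx = \<one>\<^bsub>R\<^esub>" "idx \<otimes>\<^bsub>R\<^esub> inv\<^bsub>R\<^esub> idx = \<one>\<^bsub>R\<^esub>" using idx_Units by auto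
  show 2: "inv\<^bsub>R\<^esub> idx \<otimes>\<^bsub>R\<^esub> (idx \<otimes>\<^bsub>R\<^esub> r) = r" using i 1 assms by (simp add: R.m_assoc[symmetric])
  then show "inv\<^bsub>R\<^esub> idx \<otimes>\<^bsub>R\<^esub> (r \<otimes>\<^bsub>R\<^esub> idx) = r" using i assms by (simp add: R.m_comm)
  show "r \<otimes>\<^bsub>R\<^esub> inv\<^bsub>R\<^esub> idx \<otimes>\<^bsub>R\<^esub> idx = r" "r \<otimes>\<^bsub>R\<^esub> idx \<otimes>\<^bsub>R\<^esub> inv\<^bsub>R\<^esub> idx = r"
    using i 1 assms by (simp_all add: R.m_assoc)
qed

lemma left_unit:
  assumes "r \<in> carrier R" "(G, L, H) \<in> Mor C" "e O L = L"
  shows "e' \<otimes>\<^bsub>A\<^esub> mono r (G, L, H) = mono r (G, L, H)"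
  using mono_mult_A[OF _ assms(1) me_Mor assms(2), of idx] idx_cancel[OF assms(1)]
    e_comp(1)[OF assms(2,3)] assms(3) by (simp add: e'_eq)

lemma right_unit:
  assumes "r \<in> carrier R" "(H, L, G) \<in> Mor C" "L O e = L"
  shows "mono r (H, L, G) \<otimes>\<^bsub>A\<^esub> e' = mono r (H, L, G)"
  using mono_mult_A[OF assms(1) _ assms(2) me_Mor, of idx] idx_cancel[OF assms(1)]
    comp_e(1)[OF assms(2,3)] assms(3) by (simp add: e'_eq)

lemma e_e: "e O e = e"
  using E.e_sec_comp[OF sec] by (simp add: p_e k_e)

sublocale ring_idempotent A e'
proof (intro ring_idempotent.intro ring_A ring_idempotent_axioms.intro)
  show "e' \<in> carrier A" unfolding e'_eq by (rule mono_carrier) simp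
  show "e' \<otimes>\<^bsub>A\<^esub> e' = e'" using left_unit[OF _ me_Mor e_e, of idx] by (simp add: e'_eq)
qed

lemma e'_span: "e' \<in> basis_span R (Mor C) {(G, e, G)}"
  unfolding e'_eq by (rule BP.mono_in_basis_span) simp_all

text \<open>The monoid \<open>e * C(G, G) * e\<close> as a set of morphisms; it is a basis of \<open>e'Ae'\<close> (\<open>corner_span\<close>).\<close>

definition local_basis where
  "local_basis = {(G, L, G) | L. L \<in> Hom C G G \<and> e O L = L \<and> L O e = L}"

lemma local_basis_iff:
  "(G1, L, G2) \<in> local_basis \<longleftrightarrow> G1 = G \<and> G2 = G \<and> L \<in> Hom C G G \<and> e O L = L \<and> L O e = L"
  by (auto simp: local_basis_def)

lemma local_basis_Mor: "local_basis \<subseteq> Mor C"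
  using Ob_G by (auto simp: local_basis_def Mor_def)

lemma local_basis_comp:
  assumes "(G, L, G) \<in> local_basis" "(G, M, G) \<in> local_basis"
  shows "(G, L O M, G) \<in> local_basis"
  using assms Hom_comp[OF Ob_G Ob_G Ob_G] by (simp add: local_basis_iff O_assoc) (simp add: O_assoc[symmetric])

lemma corner_span: "carrier B = basis_span R (Mor C) local_basis"
proof (intro subset_antisym subsetI)
  fix b assume b: "b \<in> carrier B"
  let ?Y = "{(G1, L, H). G1 = G \<and> H \<in> Ob C \<and> L \<in> Hom C G H \<and> e O L = L}"
  have "e' \<otimes>\<^bsub>A\<^esub> b \<in> basis_span R (Mor C) ?Y"
    by (rule span_mult[OF e'_span])
      (use b e_e Hom_comp Ob_G in \<open>auto simp: corner_carrier carrier_A Mor_def O_assoc[symmetric]\<close>)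
  then have "e' \<otimes>\<^bsub>A\<^esub> b \<otimes>\<^bsub>A\<^esub> e' \<in> basis_span R (Mor C) local_basis"
    by (rule span_mult[OF _ e'_span])
      (use e_e Hom_comp Ob_G in \<open>auto simp: local_basis_iff Mor_def O_assoc, auto simp: O_assoc[symmetric]\<close>)
  then show "b \<in> basis_span R (Mor C) local_basis" using b by (simp add: corner_carrier)
next
  fix b assume "b \<in> basis_span R (Mor C) local_basis"
  then show "b \<in> carrier B"
    unfolding corner_carrier
  proof (induction rule: BP.basis_span_induct)
    case zero
    then show ?case by (simp add: BA_eq_A del: BP.BA_simps)
  next
    case (mono r x)
    then show ?case
      using left_unit[OF mono(1)] right_unit[OF mono(1)] mono_carrier[OF mono(1)]
      by (cases x) (auto simp: local_basis_iff)
  next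
    case (add f g)
    then show ?case by (simp add: BA_eq_A A.l_distr A.r_distr del: BP.BA_simps)
  qed
qed

lemma local_monoid_carrier:
  "carrier (local_monoid C s) = {L \<in> Hom C G G. e O L = L \<and> L O e = L}"
proof (intro subset_antisym subsetI)
  fix M assume "M \<in> carrier (local_monoid C s)"
  then obtain L where L: "L \<in> Hom C G G" "M = e O L O e" by (auto simp: local_monoid_def)
  have "e O (e O L O e) = (e O e) O L O e" "(e O L O e) O e = e O L O (e O e)" by (simp_all only: O_assoc)
  then show "M \<in> {L \<in> Hom C G G. e O L = L \<and> L O e = L}"
    using L Hom_comp[OF Ob_G Ob_G Ob_G] e_Hom e_e by simp
next
  fix L assume "L \<in> {L \<in> Hom C G G. e O L = L \<and> L O e = L}"
  then show "L \<in> carrier (local_monoid C s)"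
    by (auto simp: local_monoid_def O_assoc[symmetric] intro!: exI[of _ L])
qed

lemma Units_local_iff: "L \<in> Units (local_monoid C s) \<longleftrightarrow>
    (G, L, G) \<in> local_basis \<and> (\<exists>M. (G, M, G) \<in> local_basis \<and> M O L = e \<and> L O M = e)"
  unfolding Units_def local_monoid_carrier by (auto simp: local_basis_iff local_monoid_def)

lemma auts_one: "\<one>\<^bsub>AutoGroup Q\<^esub> \<in> auts s"
proof -
  interpret Q: group Q by (rule group_sec_quot[OF sec])
  have "\<one>\<^bsub>AutoGroup Q\<^esub> \<in> auto Q"
    using monoid.one_closed[OF group.is_monoid[OF Q.AutoGroup]] by (simp add: AutoGroup_simps(1))
  then show ?thesis unfolding auts_iff goursat_one using e_Hom by blast
qed

lemma subgroup_auts: "subgroup (auts s) (AutoGroup Q)"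
  using auts_subgroup[OF Ob_G sec] auts_one by blast

lemma group_Aut_C: "group (Aut_C C s)"
proof -
  interpret Q: group Q by (rule group_sec_quot[OF sec])
  have "Aut_C C s = (AutoGroup Q)\<lparr>carrier := auts s\<rparr>" by (simp add: Aut_C_def)
  then show ?thesis using group.subgroup_imp_group[OF Q.AutoGroup subgroup_auts] by simp
qed

lemma Aut_C_simps: "mult (Aut_C C s) = mult (AutoGroup Q)" "\<one>\<^bsub>Aut_C C s\<^esub> = \<one>\<^bsub>AutoGroup Q\<^esub>"
  by (simp_all add: Aut_C_def)

lemma finite_auts: "finite (auts s)"
  using finite_subset[OF _ finite_auto[OF finite_sec_quot[OF Ob_G sec]]] by (auto simp: Aut_C_def)

lemma gm_local_basis:
  assumes "\<alpha> \<in> auts s"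
  shows "gm \<alpha> \<in> local_basis"
proof -
  let ?L = "goursat G G P K \<alpha> P K"
  have \<alpha>: "\<alpha> \<in> auto Q" "?L \<in> Hom C G G" using assms by (auto simp: auts_iff)
  interpret L: prod_subgroup G G ?L by (rule Hom_prod_subgroup[OF Ob_G Ob_G \<alpha>(2)])
  interpret L': prod_subgroup G G "?L\<inverse>" by (rule L.converse)
  note pk = goursat_sections[OF Ob_group(1)[OF Ob_G] Ob_group(1)[OF Ob_G] sec sec autoD(1)[OF \<alpha>(1)]]
  have "e O ?L = ?L" using L.e_sec_comp[OF sec] pk by simp
  moreover have "?L O e = ?L" unfolding L.comp_e_sec_iff
    by (rule L'.e_sec_comp[OF sec]) (simp_all add: pk k1_converse)
  ultimately show ?thesis using \<alpha>(2) by (simp add: local_basis_iff)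
qed

lemma gm_inj: "inj_on gm (auts s)"
proof (rule inj_onI)
  fix \<alpha> \<beta> assume ab: "\<alpha> \<in> auts s" "\<beta> \<in> auts s" "gm \<alpha> = gm \<beta>"
  then have "\<alpha> \<in> auto Q" "\<beta> \<in> auto Q" by (auto simp: auts_iff)
  moreover have "\<alpha> U = \<beta> U" if "U \<in> carrier Q" for U
    using goursat_inj[OF autoD(2)[OF \<open>\<alpha> \<in> auto Q\<close>] _ that] ab(3) by auto
  ultimately show "\<alpha> = \<beta>" using autoD(3) extensionalityI by blast
qed

lemma gm_comp:
  assumes "\<alpha> \<in> auts s" "\<beta> \<in> auts s"
  shows "goursat G G P K \<alpha> P K O goursat G G P K \<beta> P K = goursat G G P K (\<alpha> \<otimes>\<^bsub>Aut_C C s\<^esub> \<beta>) P K"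
  using assms by (simp add: goursat_compose auts_iff Aut_C_simps)

lemma gm_one: "goursat G G P K \<one>\<^bsub>Aut_C C s\<^esub> P K = e"
  by (simp add: Aut_C_simps goursat_one)

lemma rank_local_le:
  assumes "(G, L, G) \<in> local_basis"
  shows "rank G L \<le> srank s"
proof -
  have L: "(G, L, G) \<in> Mor C" "e O L = L" using assms local_basis_Mor by (auto simp: local_basis_iff)
  then show ?thesis
    using rank_comp_left[OF E.prod_subgroup_axioms MorD(4)[OF L(1)]] MorD(4)[OF L(1)] rank_e by simp
qed

text \<open>
  If \<open>L * M = e\<close>, then \<open>|P / K| = |q(e)| \<le> |q(L)|\<close>.  An \<open>L\<close> of rank \<open>|P / K|\<close> is the graph of an automorphism, by
  Goursat's lemma, and the graph of the inverse automorphism is its inverse.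
\<close>

lemma Units_local_tfae:
  assumes "(G, L, G) \<in> local_basis"
  shows "L \<in> Units (local_monoid C s) \<longleftrightarrow> rank G L = srank s"
    and "rank G L = srank s \<longleftrightarrow> (\<exists>\<alpha>\<in>auts s. L = goursat G G P K \<alpha> P K)"
proof -
  have LM: "(G, L, G) \<in> Mor C" "e O L = L" "L O e = L" "L \<in> Hom C G G"
    using assms local_basis_Mor by (auto simp: local_basis_iff)
  interpret L: prod_subgroup G G L using MorD[OF LM(1)] by simp
  interpret L': prod_subgroup G G "L\<inverse>" by (rule L.converse)
  have 1: "rank G L = srank s" if U: "L \<in> Units (local_monoid C s)"
  proof -
    obtain M where M: "(G, M, G) \<in> local_basis" "L O M = e" using U Units_local_iff by blast
    then have "prod_subgroup G G M" using MorD(4) local_basis_Mor by blast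
    then have "rank G e \<le> rank G L"
      using rank_comp_left[OF L.prod_subgroup_axioms, of G M] M(2) E.prod_subgroup_axioms by simp
    then show ?thesis using rank_local_le[OF assms] rank_e by simp
  qed
  have 2: "\<exists>\<alpha>\<in>auts s. L = goursat G G P K \<alpha> P K" if r: "rank G L = srank s"
  proof -
    have pk: "p1 L = P" "k1 G L = K"
      using L.rank_maximal[OF sec e_comp(2,3)[OF LM(1,2)]] r by (auto simp: srank_def)
    have pk': "p2 L = P" "k2 G L = K"
      using L'.rank_maximal[OF sec] comp_e(2,3)[OF LM(1,3)] r L.rank_converse
      by (auto simp: srank_def k1_converse)
    obtain \<alpha> where "\<alpha> \<in> iso Q Q" "\<alpha> \<in> extensional (carrier Q)" "goursat G G P K \<alpha> P K = L"
      using L.goursat_lemma unfolding pk pk' .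
    moreover then have "\<alpha> \<in> auto Q" by (auto simp: auto_def iso_def Bij_def)
    ultimately show ?thesis using LM(4) by (auto simp: auts_iff)
  qed
  have 3: "L \<in> Units (local_monoid C s)" if ex: "\<exists>\<alpha>\<in>auts s. L = goursat G G P K \<alpha> P K"
  proof -
    interpret Aut: group "Aut_C C s" by (rule group_Aut_C)
    obtain \<alpha> where \<alpha>: "\<alpha> \<in> auts s" "L = goursat G G P K \<alpha> P K" using ex by blast
    let ?\<beta> = "inv\<^bsub>Aut_C C s\<^esub> \<alpha>"
    have \<beta>: "?\<beta> \<in> auts s" using \<alpha>(1) by simp
    show ?thesis
      unfolding Units_local_iff using assms gm_local_basis[OF \<beta>] gm_comp[OF \<alpha>(1) \<beta>] gm_comp[OF \<beta> \<alpha>(1)] \<alpha>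
      by (auto simp: gm_one intro!: exI[of _ "goursat G G P K ?\<beta> P K"])
  qed
  show "L \<in> Units (local_monoid C s) \<longleftrightarrow> rank G L = srank s"
    and "rank G L = srank s \<longleftrightarrow> (\<exists>\<alpha>\<in>auts s. L = goursat G G P K \<alpha> P K)"
    using 1 2 3 by blast+
qed

lemma Gamma_eq: "Gamma C s = gm ` auts s"
proof (intro subset_antisym subsetI)
  fix x assume "x \<in> Gamma C s"
  then obtain L where "x = (G, L, G)" "L \<in> Units (local_monoid C s)" by (auto simp: Gamma_def)
  then show "x \<in> gm ` auts s" using Units_local_tfae Units_local_iff by blast
next
  fix x assume "x \<in> gm ` auts s"
  then obtain \<alpha> where "\<alpha> \<in> auts s" "x = gm \<alpha>" by blast
  then show "x \<in> Gamma C s"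
    using Units_local_tfae[of "goursat G G P K \<alpha> P K"] gm_local_basis[of \<alpha>] by (auto simp: Gamma_def)
qed

lemma J_set_eq: "J_set C s = {(G1, L, H). (G1, L, H) \<in> local_basis \<and> rank G L < srank s}"
proof (intro subset_antisym subsetI)
  fix x assume "x \<in> J_set C s"
  then obtain L where L: "x = (G, L, G)" "(G, L, G) \<in> local_basis" "L \<notin> Units (local_monoid C s)"
    by (auto simp: J_set_def local_monoid_carrier local_basis_iff)
  then show "x \<in> {(G1, L, H). (G1, L, H) \<in> local_basis \<and> rank G L < srank s}"
    using Units_local_tfae(1)[OF L(2)] rank_local_le[OF L(2)] by simp
next
  fix x assume "x \<in> {(G1, L, H). (G1, L, H) \<in> local_basis \<and> rank G L < srank s}"
  then obtain L where L: "x = (G, L, G)" "(G, L, G) \<in> local_basis" "rank G L < srank s"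
    by (auto simp: local_basis_iff)
  then show "x \<in> J_set C s"
    using Units_local_tfae(1)[OF L(2)] by (auto simp: J_set_def local_monoid_carrier local_basis_iff)
qed

lemma local_basis_split: "local_basis = Gamma C s \<union> J_set C s" "Gamma C s \<inter> J_set C s = {}"
  by (auto simp: Gamma_def J_set_def local_monoid_carrier local_basis_def Units_def)

lemma local_basis_cases:
  assumes "x \<in> local_basis"
  obtains (Gamma) \<alpha> where "\<alpha> \<in> auts s" "x = gm \<alpha>" | (J) "x \<in> J_set C s" "x \<notin> gm ` auts s"
  using assms local_basis_split Gamma_eq by blast

end

section \<open>Inflation to the local algebra\<close>

text \<open>
  A module on which the kernel of \<open>\<rho>\<close> acts as zero is a module for the image.  The section \<open>\<sigma>\<close> of \<open>\<rho>\<close> is an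
  arbitrary map: any choice of preimages acts in the same way.
\<close>

lemma module_descends:
  fixes U :: "('b, 'm) module"
  assumes U: "left_module B U" and "ring L" and \<rho>: "\<rho> \<in> ring_hom B L"
    and \<sigma>: "\<And>f. f \<in> carrier L \<Longrightarrow> \<sigma> f \<in> carrier B" "\<And>f. f \<in> carrier L \<Longrightarrow> \<rho> (\<sigma> f) = f"
    and act: "\<And>b u. b \<in> carrier B \<Longrightarrow> u \<in> carrier U \<Longrightarrow> b \<odot>\<^bsub>U\<^esub> u = \<sigma> (\<rho> b) \<odot>\<^bsub>U\<^esub> u"
  shows "left_module L (pullback \<sigma> U)"
    and "simple_module B U \<Longrightarrow> simple_module L (pullback \<sigma> U)"
    and "module_iso B U (pullback \<rho> (pullback \<sigma> U))"
proof -
  interpret U: left_module B U by fact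
  interpret L: ring L by fact
  have \<rho>c: "\<rho> b \<in> carrier L" if "b \<in> carrier B" for b by (rule ring_hom_closed[OF \<rho> that])
  show L: "left_module L (pullback \<sigma> U)"
  proof (intro left_module.intro left_module_axioms.intro \<open>ring L\<close>)
    show "abelian_group (pullback \<sigma> U)"
      by (rule abelian_group_transfer[OF U.M.abelian_group_axioms]) auto
    show "(f \<oplus>\<^bsub>L\<^esub> g) \<odot>\<^bsub>pullback \<sigma> U\<^esub> x = f \<odot>\<^bsub>pullback \<sigma> U\<^esub> x \<oplus>\<^bsub>pullback \<sigma> U\<^esub> g \<odot>\<^bsub>pullback \<sigma> U\<^esub> x"
      if "f \<in> carrier L" "g \<in> carrier L" "x \<in> carrier (pullback \<sigma> U)" for f g x
      using that act[of "\<sigma> f \<oplus>\<^bsub>B\<^esub> \<sigma> g" x] ring_hom_add[OF \<rho>, of "\<sigma> f" "\<sigma> g"]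
        U.smult_l_distr[of "\<sigma> f" "\<sigma> g" x] by (simp add: \<sigma>)
    show "(f \<otimes>\<^bsub>L\<^esub> g) \<odot>\<^bsub>pullback \<sigma> U\<^esub> x = f \<odot>\<^bsub>pullback \<sigma> U\<^esub> (g \<odot>\<^bsub>pullback \<sigma> U\<^esub> x)"
      if "f \<in> carrier L" "g \<in> carrier L" "x \<in> carrier (pullback \<sigma> U)" for f g x
      using that act[of "\<sigma> f \<otimes>\<^bsub>B\<^esub> \<sigma> g" x] ring_hom_mult[OF \<rho>, of "\<sigma> f" "\<sigma> g"]
        U.smult_assoc[of "\<sigma> f" "\<sigma> g" x] by (simp add: \<sigma>)
    show "\<one>\<^bsub>L\<^esub> \<odot>\<^bsub>pullback \<sigma> U\<^esub> x = x" if "x \<in> carrier (pullback \<sigma> U)" for x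
      using that act[of "\<one>\<^bsub>B\<^esub>" x] ring_hom_one[OF \<rho>] by simp
  qed (auto simp: \<sigma> U.smult_r_distr)
  show "module_iso B U (pullback \<rho> (pullback \<sigma> U))"
    by (rule module_isoI[of "\<lambda>x. x"]) (auto simp: bij_betw_def act)
  assume simple: "simple_module B U"
  have "N = {\<zero>\<^bsub>U\<^esub>} \<or> N = carrier U" if N: "submodule N L (pullback \<sigma> U)" for N
  proof (rule simple_moduleD(3)[OF simple], rule U.submoduleI)
    show "b \<odot>\<^bsub>U\<^esub> x \<in> N" if "b \<in> carrier B" "x \<in> N" for b x
    proof -
      have "\<sigma> (\<rho> b) \<odot>\<^bsub>U\<^esub> x \<in> N" using submoduleD(4)[OF N \<rho>c[OF that(1)] that(2)] by simp
      moreover have "x \<in> carrier U" using submoduleD(1)[OF N] that(2) by auto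
      ultimately show ?thesis using act[OF that(1)] by simp
    qed
  qed (use submoduleD[OF N] in auto)
  then show "simple_module L (pullback \<sigma> U)"
    using L simple_moduleD(2)[OF simple] by (auto simp: simple_module_def)
qed

context star_category
begin

lemma A_add_apply: "z \<in> Mor C \<Longrightarrow> (f \<oplus>\<^bsub>A\<^esub> g) z = f z \<oplus>\<^bsub>R\<^esub> g z"
  using BP.BA_simps(4)[unfolded BA_eq_A, of f g] by simp

lemma A_zero_apply: "z \<in> Mor C \<Longrightarrow> \<zero>\<^bsub>A\<^esub> z = \<zero>\<^bsub>R\<^esub>"
  using BP.BA_simps(3)[unfolded BA_eq_A] by simp

lemma A_carrier: "carrier A = Mor C \<rightarrow>\<^sub>E carrier R"
  using BP.BA_simps(1)[unfolded BA_eq_A] .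

lemma A_finsum_apply:
  assumes "finite I" "F \<in> I \<rightarrow> carrier A" "z \<in> Mor C"
  shows "(\<Oplus>\<^bsub>A\<^esub>i\<in>I. F i) z = (\<Oplus>\<^bsub>R\<^esub>i\<in>I. F i z)"
  using assms
proof (induction I)
  case empty
  then show ?case by (simp add: A_zero_apply)
next
  case (insert i I)
  then have F: "F \<in> I \<rightarrow> carrier A" "F i \<in> carrier A" by auto
  then have "(\<lambda>i. F i z) \<in> I \<rightarrow> carrier R" "F i z \<in> carrier R" using insert.prems(2) by (auto simp: A_carrier)
  then show ?case using insert F by (simp add: A_add_apply)
qed

end

context star_section
begin

abbreviation \<Lambda> where "\<Lambda> \<equiv> group_algebra R (Aut_C C s)"

sublocale Aut: group "Aut_C C s" by (rule group_Aut_C)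

sublocale GB: basis_product R "auts s" "\<lambda>_ _. \<one>\<^bsub>R\<^esub>" "mult (Aut_C C s)" "monomial R (auts s) \<one>\<^bsub>R\<^esub> \<one>\<^bsub>Aut_C C s\<^esub>"
  by unfold_locales (auto simp: finite_auts Aut.m_assoc)

lemma \<Lambda>_eq: "GB.BA = \<Lambda>"
  by (simp add: group_algebra_def)

sublocale GT: twisted_basis R "auts s" "\<lambda>_ _. \<one>\<^bsub>R\<^esub>" "mult (Aut_C C s)" "monomial R (auts s) \<one>\<^bsub>R\<^esub> \<one>\<^bsub>Aut_C C s\<^esub>"
  by unfold_locales (simp_all add: GB.mono_mult)

lemma ring_\<Lambda>: "ring \<Lambda>"
  using GT.ring_BA by (simp add: \<Lambda>_eq)

lemma \<Lambda>_carrier: "carrier \<Lambda> = auts s \<rightarrow>\<^sub>E carrier R"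
  using GB.BA_simps(1)[unfolded \<Lambda>_eq] .

lemma \<Lambda>_simps:
  "\<one>\<^bsub>\<Lambda>\<^esub> = GB.mono \<one>\<^bsub>R\<^esub> \<one>\<^bsub>Aut_C C s\<^esub>" "\<zero>\<^bsub>\<Lambda>\<^esub> = (\<lambda>x\<in>auts s. \<zero>\<^bsub>R\<^esub>)"
  "f \<oplus>\<^bsub>\<Lambda>\<^esub> g = (\<lambda>x\<in>auts s. f x \<oplus>\<^bsub>R\<^esub> g x)"
  using GB.BA_simps(2-4)[unfolded \<Lambda>_eq] by blast+

abbreviation \<sigma> where "\<sigma> \<equiv> aut_embed C R s"

lemma gm_Mor: "\<alpha> \<in> auts s \<Longrightarrow> gm \<alpha> \<in> Mor C"
  using gm_local_basis local_basis_Mor by blast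

lemma \<sigma>_eq: "\<sigma> f = (\<Oplus>\<^bsub>A\<^esub>\<alpha>\<in>auts s. mono (f \<alpha> \<otimes>\<^bsub>R\<^esub> idx) (gm \<alpha>))"
  by (simp add: aut_embed_def)

lemma \<sigma>_closed:
  assumes "f \<in> carrier \<Lambda>"
  shows "\<sigma> f \<in> carrier A"
  unfolding \<sigma>_eq using assms by (intro A.finsum_closed) (auto simp: \<Lambda>_carrier intro!: mono_carrier)

lemma \<sigma>_apply:
  assumes f: "f \<in> carrier \<Lambda>" and z: "z \<in> Mor C"
  shows "\<sigma> f z = (\<Oplus>\<^bsub>R\<^esub>\<alpha>\<in>auts s. if gm \<alpha> = z then f \<alpha> \<otimes>\<^bsub>R\<^esub> idx else \<zero>\<^bsub>R\<^esub>)"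
proof -
  have fc: "f \<alpha> \<in> carrier R" if "\<alpha> \<in> auts s" for \<alpha> using f that by (auto simp: \<Lambda>_carrier)
  have "\<sigma> f z = (\<Oplus>\<^bsub>R\<^esub>\<alpha>\<in>auts s. mono (f \<alpha> \<otimes>\<^bsub>R\<^esub> idx) (gm \<alpha>) z)"
    unfolding \<sigma>_eq by (rule A_finsum_apply[OF finite_auts _ z]) (auto intro!: mono_carrier simp: fc)
  also have "\<dots> = (\<Oplus>\<^bsub>R\<^esub>\<alpha>\<in>auts s. if gm \<alpha> = z then f \<alpha> \<otimes>\<^bsub>R\<^esub> idx else \<zero>\<^bsub>R\<^esub>)"
    by (rule R.finsum_cong') (use fc z in \<open>auto simp: monomial_def\<close>)
  finally show ?thesis .
qed

lemma \<sigma>_gm: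
  assumes f: "f \<in> carrier \<Lambda>" and \<beta>: "\<beta> \<in> auts s"
  shows "\<sigma> f (gm \<beta>) = f \<beta> \<otimes>\<^bsub>R\<^esub> idx"
proof -
  have "f \<beta> \<in> carrier R" using f \<beta> by (auto simp: \<Lambda>_carrier)
  then have "(\<Oplus>\<^bsub>R\<^esub>\<alpha>\<in>auts s. if gm \<alpha> = gm \<beta> then f \<alpha> \<otimes>\<^bsub>R\<^esub> idx else \<zero>\<^bsub>R\<^esub>) =
      (if \<beta> \<in> auts s then f \<beta> \<otimes>\<^bsub>R\<^esub> idx else \<zero>\<^bsub>R\<^esub>)"
    by (intro BP.single_term) (use finite_auts gm_inj \<beta> in \<open>auto dest: inj_onD\<close>)
  then show ?thesis using \<sigma>_apply[OF f gm_Mor[OF \<beta>]] \<beta> by simp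
qed

lemma \<sigma>_outside:
  assumes f: "f \<in> carrier \<Lambda>" and z: "z \<in> Mor C" "z \<notin> gm ` auts s"
  shows "\<sigma> f z = \<zero>\<^bsub>R\<^esub>"
  unfolding \<sigma>_apply[OF f z(1)] using z(2) by (auto intro!: R.add.finprod_one_eqI)

lemma \<sigma>_in_corner:
  assumes "f \<in> carrier \<Lambda>"
  shows "\<sigma> f \<in> carrier B"
proof -
  have "z \<in> gm ` auts s" if "z \<in> Mor C" "\<sigma> f z \<noteq> \<zero>\<^bsub>R\<^esub>" for z using \<sigma>_outside[OF assms] that by blast
  then show ?thesis
    using \<sigma>_closed[OF assms] gm_local_basis unfolding corner_span basis_span_def A_carrier by blast
qed

text \<open>The coefficients at \<open>\<Gamma>\<^sub>e\<close>, rescaled: the composite of the projection with the inverse of \<open>\<sigma>\<close>.\<close>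

definition \<theta> where
  "\<theta> x = (\<lambda>\<alpha>\<in>auts s. x (gm \<alpha>) \<otimes>\<^bsub>R\<^esub> inv\<^bsub>R\<^esub> idx)"

lemma \<theta>_closed:
  assumes "x \<in> carrier A"
  shows "\<theta> x \<in> carrier \<Lambda>"
  using assms gm_Mor idx_Units by (auto simp: \<theta>_def \<Lambda>_carrier A_carrier)

lemma \<theta>_\<sigma>: "f \<in> carrier \<Lambda> \<Longrightarrow> \<theta> (\<sigma> f) = f"
proof (rule extensionalityI[of _ "auts s"])
  fix \<alpha> assume f: "f \<in> carrier \<Lambda>" and \<alpha>: "\<alpha> \<in> auts s"
  then have "f \<alpha> \<in> carrier R" by (auto simp: \<Lambda>_carrier)
  then show "\<theta> (\<sigma> f) \<alpha> = f \<alpha>" using \<sigma>_gm[OF f \<alpha>] \<alpha> idx_cancel(4) by (simp add: \<theta>_def)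
qed (auto simp: \<theta>_def \<Lambda>_carrier PiE_def)

lemma \<sigma>_\<theta>:
  assumes x: "x \<in> carrier A"
  shows "\<sigma> (\<theta> x) = (\<lambda>z\<in>Mor C. if z \<in> Gamma C s then x z else \<zero>\<^bsub>R\<^esub>)"
proof (rule extensionalityI[of _ "Mor C"])
  fix z assume z: "z \<in> Mor C"
  show "\<sigma> (\<theta> x) z = (\<lambda>z\<in>Mor C. if z \<in> Gamma C s then x z else \<zero>\<^bsub>R\<^esub>) z"
  proof (cases "z \<in> gm ` auts s")
    case True
    then obtain \<alpha> where \<alpha>: "\<alpha> \<in> auts s" "z = gm \<alpha>" by blast
    have "x z \<in> carrier R" using x z by (auto simp: A_carrier)
    then have "x z \<otimes>\<^bsub>R\<^esub> inv\<^bsub>R\<^esub> idx \<otimes>\<^bsub>R\<^esub> idx = x z" by (rule idx_cancel)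
    then show ?thesis using \<sigma>_gm[OF \<theta>_closed[OF x] \<alpha>(1)] \<alpha> z True by (simp add: \<theta>_def Gamma_eq)
  next
    case False
    then show ?thesis using \<sigma>_outside[OF \<theta>_closed[OF x] z False] z by (simp add: Gamma_eq)
  qed
qed (use \<sigma>_closed[OF \<theta>_closed[OF x]] in \<open>auto simp: A_carrier PiE_def\<close>)

lemma corner_decomposition:
  assumes x: "x \<in> carrier B"
  obtains j where "j \<in> basis_span R (Mor C) (J_set C s)" "x = \<sigma> (\<theta> x) \<oplus>\<^bsub>A\<^esub> j"
proof (rule that)
  let ?j = "\<lambda>z\<in>Mor C. if z \<in> J_set C s then x z else \<zero>\<^bsub>R\<^esub>"
  have xA: "x \<in> carrier A" using x by (simp add: corner_carrier)
  then show "?j \<in> basis_span R (Mor C) (J_set C s)" by (auto simp: basis_span_def A_carrier)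
  then have "\<sigma> (\<theta> x) \<oplus>\<^bsub>A\<^esub> ?j \<in> carrier A" using \<sigma>_closed[OF \<theta>_closed[OF xA]] span_carrier by simp
  then show "x = \<sigma> (\<theta> x) \<oplus>\<^bsub>A\<^esub> ?j"
  proof (intro extensionalityI[of x "Mor C"])
    fix z assume z: "z \<in> Mor C"
    have xz: "x z \<in> carrier R" using xA z by (auto simp: A_carrier)
    have "x z = \<zero>\<^bsub>R\<^esub>" if "z \<notin> local_basis" using x z that by (simp add: corner_span basis_span_def)
    then show "x z = (\<sigma> (\<theta> x) \<oplus>\<^bsub>A\<^esub> ?j) z"
      using z xz local_basis_split by (auto simp: A_add_apply \<sigma>_\<theta>[OF xA])
  qed (use xA in \<open>auto simp: A_carrier PiE_def\<close>)
qed

lemma Gamma_proj_eq: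
  assumes x: "x \<in> carrier B"
  shows "Gamma_proj C R s x = \<sigma> (\<theta> x)"
  unfolding Gamma_proj_def
proof (rule the_equality)
  have xA: "x \<in> carrier A" using x by (simp add: corner_carrier)
  obtain j where j: "j \<in> basis_span R (Mor C) (J_set C s)" "x = \<sigma> (\<theta> x) \<oplus>\<^bsub>A\<^esub> j"
    using corner_decomposition[OF x] .
  have "\<sigma> (\<theta> x) \<in> basis_span R (Mor C) (Gamma C s)"
    using \<sigma>_closed[OF \<theta>_closed[OF xA]] unfolding basis_span_def A_carrier by (auto simp: \<sigma>_\<theta>[OF xA])
  then show "\<sigma> (\<theta> x) \<in> basis_span R (Mor C) (Gamma C s) \<and>
    (\<exists>j\<in>basis_span R (Mor C) (J_set C s). x = \<sigma> (\<theta> x) \<oplus>\<^bsub>A\<^esub> j)" using j by blast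
  fix y assume "y \<in> basis_span R (Mor C) (Gamma C s) \<and> (\<exists>j\<in>basis_span R (Mor C) (J_set C s). x = y \<oplus>\<^bsub>A\<^esub> j)"
  then obtain j' where y: "y \<in> basis_span R (Mor C) (Gamma C s)" and
    j': "j' \<in> basis_span R (Mor C) (J_set C s)" "x = y \<oplus>\<^bsub>A\<^esub> j'" by blast
  have yz: "y z = (if z \<in> Gamma C s then x z else \<zero>\<^bsub>R\<^esub>)" if z: "z \<in> Mor C" for z
  proof (cases "z \<in> Gamma C s")
    case True
    then have "j' z = \<zero>\<^bsub>R\<^esub>" "y z \<in> carrier R"
      using local_basis_split(2) j'(1) y z by (auto simp: basis_span_def)
    then show ?thesis using True z j'(2) by (simp add: A_add_apply)
  next
    case False
    then show ?thesis using y z by (simp add: basis_span_def)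
  qed
  show "y = \<sigma> (\<theta> x)"
    unfolding \<sigma>_\<theta>[OF xA]
    by (rule extensionalityI[of _ "Mor C"]) (use y yz in \<open>auto simp: basis_span_def PiE_def\<close>)
qed

abbreviation \<rho> where
  "\<rho> b \<equiv> inv_into (carrier \<Lambda>) \<sigma> (Gamma_proj C R s b)"

lemma \<rho>_eq: "b \<in> carrier B \<Longrightarrow> \<rho> b = \<theta> b"
proof -
  assume b: "b \<in> carrier B"
  have "inj_on \<sigma> (carrier \<Lambda>)" by (rule inj_on_inverseI[of _ \<theta>]) (rule \<theta>_\<sigma>)
  then show ?thesis
    using b \<theta>_closed[of b] by (simp add: Gamma_proj_eq corner_carrier)
qed

lemma inflation_eq: "inflation C R s T = pullback (\<lambda>b. \<rho> b) T"
  by (simp add: inflation_def pullback_def)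

lemma \<theta>_mono_gm:
  assumes "r \<in> carrier R" "\<alpha> \<in> auts s"
  shows "\<theta> (mono r (gm \<alpha>)) = GB.mono (r \<otimes>\<^bsub>R\<^esub> inv\<^bsub>R\<^esub> idx) \<alpha>"
proof (rule extensionalityI[of _ "auts s"])
  fix \<beta> assume \<beta>: "\<beta> \<in> auts s"
  have "gm \<beta> = gm \<alpha> \<longleftrightarrow> \<beta> = \<alpha>" using gm_inj \<beta> assms(2) inj_on_eq_iff[OF gm_inj] by blast
  then show "\<theta> (mono r (gm \<alpha>)) \<beta> = GB.mono (r \<otimes>\<^bsub>R\<^esub> inv\<^bsub>R\<^esub> idx) \<alpha> \<beta>"
    using \<beta> gm_Mor[OF \<beta>] idx_Units by (auto simp: \<theta>_def monomial_def)
qed (auto simp: \<theta>_def monomial_def)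

lemma \<theta>_mono_outside:
  assumes "x \<notin> gm ` auts s"
  shows "\<theta> (mono r x) = \<zero>\<^bsub>\<Lambda>\<^esub>"
proof -
  have "\<theta> (mono r x) \<alpha> = \<zero>\<^bsub>\<Lambda>\<^esub> \<alpha>" for \<alpha>
  proof (cases "\<alpha> \<in> auts s")
    case True
    then have "gm \<alpha> \<noteq> x" using assms by blast
    then show ?thesis using True gm_Mor[OF True] idx_Units by (simp add: \<Lambda>_simps \<theta>_def monomial_def)
  qed (simp add: \<Lambda>_simps \<theta>_def)
  then show ?thesis by blast
qed

lemma \<theta>_add:
  assumes "x \<in> carrier A" "y \<in> carrier A"
  shows "\<theta> (x \<oplus>\<^bsub>A\<^esub> y) = \<theta> x \<oplus>\<^bsub>\<Lambda>\<^esub> \<theta> y"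
proof (rule extensionalityI[of _ "auts s"])
  fix \<alpha> assume \<alpha>: "\<alpha> \<in> auts s"
  then have "x (gm \<alpha>) \<in> carrier R" "y (gm \<alpha>) \<in> carrier R" using assms gm_Mor by (auto simp: A_carrier)
  then show "\<theta> (x \<oplus>\<^bsub>A\<^esub> y) \<alpha> = (\<theta> x \<oplus>\<^bsub>\<Lambda>\<^esub> \<theta> y) \<alpha>"
    using \<alpha> gm_Mor[OF \<alpha>] idx_Units by (simp add: \<theta>_def \<Lambda>_simps A_add_apply R.l_distr)
qed (auto simp: \<theta>_def \<Lambda>_simps)

lemma J_set_iff: "(G1, L, G2) \<in> J_set C s \<longleftrightarrow> (G1, L, G2) \<in> local_basis \<and> rank G L < srank s"
  by (simp add: J_set_eq)

lemma J_not_gm: "x \<in> J_set C s \<Longrightarrow> x \<notin> gm ` auts s"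
  using local_basis_split Gamma_eq by blast

text \<open>Ranks do not increase under composition; so \<open>J\<^sub>e\<close> spans an ideal of \<open>e'Ae'\<close>.\<close>

lemma J_ideal:
  assumes L: "(G, L, G) \<in> local_basis" and M: "(G, M, G) \<in> local_basis"
    and J: "(G, L, G) \<in> J_set C s \<or> (G, M, G) \<in> J_set C s"
  shows "(G, L O M, G) \<in> J_set C s"
proof -
  have LM: "(G, L O M, G) \<in> local_basis" by (rule local_basis_comp[OF L M])
  have p: "prod_subgroup G G L" "prod_subgroup G G M" "prod_subgroup G G (L O M)"
    using MorD(4) local_basis_Mor L M LM by blast+
  have "rank G (L O M) < srank s"
    using J rank_comp_left[OF p] rank_comp_right[OF p] by (auto simp: J_set_iff)
  then show ?thesis using LM by (simp add: J_set_iff)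
qed

lemma \<theta>_mult:
  assumes "x \<in> carrier B" "y \<in> carrier B"
  shows "\<theta> (x \<otimes>\<^bsub>A\<^esub> y) = \<theta> x \<otimes>\<^bsub>\<Lambda>\<^esub> \<theta> y"
  unfolding BA_eq_A[symmetric]
proof (rule TB.additive_mult_on_span[where Y = local_basis])
  interpret \<Lambda>: ring \<Lambda> by (rule ring_\<Lambda>)
  show "ring \<Lambda>" by (rule ring_\<Lambda>)
  show "x \<in> basis_span R (Mor C) local_basis" "y \<in> basis_span R (Mor C) local_basis"
    using assms by (simp_all add: corner_span)
  show "comp_mor x y \<in> local_basis" if "x \<in> local_basis" "y \<in> local_basis" for x y
    using that local_basis_comp by (cases x, cases y) (auto simp: comp_mor_def local_basis_iff)
  show "\<theta> f \<in> carrier \<Lambda>" if "f \<in> basis_span R (Mor C) local_basis" for f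
    using \<theta>_closed span_carrier that by blast
  show "\<theta> (f \<oplus>\<^bsub>BP.BA\<^esub> g) = \<theta> f \<oplus>\<^bsub>\<Lambda>\<^esub> \<theta> g"
    if "f \<in> basis_span R (Mor C) local_basis" "g \<in> basis_span R (Mor C) local_basis" for f g
    using \<theta>_add span_carrier that by (simp only: BA_eq_A)
  fix r t x y
  assume r: "r \<in> carrier R" "t \<in> carrier R" and xy: "x \<in> local_basis" "y \<in> local_basis"
  obtain L M where LM: "x = (G, L, G)" "y = (G, M, G)" using xy by (auto simp: local_basis_def)
  have xyM: "(G, L, G) \<in> Mor C" "(G, M, G) \<in> Mor C" using xy LM local_basis_Mor by auto
  note prod = mono_mult_A[OF r xyM]
  show "\<theta> (mono r x \<otimes>\<^bsub>BP.BA\<^esub> mono t y) = \<theta> (mono r x) \<otimes>\<^bsub>\<Lambda>\<^esub> \<theta> (mono t y)"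
  proof (cases "x \<in> J_set C s \<or> y \<in> J_set C s")
    case True
    then have "(G, L O M, G) \<in> J_set C s" using J_ideal xy LM by blast
    then have "\<theta> (mono r x \<otimes>\<^bsub>A\<^esub> mono t y) = \<zero>\<^bsub>\<Lambda>\<^esub>"
      unfolding LM prod by (rule \<theta>_mono_outside[OF J_not_gm])
    moreover have "\<theta> (mono r x) = \<zero>\<^bsub>\<Lambda>\<^esub> \<or> \<theta> (mono t y) = \<zero>\<^bsub>\<Lambda>\<^esub>"
      using True \<theta>_mono_outside J_not_gm by blast
    moreover have "\<theta> (mono r x) \<in> carrier \<Lambda>" "\<theta> (mono t y) \<in> carrier \<Lambda>"
      using \<theta>_closed mono_carrier r by auto
    ultimately show ?thesis by (auto simp: BA_eq_A)
  next
    case False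
    then obtain \<alpha> \<beta> where ab: "\<alpha> \<in> auts s" "x = gm \<alpha>" "\<beta> \<in> auts s" "y = gm \<beta>"
      using local_basis_cases xy by metis
    let ?i = "inv\<^bsub>R\<^esub> idx"
    have i: "?i \<in> carrier R" using idx_Units by simp
    have eM: "M = goursat G G P K \<beta> P K" and eL: "L = goursat G G P K \<alpha> P K" using ab LM by auto
    have "e O M = M" "(G, M, G) \<in> Mor C" "(G, L, G) \<in> Mor C" "L O e = L" using xy LM xyM by (auto simp: local_basis_iff)
    then have K: "K \<subseteq> k1 G M" "K \<subseteq> k2 G L" using e_comp comp_e by auto
    have "k2 G L \<inter> k1 G M = K"
      using goursat_sections[OF Ob_group(1)[OF Ob_G] Ob_group(1)[OF Ob_G] sec sec autoD(1)] ab
      unfolding eM eL by (auto simp: auts_iff)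
    then have k: "kappa R (G, L, G) (G, M, G) = ?i" by (simp add: kappa_eq idx_inv)
    have "\<theta> (mono r x \<otimes>\<^bsub>A\<^esub> mono t y) = \<theta> (mono (?i \<otimes>\<^bsub>R\<^esub> (r \<otimes>\<^bsub>R\<^esub> t)) (gm (\<alpha> \<otimes>\<^bsub>Aut_C C s\<^esub> \<beta>)))"
      unfolding LM prod k using gm_comp[OF ab(1,3)] eL eM by simp
    also have "\<dots> = GB.mono (?i \<otimes>\<^bsub>R\<^esub> (r \<otimes>\<^bsub>R\<^esub> t) \<otimes>\<^bsub>R\<^esub> ?i) (\<alpha> \<otimes>\<^bsub>Aut_C C s\<^esub> \<beta>)"
      by (rule \<theta>_mono_gm) (use r i ab in auto)
    also have "\<dots> = GB.mono (r \<otimes>\<^bsub>R\<^esub> ?i) \<alpha> \<otimes>\<^bsub>\<Lambda>\<^esub> GB.mono (t \<otimes>\<^bsub>R\<^esub> ?i) \<beta>"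
      using GB.mono_mult[of "r \<otimes>\<^bsub>R\<^esub> ?i" "t \<otimes>\<^bsub>R\<^esub> ?i" \<alpha> \<beta>, unfolded \<Lambda>_eq] r i ab by (simp add: R.m_ac)
    also have "\<dots> = \<theta> (mono r x) \<otimes>\<^bsub>\<Lambda>\<^esub> \<theta> (mono t y)" using \<theta>_mono_gm r ab by simp
    finally show ?thesis by (simp add: BA_eq_A)
  qed
qed

lemma \<theta>_one: "\<theta> e' = \<one>\<^bsub>\<Lambda>\<^esub>"
proof -
  have "e' = mono idx (gm \<one>\<^bsub>Aut_C C s\<^esub>)" by (simp add: e'_eq gm_one)
  then have "\<theta> e' = GB.mono (idx \<otimes>\<^bsub>R\<^esub> inv\<^bsub>R\<^esub> idx) \<one>\<^bsub>Aut_C C s\<^esub>" using \<theta>_mono_gm[of idx] by simp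
  then show ?thesis using idx_Units by (simp add: \<Lambda>_simps)
qed

lemma \<rho>_ring_hom: "(\<lambda>b. \<rho> b) \<in> ring_hom B \<Lambda>"
proof (rule ring_hom_memI)
  interpret Bc: ring B by (rule ring_corner)
  have c: "b \<in> carrier A" if "b \<in> carrier B" for b using that by (simp add: corner_carrier)
  show "\<rho> b \<in> carrier \<Lambda>" if "b \<in> carrier B" for b using that \<rho>_eq \<theta>_closed c by simp
  show "\<rho> (x \<otimes>\<^bsub>B\<^esub> y) = \<rho> x \<otimes>\<^bsub>\<Lambda>\<^esub> \<rho> y" if "x \<in> carrier B" "y \<in> carrier B" for x y
    using that \<theta>_mult[OF that] Bc.m_closed[OF that] by (simp add: \<rho>_eq)
  show "\<rho> (x \<oplus>\<^bsub>B\<^esub> y) = \<rho> x \<oplus>\<^bsub>\<Lambda>\<^esub> \<rho> y" if "x \<in> carrier B" "y \<in> carrier B" for x y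
    using that \<theta>_add[OF c[OF that(1)] c[OF that(2)]] Bc.a_closed[OF that] by (simp add: \<rho>_eq)
  show "\<rho> \<one>\<^bsub>B\<^esub> = \<one>\<^bsub>\<Lambda>\<^esub>" using \<theta>_one by (simp add: \<rho>_eq)
qed

lemma \<rho>_\<sigma>: "f \<in> carrier \<Lambda> \<Longrightarrow> \<rho> (\<sigma> f) = f"
  using \<rho>_eq[OF \<sigma>_in_corner] \<theta>_\<sigma> by simp

lemma \<rho>_surj: "(\<lambda>b. \<rho> b) ` carrier B = carrier \<Lambda>"
proof (intro subset_antisym subsetI)
  fix f assume "f \<in> carrier \<Lambda>"
  then show "f \<in> (\<lambda>b. \<rho> b) ` carrier B" using \<rho>_\<sigma> \<sigma>_in_corner by (intro image_eqI[of _ _ "\<sigma> f"]) auto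
qed (use ring_hom_closed[OF \<rho>_ring_hom] in auto)

lemma simple_inflation: "simple_module \<Lambda> T \<Longrightarrow> simple_module B (inflation C R s T)"
  unfolding inflation_eq by (rule simple_module_pullback[OF _ ring_corner \<rho>_ring_hom \<rho>_surj])

lemma inflation_iso_iff: "module_iso B (inflation C R s T) (inflation C R s T') \<longleftrightarrow> module_iso \<Lambda> T T'"
  unfolding inflation_eq by (rule module_iso_pullback_iff[OF \<rho>_surj])

lemma \<rho>_J:
  assumes "r \<in> carrier R" "x \<in> J_set C s"
  shows "\<rho> (mono r x) = \<zero>\<^bsub>\<Lambda>\<^esub>"
proof -
  have "mono r x \<in> carrier B"
    using BP.mono_in_basis_span[OF assms(1), of x local_basis] assms(2) local_basis_split corner_span by auto
  then show ?thesis using \<theta>_mono_outside[OF J_not_gm[OF assms(2)]] \<rho>_eq by simp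
qed

text \<open>By the decomposition \<open>e'Ae' = R\<Gamma>\<^sub>e \<oplus> RJ\<^sub>e\<close>, such a module only depends on the action of \<open>R\<Gamma>\<^sub>e\<close>.\<close>

lemma inflated_if_J_zero:
  fixes U :: "('g morphism \<Rightarrow> 'r, 'm) module"
  assumes U: "simple_module B U"
    and J: "\<And>j u. j \<in> basis_span R (Mor C) (J_set C s) \<Longrightarrow> u \<in> carrier U \<Longrightarrow> j \<odot>\<^bsub>U\<^esub> u = \<zero>\<^bsub>U\<^esub>"
  obtains T :: "(('g set \<Rightarrow> 'g set) \<Rightarrow> 'r, 'm) module"
  where "simple_module \<Lambda> T" "module_iso B U (inflation C R s T)"
proof -
  interpret U: left_module B U by (rule simple_moduleD(1)[OF U])
  have act: "b \<odot>\<^bsub>U\<^esub> u = \<sigma> (\<rho> b) \<odot>\<^bsub>U\<^esub> u" if bu: "b \<in> carrier B" "u \<in> carrier U" for b u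
  proof -
    obtain j where j: "j \<in> basis_span R (Mor C) (J_set C s)" "b = \<sigma> (\<theta> b) \<oplus>\<^bsub>A\<^esub> j"
      using corner_decomposition[OF bu(1)] .
    have "b \<in> carrier A" using bu(1) by (simp add: corner_carrier)
    then have 1: "\<sigma> (\<theta> b) \<in> carrier B" using \<sigma>_in_corner \<theta>_closed by blast
    have "basis_span R (Mor C) (J_set C s) \<subseteq> basis_span R (Mor C) local_basis"
      using local_basis_split unfolding basis_span_def by blast
    then have 2: "j \<in> carrier B" using j(1) corner_span by blast
    have "b \<odot>\<^bsub>U\<^esub> u = \<sigma> (\<theta> b) \<odot>\<^bsub>U\<^esub> u \<oplus>\<^bsub>U\<^esub> j \<odot>\<^bsub>U\<^esub> u"
      using U.smult_l_distr[OF 1 2 bu(2)] j(2) by simp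
    then show ?thesis using J[OF j(1) bu(2)] 1 bu \<rho>_eq by simp
  qed
  have "simple_module \<Lambda> (pullback \<sigma> U)"
    by (rule module_descends(2)[where \<rho> = "\<lambda>b. \<rho> b", OF U.left_module_axioms ring_\<Lambda> \<rho>_ring_hom _ _ _ U])
      (rule \<sigma>_in_corner \<rho>_\<sigma> act, assumption+)+
  moreover have "module_iso B U (pullback (\<lambda>b. \<rho> b) (pullback \<sigma> U))"
    by (rule module_descends(3)[OF U.left_module_axioms ring_\<Lambda> \<rho>_ring_hom])
      (rule \<sigma>_in_corner \<rho>_\<sigma> act, assumption+)+
  ultimately show thesis by (intro that) (simp_all only: inflation_eq)
qed

lemma head_module_eq: "head_module C R s T =
    Hd A (tensor B (left_ideal_module A e') (mult A) (inflation C R s T))"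
  by (simp add: head_module_def Let_def)

lemma simple_head_module:
  assumes "simple_module \<Lambda> T"
  shows "simple_module A (head_module C R s T)"
    and "module_iso B (inflation C R s T) (corner_module A e' (head_module C R s T))"
  using simple_head_tensor[OF simple_inflation[OF assms]] unfolding head_module_eq by blast+

end

section \<open>The apex of a simple module\<close>

context star_category
begin

definition kills :: "('g morphism \<Rightarrow> 'r, 'm) module \<Rightarrow> 'g morphism \<Rightarrow> bool" where
  "kills V x \<longleftrightarrow> (\<forall>r\<in>carrier R. \<forall>v\<in>carrier V. mono r x \<odot>\<^bsub>V\<^esub> v = \<zero>\<^bsub>V\<^esub>)"

definition e_mor :: "'g monoid \<times> 'g set \<times> 'g set \<Rightarrow> 'g morphism" where
  "e_mor = (\<lambda>(G, P, K). (G, e_sec G P K, G))"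

text \<open>
  The last condition says that the section \<open>s\<close> has the least possible order; it is stated for arbitrary morphisms
  because an \<open>L\<close> that acts nontrivially is \<open>e * L\<close> for the idempotent \<open>e\<close> of a section of order \<open>|q(L)|\<close>.
\<close>

definition apex :: "('g morphism \<Rightarrow> 'r, 'm) module \<Rightarrow> 'g monoid \<times> 'g set \<times> 'g set \<Rightarrow> bool" where
  "apex V s \<longleftrightarrow> s \<in> C_sections C \<and> \<not> kills V (e_mor s) \<and>
    (\<forall>G L H. (G, L, H) \<in> Mor C \<longrightarrow> rank H L < srank s \<longrightarrow> kills V (G, L, H))"

lemma kills_span:
  assumes V: "left_module A V" and Y: "\<And>x. x \<in> Mor C \<Longrightarrow> x \<in> Y \<Longrightarrow> kills V x"
    and f: "f \<in> basis_span R (Mor C) Y" and v: "v \<in> carrier V"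
  shows "f \<odot>\<^bsub>V\<^esub> v = \<zero>\<^bsub>V\<^esub>"
proof -
  interpret V: left_module A V by fact
  show ?thesis using f
  proof (induction rule: BP.basis_span_induct)
    case zero
    then show ?case unfolding BA_eq_A using v by simp
  next
    case (mono r x)
    then show ?case using Y v by (simp add: kills_def)
  next
    case (add f g)
    then show ?case unfolding BA_eq_A using v V.smult_l_distr[OF span_carrier[OF add(1)] span_carrier[OF add(2)] v]
      by simp
  qed
qed

text \<open>
  Up to the unit \<open>\<kappa>(L, M)\<close>, composition of morphisms is multiplication in \<open>A\<close>.
\<close>

lemma mono_comp:
  assumes "(G, L, H) \<in> Mor C" "(H, M, K) \<in> Mor C" "r \<in> carrier R"
  obtains r' where "r' \<in> carrier R"
    "mono r (G, L O M, K) = mono r' (G, L, H) \<otimes>\<^bsub>A\<^esub> mono \<one>\<^bsub>R\<^esub> (H, M, K)"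
proof -
  let ?k = "kappa R (G, L, H) (H, M, K)"
  have k: "?k \<in> Units R" by (rule kappa_Units[OF assms(1,2)])
  have "?k \<otimes>\<^bsub>R\<^esub> (inv\<^bsub>R\<^esub> ?k \<otimes>\<^bsub>R\<^esub> r) = r"
    using k assms(3) R.m_assoc[of ?k "inv\<^bsub>R\<^esub> ?k" r] by (simp add: R.Units_closed)
  then show thesis
    using mono_mult_A[of "inv\<^bsub>R\<^esub> ?k \<otimes>\<^bsub>R\<^esub> r" "\<one>\<^bsub>R\<^esub>", OF _ _ assms(1,2)] k assms(3)
    by (intro that[of "inv\<^bsub>R\<^esub> ?k \<otimes>\<^bsub>R\<^esub> r"]) simp_all
qed

lemma kills_comp:
  assumes V: "left_module A V" and L: "(G, L, H) \<in> Mor C" and M: "(H, M, K) \<in> Mor C"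
    and "kills V (G, L, H) \<or> kills V (H, M, K)"
  shows "kills V (G, L O M, K)"
  unfolding kills_def
proof (intro ballI)
  interpret V: left_module A V by fact
  fix r v assume r: "r \<in> carrier R" and v: "v \<in> carrier V"
  obtain r' where r': "r' \<in> carrier R"
    "mono r (G, L O M, K) = mono r' (G, L, H) \<otimes>\<^bsub>A\<^esub> mono \<one>\<^bsub>R\<^esub> (H, M, K)"
    using mono_comp[OF L M r] .
  have c: "mono r' (G, L, H) \<in> carrier A" "mono \<one>\<^bsub>R\<^esub> (H, M, K) \<in> carrier A"
    using r' by (auto intro!: mono_carrier)
  then have "mono r (G, L O M, K) \<odot>\<^bsub>V\<^esub> v = mono r' (G, L, H) \<odot>\<^bsub>V\<^esub> (mono \<one>\<^bsub>R\<^esub> (H, M, K) \<odot>\<^bsub>V\<^esub> v)"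
    using r' v by (simp add: V.smult_assoc)
  then show "mono r (G, L O M, K) \<odot>\<^bsub>V\<^esub> v = \<zero>\<^bsub>V\<^esub>"
    using assms(4) c r' v by (auto simp: kills_def)
qed

lemma kills_iso:
  assumes "left_module A V" "left_module A W" "module_iso A V W"
  shows "kills V x \<longleftrightarrow> kills W x"
proof -
  interpret V: left_module A V by fact
  obtain f where f: "module_bij f A V W" using assms(3) by (auto simp: module_iso_iff_bij)
  note f = module_bijD[OF f]
  have f0: "f \<zero>\<^bsub>V\<^esub> = \<zero>\<^bsub>W\<^esub>" by (rule module_iso_zero[OF assms(1,2) f(1,2)])
  have W: "carrier W = f ` carrier V" using f(1) by (simp add: bij_betw_def)
  have "mono r x \<odot>\<^bsub>V\<^esub> v = \<zero>\<^bsub>V\<^esub> \<longleftrightarrow> mono r x \<odot>\<^bsub>W\<^esub> f v = \<zero>\<^bsub>W\<^esub>" if "r \<in> carrier R" "v \<in> carrier V" for r v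
  proof -
    have c: "mono r x \<in> carrier A" by (rule mono_carrier[OF that(1)])
    have "mono r x \<odot>\<^bsub>V\<^esub> v = \<zero>\<^bsub>V\<^esub> \<longleftrightarrow> f (mono r x \<odot>\<^bsub>V\<^esub> v) = f \<zero>\<^bsub>V\<^esub>"
      using f(1) that c by (auto simp: bij_betw_def inj_on_eq_iff)
    then show ?thesis using f(3)[OF c that(2)] f0 by simp
  qed
  then show ?thesis unfolding kills_def W by simp
qed

lemma apex_iso:
  assumes "left_module A V" "left_module A W" "module_iso A V W"
  shows "apex V s \<longleftrightarrow> apex W s"
  unfolding apex_def using kills_iso[OF assms] by simp

lemma e_sec_Mor:
  assumes "(G, P, K) \<in> C_sections C"
  shows "(G, e_sec G P K, G) \<in> Mor C"
  using assms by (auto simp: C_sections_def Mor_def)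

text \<open>
  The apex is \<open>(p\<^sub>1(L), k\<^sub>1(L))\<close> for a morphism \<open>L\<close> of least rank among those that do not annihilate \<open>V\<close>.
\<close>

lemma apex_exists:
  fixes V :: "('g morphism \<Rightarrow> 'r, 'm) module"
  assumes V: "simple_module A V"
  shows "\<exists>s. apex V s"
proof -
  interpret V: left_module A V by (rule simple_moduleD(1)[OF V])
  have "\<exists>x\<in>Mor C. \<not> kills V x"
  proof (rule ccontr)
    assume "\<not> (\<exists>x\<in>Mor C. \<not> kills V x)"
    then have "\<one>\<^bsub>A\<^esub> \<odot>\<^bsub>V\<^esub> v = \<zero>\<^bsub>V\<^esub>" if "v \<in> carrier V" for v
      using kills_span[OF V.left_module_axioms _ _ that, of "Mor C" "\<one>\<^bsub>A\<^esub>"] A.one_closed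
      unfolding carrier_A by blast
    then have "carrier V \<subseteq> {\<zero>\<^bsub>V\<^esub>}" by auto
    then show False using simple_moduleD(2)[OF V] V.M.zero_closed by blast
  qed
  then obtain x0 where "x0 \<in> Mor C \<and> \<not> kills V x0" by blast
  from ex_has_least_nat[of "\<lambda>x. x \<in> Mor C \<and> \<not> kills V x", OF this, of "\<lambda>(G, L, H). rank H L"]
  obtain x where x: "x \<in> Mor C" "\<not> kills V x"
    "\<And>y. y \<in> Mor C \<Longrightarrow> \<not> kills V y \<Longrightarrow> (\<lambda>(G, L, H). rank H L) x \<le> (\<lambda>(G, L, H). rank H L) y" by blast
  obtain G L H where xe: "x = (G, L, H)" by (cases x)
  have L: "(G, L, H) \<in> Mor C" using x(1) xe by simp
  interpret L: prod_subgroup G H L using MorD[OF L] by simp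
  let ?s = "(G, p1 L, k1 H L)"
  have s: "?s \<in> C_sections C" by (rule C_sections_p1_k1[OF L])
  have "\<not> kills V (e_mor ?s)"
    using kills_comp[OF V.left_module_axioms e_sec_Mor[OF s] L] x(2) xe L.e_sec_comp_self
    by (auto simp: e_mor_def)
  moreover have "kills V (G', L', H')" if "(G', L', H') \<in> Mor C" "rank H' L' < srank ?s" for G' L' H'
    using x(3)[OF that(1)] that(2) xe L.rank_eq by (auto simp: srank_def)
  ultimately show ?thesis using s unfolding apex_def by blast
qed

lemma C_section_locale:
  assumes "(G, P, K) \<in> C_sections C"
  shows "star_section \<O> C R G P K"
  using assms by (intro star_section.intro star_section_axioms.intro star_category_axioms)

lemma simple_generated:
  assumes V: "simple_module A V" and "v \<in> carrier V" "v \<noteq> \<zero>\<^bsub>V\<^esub>" and x: "\<not> kills V x"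
  obtains r a where "r \<in> carrier R" "a \<in> carrier A" "(mono r x \<otimes>\<^bsub>A\<^esub> a) \<odot>\<^bsub>V\<^esub> v \<noteq> \<zero>\<^bsub>V\<^esub>"
proof -
  interpret V: left_module A V by (rule simple_moduleD(1)[OF V])
  obtain r w where rw: "r \<in> carrier R" "w \<in> carrier V" "mono r x \<odot>\<^bsub>V\<^esub> w \<noteq> \<zero>\<^bsub>V\<^esub>"
    using x by (auto simp: kills_def)
  obtain a where a: "a \<in> carrier A" "w = a \<odot>\<^bsub>V\<^esub> v" using simple_module_cyclicE[OF V assms(2,3) rw(2)] .
  show thesis
    using rw a assms(2) mono_carrier[OF rw(1), of x] by (intro that[of r a]) (simp_all add: V.smult_assoc)
qed

end

context star_section
begin

lemma kills_e_iff:
  assumes "left_module A V"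
  shows "kills V (e_mor s) \<longleftrightarrow> (\<forall>v\<in>carrier V. e' \<odot>\<^bsub>V\<^esub> v = \<zero>\<^bsub>V\<^esub>)"
proof
  interpret V: left_module A V by fact
  show "\<forall>v\<in>carrier V. e' \<odot>\<^bsub>V\<^esub> v = \<zero>\<^bsub>V\<^esub>" if "kills V (e_mor s)"
    using that unfolding kills_def e'_eq by (simp add: e_mor_def)
  assume z: "\<forall>v\<in>carrier V. e' \<odot>\<^bsub>V\<^esub> v = \<zero>\<^bsub>V\<^esub>"
  show "kills V (e_mor s)"
    unfolding kills_def
  proof (intro ballI)
    fix r v assume rv: "r \<in> carrier R" "v \<in> carrier V"
    have c: "mono r (G, e, G) \<in> carrier A" by (rule mono_carrier[OF rv(1)])
    then have "mono r (G, e, G) \<odot>\<^bsub>V\<^esub> v = mono r (G, e, G) \<odot>\<^bsub>V\<^esub> (e' \<odot>\<^bsub>V\<^esub> v)"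
      using right_unit[OF rv(1) me_Mor e_e] V.smult_assoc[OF c e_closed rv(2)] by simp
    then show "mono r (e_mor s) \<odot>\<^bsub>V\<^esub> v = \<zero>\<^bsub>V\<^esub>" using z rv c by (simp add: e_mor_def)
  qed
qed

lemma apex_corner_nonzero:
  assumes "left_module A V" "apex V s"
  shows "\<exists>v\<in>carrier V. e' \<odot>\<^bsub>V\<^esub> v \<noteq> \<zero>\<^bsub>V\<^esub>"
  using assms(2) kills_e_iff[OF assms(1)] by (auto simp: apex_def)

lemma apex_J_zero:
  assumes V: "left_module A V" and "apex V s" and "j \<in> basis_span R (Mor C) (J_set C s)" "v \<in> carrier V"
  shows "j \<odot>\<^bsub>V\<^esub> v = \<zero>\<^bsub>V\<^esub>"
proof (rule kills_span[OF V _ assms(3,4)])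
  fix x assume "x \<in> Mor C" "x \<in> J_set C s"
  then show "kills V x" using assms(2) by (cases x) (auto simp: apex_def J_set_eq local_basis_iff)
qed

text \<open>
  The apex can be read off from \<open>e'V\<close>.  If a morphism of rank below that of \<open>s\<close> acted nontrivially on \<open>V\<close>, then
  moving \<open>e'V\<close> through it and back would give an element of \<open>e'Ae'\<close> that acts nontrivially and is a combination of
  elements of \<open>J\<^sub>e\<close>.
\<close>

lemma apexI:
  assumes V: "simple_module A V" and nz: "\<not> kills V (e_mor s)"
    and J: "\<And>x. x \<in> J_set C s \<Longrightarrow> kills V x"
  shows "apex V s"
  unfolding apex_def
proof (intro conjI allI impI C_section nz, rule ccontr)
  interpret V: left_module A V by (rule simple_moduleD(1)[OF V])
  fix G1 L H assume x: "(G1, L, H) \<in> Mor C" and r: "rank H L < srank s" and not: "\<not> kills V (G1, L, H)"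
  define Low where "Low = {(G2, M, H2). (G2, M, H2) \<in> Mor C \<and> rank H2 M < srank s}"
  obtain v where v: "v \<in> carrier V" "e' \<odot>\<^bsub>V\<^esub> v \<noteq> \<zero>\<^bsub>V\<^esub>" using nz kills_e_iff[OF V.left_module_axioms] by blast
  let ?w = "e' \<odot>\<^bsub>V\<^esub> v"
  have w: "?w \<in> carrier V" using v by simp
  obtain r a where ra: "r \<in> carrier R" "a \<in> carrier A" "(mono r (G1, L, H) \<otimes>\<^bsub>A\<^esub> a) \<odot>\<^bsub>V\<^esub> ?w \<noteq> \<zero>\<^bsub>V\<^esub>"
    using simple_generated[OF V w v(2) not] .
  have m: "mono r (G1, L, H) \<in> carrier A" by (rule mono_carrier[OF ra(1)])
  have "(mono r (G1, L, H) \<otimes>\<^bsub>A\<^esub> a) \<odot>\<^bsub>V\<^esub> ?w \<in> carrier V" using m ra(2) w by simp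
  from simple_module_cyclicE[OF V this ra(3) w]
  obtain b where b: "b \<in> carrier A" "?w = b \<odot>\<^bsub>V\<^esub> ((mono r (G1, L, H) \<otimes>\<^bsub>A\<^esub> a) \<odot>\<^bsub>V\<^esub> ?w)" .
  let ?c = "e' \<otimes>\<^bsub>A\<^esub> (b \<otimes>\<^bsub>A\<^esub> (mono r (G1, L, H) \<otimes>\<^bsub>A\<^esub> a)) \<otimes>\<^bsub>A\<^esub> e'"
  have low: "mono r (G1, L, H) \<in> basis_span R (Mor C) Low"
    using x r ra(1) \<open>rank H L < srank s\<close> by (intro BP.mono_in_basis_span) (auto simp: Low_def)
  have right: "f \<otimes>\<^bsub>A\<^esub> g \<in> basis_span R (Mor C) Low"
    if "f \<in> basis_span R (Mor C) Low" "g \<in> carrier A" for f g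
  proof (rule span_mult[OF that(1) that(2)[unfolded carrier_A]])
    fix G1 L H M K assume *: "(G1, L, H) \<in> Mor C" "(H, M, K) \<in> Mor C" "(G1, L, H) \<in> Low"
    then have "rank K (L O M) \<le> rank H L" using rank_comp_left MorD(4) comp_Mor by metis
    then show "(G1, L O M, K) \<in> Low" using * comp_Mor by (auto simp: Low_def)
  qed
  have left: "g \<otimes>\<^bsub>A\<^esub> f \<in> basis_span R (Mor C) Low"
    if "f \<in> basis_span R (Mor C) Low" "g \<in> carrier A" for f g
  proof (rule span_mult[OF that(2)[unfolded carrier_A] that(1)])
    fix G1 L H M K assume *: "(G1, L, H) \<in> Mor C" "(H, M, K) \<in> Mor C" "(H, M, K) \<in> Low"
    then have "rank K (L O M) \<le> rank K M" using rank_comp_right MorD(4) comp_Mor by metis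
    then show "(G1, L O M, K) \<in> Low" using * comp_Mor by (auto simp: Low_def)
  qed
  have "?c \<in> basis_span R (Mor C) Low"
    by (intro right[OF left[OF left[OF right[OF low]]]] ra b e_closed)
  moreover have "?c \<in> basis_span R (Mor C) local_basis"
    unfolding corner_span[symmetric] using b(1) m ra(2) by (intro cornerI) simp
  moreover have low_J: "x \<in> J_set C s" if "x \<in> Low" "x \<in> local_basis" for x
    using that by (cases x) (simp add: J_set_eq Low_def local_basis_iff)
  ultimately have "?c \<in> basis_span R (Mor C) (J_set C s)"
    unfolding basis_span_def using low_J by blast
  then have "?c \<odot>\<^bsub>V\<^esub> v = \<zero>\<^bsub>V\<^esub>" using kills_span[OF V.left_module_axioms J _ v(1)] by blast
  moreover have "?c \<odot>\<^bsub>V\<^esub> v = e' \<odot>\<^bsub>V\<^esub> (b \<odot>\<^bsub>V\<^esub> ((mono r (G1, L, H) \<otimes>\<^bsub>A\<^esub> a) \<odot>\<^bsub>V\<^esub> ?w))"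
    using b(1) m ra(2) v(1) by (simp add: V.smult_assoc)
  moreover have "e' \<odot>\<^bsub>V\<^esub> ?w = ?w" using V.smult_assoc[OF e_closed e_closed v(1)] by simp
  ultimately show False using b(2) v(2) by simp
qed

text \<open>
  On \<open>e'D\<close>, which is isomorphic to the inflated module, \<open>J\<^sub>e\<close> acts as zero.  It then acts as zero on the head \<open>D\<close>, since
  \<open>x = x e'\<close> for every \<open>x\<close> in \<open>J\<^sub>e\<close>.
\<close>

lemma apex_head_module:
  assumes "simple_module \<Lambda> T"
  shows "apex (head_module C R s T) s"
proof -
  let ?D = "head_module C R s T" and ?I = "inflation C R s T"
  note D = simple_head_module[OF assms]
  interpret D: left_module A ?D by (rule simple_moduleD(1)[OF D(1)])
  have I: "simple_module B ?I" by (rule simple_inflation[OF assms])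
  interpret I: left_module B ?I by (rule simple_moduleD(1)[OF I])
  interpret T: left_module \<Lambda> T by (rule simple_moduleD(1)[OF assms])
  have Dc: "left_module B (corner_module A e' ?D)" by (rule left_module_corner[OF D.left_module_axioms])
  obtain f where f: "module_bij f B ?I (corner_module A e' ?D)"
    using D(2) by (auto simp: module_iso_iff_bij)
  note f = module_bijD[OF f]
  have f0: "f \<zero>\<^bsub>?I\<^esub> = \<zero>\<^bsub>?D\<^esub>" using module_iso_zero[OF I.left_module_axioms Dc f(1,2)] by simp
  have surj: "\<exists>t\<in>carrier ?I. y = f t" if "y \<in> carrier ?D" "e' \<odot>\<^bsub>?D\<^esub> y = y" for y
  proof -
    have "y \<in> f ` carrier ?I" using f(1) that by (simp add: bij_betw_def)
    then show ?thesis by blast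
  qed
  show ?thesis
  proof (rule apexI[OF D(1)])
    have "\<exists>t\<in>carrier ?I. t \<noteq> \<zero>\<^bsub>?I\<^esub>" using simple_moduleD(2)[OF I] I.M.zero_closed by blast
    then obtain t where t: "t \<in> carrier ?I" "t \<noteq> \<zero>\<^bsub>?I\<^esub>" by blast
    then have "f t \<noteq> f \<zero>\<^bsub>?I\<^esub>" using f(1) I.M.zero_closed by (auto simp: bij_betw_def inj_on_eq_iff)
    moreover have "f t \<in> carrier ?D" "e' \<odot>\<^bsub>?D\<^esub> f t = f t" using f(4)[OF t(1)] by auto
    ultimately show "\<not> kills ?D (e_mor s)"
      using f0 unfolding kills_e_iff[OF D.left_module_axioms] by metis
    fix x assume x: "x \<in> J_set C s"
    have xB: "x \<in> local_basis" using x local_basis_split by blast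
    show "kills ?D x" unfolding kills_def
    proof (intro ballI)
      fix r v assume rv: "r \<in> carrier R" "v \<in> carrier ?D"
      have c: "mono r x \<in> carrier B"
        unfolding corner_span using BP.mono_in_basis_span[OF rv(1) xB] .
      let ?y = "e' \<odot>\<^bsub>?D\<^esub> v"
      have y: "?y \<in> carrier ?D" "e' \<odot>\<^bsub>?D\<^esub> ?y = ?y"
        using corner_image[OF D.left_module_axioms rv(2)] by auto
      obtain t where t: "t \<in> carrier ?I" "?y = f t" using surj[OF y] by blast
      have "mono r x \<odot>\<^bsub>?D\<^esub> v = (mono r x \<otimes>\<^bsub>A\<^esub> e') \<odot>\<^bsub>?D\<^esub> v" using c by (simp add: corner_carrier)
      also have "\<dots> = mono r x \<odot>\<^bsub>?D\<^esub> f t"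
        using D.smult_assoc[OF _ e_closed rv(2), of "mono r x"] c t(2) by (simp only: corner_carrier)
      also have "\<dots> = f (mono r x \<odot>\<^bsub>?I\<^esub> t)" using f(3)[OF c t(1)] by simp
      also have "mono r x \<odot>\<^bsub>?I\<^esub> t = \<zero>\<^bsub>?I\<^esub>"
        using \<rho>_J[OF rv(1) x] t(1) by (simp add: inflation_eq)
      finally show "mono r x \<odot>\<^bsub>?D\<^esub> v = \<zero>\<^bsub>?D\<^esub>" using f0 by simp
    qed
  qed
qed

text \<open>Both modules have the same corner: \<open>T\<close> is the representative whose inflation is isomorphic to \<open>e'V\<close>.\<close>

lemma simple_with_apex:
  fixes V :: "('g morphism \<Rightarrow> 'r, 'm) module"
  assumes V: "simple_module A V" and apex: "apex V s"
    and reps: "simple_representatives \<Lambda> (\<T> :: (('g set \<Rightarrow> 'g set) \<Rightarrow> 'r, 't) module set)"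
  shows "\<exists>T\<in>\<T>. module_iso A V (head_module C R s T)"
proof -
  interpret V: left_module A V by (rule simple_moduleD(1)[OF V])
  let ?U = "corner_module A e' V"
  have nz: "\<exists>v\<in>carrier V. e' \<odot>\<^bsub>V\<^esub> v \<noteq> \<zero>\<^bsub>V\<^esub>" by (rule apex_corner_nonzero[OF V.left_module_axioms apex])
  have U: "simple_module B ?U" by (rule simple_module_corner[OF V nz])
  obtain T0 :: "(('g set \<Rightarrow> 'g set) \<Rightarrow> 'r, 'm) module"
    where T0: "simple_module \<Lambda> T0" "module_iso B ?U (inflation C R s T0)"
  proof (rule inflated_if_J_zero[OF U])
    show "j \<odot>\<^bsub>?U\<^esub> u = \<zero>\<^bsub>?U\<^esub>" if "j \<in> basis_span R (Mor C) (J_set C s)" "u \<in> carrier ?U" for j u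
      using apex_J_zero[OF V.left_module_axioms apex that(1)] that(2) by simp
  qed
  obtain T1 :: "(('g set \<Rightarrow> 'g set) \<Rightarrow> 'r, (('g set \<Rightarrow> 'g set) \<Rightarrow> 'r) set) module"
    where T1: "simple_module \<Lambda> T1" "module_iso \<Lambda> T0 T1" using simple_module_copy[OF T0(1)] by blast
  obtain T where T: "T \<in> \<T>" "module_iso \<Lambda> T1 T" "simple_module \<Lambda> T"
    using reps T1(1) unfolding simple_representatives_def by blast
  have "module_iso \<Lambda> T0 T" by (rule module_iso_trans[OF T1(2) T(2)])
  then have "module_iso B (inflation C R s T0) (inflation C R s T)" by (simp add: inflation_iso_iff)
  then have "module_iso B ?U (corner_module A e' (head_module C R s T))"
    using module_iso_trans[OF module_iso_trans[OF T0(2)] simple_head_module(2)[OF T(3)]] by blast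
  then have "module_iso A V (head_module C R s T)"
    by (rule simple_modules_iso_if_corners_iso[OF V simple_head_module(1)[OF T(3)] nz])
  then show ?thesis using T(1) by blast
qed

lemma head_module_iso_imp_iso:
  assumes T: "simple_module \<Lambda> T" and T': "simple_module \<Lambda> T'"
    and iso: "module_iso A (head_module C R s T) (head_module C R s T')"
  shows "module_iso \<Lambda> T T'"
proof -
  note D = simple_head_module[OF T] and D' = simple_head_module[OF T']
  have "module_iso B (corner_module A e' (head_module C R s T)) (corner_module A e' (head_module C R s T'))"
    by (rule module_iso_corner[OF simple_moduleD(1)[OF D(1)] iso])
  moreover have "module_iso B (corner_module A e' (head_module C R s T')) (inflation C R s T')"
    by (rule module_iso_sym[OF simple_moduleD(1)[OF simple_inflation[OF T']] D'(2)])
  ultimately have "module_iso B (inflation C R s T) (inflation C R s T')"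
    using module_iso_trans[OF D(2) module_iso_trans] by blast
  then show ?thesis by (simp add: inflation_iso_iff)
qed

end

context star_category
begin

text \<open>
  If \<open>s\<close> and \<open>t\<close> are both apexes of \<open>V\<close>, some \<open>L = e\<^sub>t * L * e\<^sub>s\<close> acts nontrivially on \<open>V\<close>.  Then
  \<open>q(L)\<close> has the order of both sections, so \<open>L\<close> is the graph of an isomorphism between them.
\<close>

lemma apex_unique:
  assumes V: "simple_module A V" and s: "apex V s" and t: "apex V t"
  shows "section_iso s t"
proof -
  interpret V: left_module A V by (rule simple_moduleD(1)[OF V])
  obtain G P K where se: "s = (G, P, K)" by (cases s)
  obtain H P' K' where te: "t = (H, P', K')" by (cases t)
  have sC: "(G, P, K) \<in> C_sections C" "(H, P', K') \<in> C_sections C"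
    using s t se te by (auto simp: apex_def)
  interpret S: star_section \<O> C R G P K by (rule C_section_locale[OF sC(1)])
  interpret T: star_section \<O> C R H P' K' by (rule C_section_locale[OF sC(2)])
  obtain v where v: "v \<in> carrier V" "S.e' \<odot>\<^bsub>V\<^esub> v \<noteq> \<zero>\<^bsub>V\<^esub>"
    using S.apex_corner_nonzero[OF V.left_module_axioms] s se by blast
  have tn: "\<not> kills V (H, T.e, H)" using t te by (auto simp: apex_def e_mor_def)
  let ?w = "S.e' \<odot>\<^bsub>V\<^esub> v"
  have w: "?w \<in> carrier V" using v by simp
  obtain r a where ra: "r \<in> carrier R" "a \<in> carrier A" "(mono r (H, T.e, H) \<otimes>\<^bsub>A\<^esub> a) \<odot>\<^bsub>V\<^esub> ?w \<noteq> \<zero>\<^bsub>V\<^esub>"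
    using simple_generated[OF V w v(2) tn] .
  let ?Y = "{(G1, L, G2). G1 = H \<and> G2 = G \<and> L \<in> Hom C H G \<and> T.e O L = L \<and> L O S.e = L}"
  let ?Y1 = "{(G1, L, G2). G1 = H \<and> G2 \<in> Ob C \<and> L \<in> Hom C H G2 \<and> T.e O L = L}"
  have m: "mono r (H, T.e, H) \<in> carrier A" by (rule mono_carrier[OF ra(1)])
  have m1: "mono r (H, T.e, H) \<in> basis_span R (Mor C) {(H, T.e, H)}"
    by (rule BP.mono_in_basis_span[OF ra(1)]) simp
  have "mono r (H, T.e, H) \<otimes>\<^bsub>A\<^esub> a \<in> basis_span R (Mor C) ?Y1"
    by (rule span_mult[OF m1 ra(2)[unfolded carrier_A]])
      (use T.e_e Hom_comp T.Ob_G in \<open>auto simp: Mor_def O_assoc[symmetric]\<close>)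
  then have Y: "mono r (H, T.e, H) \<otimes>\<^bsub>A\<^esub> a \<otimes>\<^bsub>A\<^esub> S.e' \<in> basis_span R (Mor C) ?Y"
    by (rule span_mult[OF _ S.e'_span])
      (use S.e_e Hom_comp S.Ob_G in \<open>auto simp: Mor_def O_assoc, auto simp: O_assoc[symmetric]\<close>)
  have "(mono r (H, T.e, H) \<otimes>\<^bsub>A\<^esub> a \<otimes>\<^bsub>A\<^esub> S.e') \<odot>\<^bsub>V\<^esub> v \<noteq> \<zero>\<^bsub>V\<^esub>"
    using ra m v(1) by (simp add: V.smult_assoc)
  then obtain x where x: "x \<in> Mor C" "x \<in> ?Y" "\<not> kills V x"
    using kills_span[OF V.left_module_axioms _ Y v(1)] by blast
  then obtain L where L: "(H, L, G) \<in> Mor C" "T.e O L = L" "L O S.e = L" "\<not> kills V (H, L, G)" by auto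
  interpret L: prod_subgroup H G L using MorD[OF L(1)] by simp
  interpret L': prod_subgroup G H "L\<inverse>" by (rule L.converse)
  have "\<not> rank G L < srank s" "\<not> rank G L < srank t"
    using L s t unfolding apex_def by blast+
  moreover have "rank G L \<le> srank t"
    using rank_comp_left[OF T.E.prod_subgroup_axioms L.prod_subgroup_axioms] L L.prod_subgroup_axioms T.rank_e te by simp
  moreover have "rank G L \<le> srank s"
    using rank_comp_right[OF L.prod_subgroup_axioms S.E.prod_subgroup_axioms] L L.prod_subgroup_axioms S.rank_e se by simp
  ultimately have r: "rank G L = srank s" "rank G L = srank t" by auto
  have pk: "p1 L = P'" "k1 G L = K'"
    using L.rank_maximal[OF T.sec T.e_comp(2,3)[OF L(1,2)]] r(2) te by (auto simp: srank_def)
  have pk': "p2 L = P" "k2 H L = K"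
    using L'.rank_maximal[OF S.sec] S.comp_e(2,3)[OF L(1,3)] r(1) se L.rank_converse
    by (auto simp: srank_def k1_converse)
  obtain \<alpha> where "\<alpha> \<in> iso (sec_quot G P K) (sec_quot H P' K')"
    using L.goursat_lemma unfolding pk pk' by blast
  then show ?thesis by (auto simp: section_iso_def se te is_iso_def)
qed

text \<open>
  Condition (*) provides morphisms \<open>X\<close> from \<open>t\<close> to \<open>s\<close> and \<open>Y = e\<^sub>t * Y\<close> back such that \<open>X * Y\<close> is a unit of the local
  monoid at \<open>s\<close>.  So \<open>e\<^sub>s\<close> factors through \<open>e\<^sub>t\<close>, and if \<open>e\<^sub>t\<close> annihilates \<open>V\<close>, then so does \<open>e\<^sub>s\<close>.
\<close>

lemma apex_transfer:
  assumes V: "left_module A V" and s: "apex V s" and t: "t \<in> C_sections C" and iso: "section_iso s t"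
  shows "apex V t"
proof -
  obtain G P K where se: "s = (G, P, K)" by (cases s)
  obtain H P' K' where te: "t = (H, P', K')" by (cases t)
  have sC: "(G, P, K) \<in> C_sections C" "(H, P', K') \<in> C_sections C"
    using s t se te by (auto simp: apex_def)
  interpret S: star_section \<O> C R G P K by (rule C_section_locale[OF sC(1)])
  interpret T: star_section \<O> C R H P' K' by (rule C_section_locale[OF sC(2)])
  have iso1: "sec_quot G P K \<cong> sec_quot H P' K'" using iso by (simp add: section_iso_def se te)
  then have iso2: "sec_quot H P' K' \<cong> sec_quot G P K"
    using group.iso_sym[OF group_sec_quot[OF S.sec]] by blast
  have eq: "srank t = srank s" using iso_same_card[OF iso1] by (simp add: se te srank_def)
  obtain \<alpha> where \<alpha>: "\<alpha> \<in> iso (sec_quot H P' K') (sec_quot G P K)" "goursat G H P K \<alpha> P' K' \<in> Hom C G H"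
    using star_iso[OF S.me_Mor S.Ob_G T.Ob_G S.sec T.sec] iso1 iso_refl unfolding S.p_e S.k_e by blast
  obtain \<beta> where \<beta>: "\<beta> \<in> iso (sec_quot G P K) (sec_quot H P' K')" "goursat H G P' K' \<beta> P K \<in> Hom C H G"
    using star_iso[OF S.me_Mor T.Ob_G S.Ob_G T.sec S.sec] iso2 iso_refl unfolding S.p_e S.k_e by blast
  let ?X = "goursat G H P K \<alpha> P' K'" and ?Y = "goursat H G P' K' \<beta> P K"
  let ?\<gamma> = "restrict (\<lambda>U. \<alpha> (\<beta> U)) (carrier S.Q)"
  have XY: "?X O ?Y = goursat G G P K ?\<gamma> P K"
  proof -
    have "?X O ?Y = goursat G G P K (\<lambda>U. \<alpha> (\<beta> U)) P K"
      by (rule goursat_comp) (use \<beta>(1) in \<open>auto simp: iso_def hom_def\<close>)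
    then show ?thesis using goursat_cong[of G P K "\<lambda>U. \<alpha> (\<beta> U)" ?\<gamma> G P K] by simp
  qed
  have M: "(G, ?X, H) \<in> Mor C" "(H, ?Y, G) \<in> Mor C"
    using \<alpha>(2) \<beta>(2) S.Ob_G T.Ob_G by (auto simp: Mor_def)
  have "(\<lambda>U. \<alpha> (\<beta> U)) \<in> iso S.Q S.Q" using iso_set_trans[OF \<beta>(1) \<alpha>(1)] by (simp add: o_def)
  then have "?\<gamma> \<in> auto S.Q" using iso_restrict_auto group_sec_quot[OF S.sec] by blast
  then have \<gamma>: "?\<gamma> \<in> auts (G, P, K)"
    using comp_Mor[OF M] XY by (simp add: auts_iff Mor_def)
  let ?\<delta> = "inv\<^bsub>Aut_C C (G, P, K)\<^esub> ?\<gamma>"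
  have \<delta>: "?\<delta> \<in> auts (G, P, K)" using \<gamma> by simp
  have "?X O ?Y O goursat G G P K ?\<delta> P K = S.e"
    using S.gm_comp[OF \<gamma> \<delta>] XY \<gamma> S.gm_one by (simp add: O_assoc[symmetric])
  have "\<not> kills V (e_mor t)"
  proof
    assume k: "kills V (e_mor t)"
    have "T.e O ?Y = ?Y"
      using prod_subgroup.e_sec_comp[OF MorD(4)[OF M(2)] T.sec]
        goursat_sections[OF Ob_group(1)[OF T.Ob_G] Ob_group(1)[OF S.Ob_G] T.sec S.sec \<beta>(1)] by simp
    then have "kills V (H, ?Y, G)"
      using kills_comp[OF V T.me_Mor M(2)] k by (simp add: e_mor_def te)
    then have "kills V (H, ?Y O goursat G G P K ?\<delta> P K, G)"
      using kills_comp[OF V M(2) S.gm_Mor[OF \<delta>]] by blast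
    then have "kills V (G, ?X O ?Y O goursat G G P K ?\<delta> P K, G)"
      using kills_comp[OF V M(1) comp_Mor[OF M(2) S.gm_Mor[OF \<delta>]]] by blast
    then have "kills V (e_mor s)" using \<open>_ = S.e\<close> by (simp add: e_mor_def se)
    then show False using s by (simp add: apex_def)
  qed
  then show ?thesis using s t eq by (simp add: apex_def)
qed

end

section \<open>The classification of simple modules\<close>

theorem theorem6p5:
  fixes \<O> :: "'g monoid set"
    and C :: "'g subgroup_category"
    and R :: "'r ring"
    and S :: "('g monoid \<times> 'g set \<times> 'g set) set"
    and T :: "'g monoid \<times> 'g set \<times> 'g set \<Rightarrow> (('g set \<Rightarrow> 'g set) \<Rightarrow> 'r, 't) module set"
  assumes "represents_finite_groups \<O>"
    and "subcategory C (category_B \<O>)"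
    and "finite_category C"
    and "condition_star C"
    and "cring R"
    and "\<And>G. G \<in> Ob C \<Longrightarrow> nat_in R (order G) \<in> Units R"
    and "section_representatives C S"
    and "\<And>s. s \<in> S \<Longrightarrow> simple_representatives (group_algebra R (Aut_C C s)) (T s)"
  shows "(\<forall>s\<in>S. \<forall>V\<in>T s. simple_module (twisted_algebra C R) (head_module C R s V)) \<and>
    bij_betw (\<lambda>(s, V). iso_class (twisted_algebra C R) (head_module C R s V))
      (SIGMA s:S. T s) (simple_iso_classes (twisted_algebra C R))"
proof -
  interpret star_category \<O> C R using assms(1-6) by (rule star_category.intro)
  have S: "\<And>s. s \<in> S \<Longrightarrow> s \<in> C_sections C" "\<And>s t. s \<in> S \<Longrightarrow> t \<in> S \<Longrightarrow> section_iso s t \<Longrightarrow> s = t"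
    "\<And>s. s \<in> C_sections C \<Longrightarrow> \<exists>t\<in>S. section_iso s t"
    using assms(7) unfolding section_representatives_def by blast+
  have loc: "star_section \<O> C R (fst s) (fst (snd s)) (snd (snd s))" if "s \<in> S" for s
    by (rule C_section_locale) (use S(1)[OF that] in simp)
  have T: "\<And>s V. s \<in> S \<Longrightarrow> V \<in> T s \<Longrightarrow> simple_module (group_algebra R (Aut_C C s)) V"
    "\<And>s V W. s \<in> S \<Longrightarrow> V \<in> T s \<Longrightarrow> W \<in> T s \<Longrightarrow> module_iso (group_algebra R (Aut_C C s)) V W \<Longrightarrow> V = W"
    using assms(8) unfolding simple_representatives_def by blast+
  have head: "simple_module A (head_module C R s V)" "apex (head_module C R s V) s"
    if "s \<in> S" "V \<in> T s" for s V
    using star_section.simple_head_module(1)[OF loc[OF that(1)]]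
      star_section.apex_head_module[OF loc[OF that(1)]] T(1)[OF that] by auto
  have "bij_betw (\<lambda>(s, V). iso_class A (head_module C R s V)) (SIGMA s:S. T s) (simple_iso_classes A)"
    unfolding bij_betw_def
  proof (intro conjI inj_onI subset_antisym subsetI)
    fix p q assume p: "p \<in> (SIGMA s:S. T s)" and q: "q \<in> (SIGMA s:S. T s)"
      and eq: "(\<lambda>(s, V). iso_class A (head_module C R s V)) p = (\<lambda>(s, V). iso_class A (head_module C R s V)) q"
    obtain s V where pe: "p = (s, V)" "s \<in> S" "V \<in> T s" using p by blast
    obtain t W where qe: "q = (t, W)" "t \<in> S" "W \<in> T t" using q by blast
    have iso: "module_iso A (head_module C R s V) (head_module C R t W)"
      using eq pe qe iso_class_eq_iff[OF head(1)[OF pe(2,3)] head(1)[OF qe(2,3)]] by simp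
    then have "apex (head_module C R s V) t"
      using apex_iso[OF simple_moduleD(1) simple_moduleD(1) iso] head pe qe by blast
    then have "section_iso s t" using apex_unique head pe by blast
    then have st: "s = t" using S(2) pe qe by blast
    then have "module_iso (group_algebra R (Aut_C C s)) V W"
      using star_section.head_module_iso_imp_iso[OF loc[OF pe(2)], of V W] T(1)[OF pe(2,3)]
        T(1)[OF qe(2,3)] iso by simp
    then show "p = q" using T(2) pe qe st by blast
  next
    fix c assume "c \<in> (\<lambda>(s, V). iso_class A (head_module C R s V)) ` (SIGMA s:S. T s)"
    then obtain s V where "s \<in> S" "V \<in> T s" "c = iso_class A (head_module C R s V)" by blast
    then show "c \<in> simple_iso_classes A" using iso_class_in_simple_iso_classes[OF head(1)] by blast
  next
    fix c assume "c \<in> simple_iso_classes A"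
    then obtain M :: "('g morphism \<Rightarrow> 'r, ('g morphism \<Rightarrow> 'r) set) module"
      where M: "simple_module A M" "c = iso_class A M" unfolding simple_iso_classes_def by blast
    obtain s0 where s0: "apex M s0" using apex_exists[OF M(1)] by blast
    then have "s0 \<in> C_sections C" unfolding apex_def by blast
    then obtain s where s: "s \<in> S" "section_iso s0 s" using S(3) by blast
    have "apex M s" by (rule apex_transfer[OF simple_moduleD(1)[OF M(1)] s0 S(1)[OF s(1)] s(2)])
    then obtain V where V: "V \<in> T s" "module_iso A M (head_module C R s V)"
      using star_section.simple_with_apex[OF loc[OF s(1)] M(1)] assms(8)[OF s(1)] by auto
    then have "c = iso_class A (head_module C R s V)"
      using M iso_class_eq_iff head(1)[OF s(1) V(1)] by blast
    then show "c \<in> (\<lambda>(s, V). iso_class A (head_module C R s V)) ` (SIGMA s:S. T s)"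
      using s(1) V(1) by (intro image_eqI[of _ _ "(s, V)"]) auto
  qed
  then show ?thesis using head(1) by blast
qed

end
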